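(* Consider the following four families of lattice paths: (a) Dyck excursions of length $2n$; (b) Dyck bridges of length $2n$; (c) Motzkin excursions of length $n$; (d) Motzkin bridges of length $n$. For each family and real $q>0$, let $X_n=X_n(q)$ be the number of returns to zero of a path of the family of the given length, under the Gibbs distribution with weight $q$. Set \[(q_c,\tau_H,c_H)=\begin{cases}(2,\tfrac12,-\tfrac12)&\text{Dyck excursions},\\ (1,1,-1)&\text{Dyck bridges},\\ (\tfrac32,\tfrac23,-\tfrac1{\sqrt3})&\text{Motzkin excursions},\\ (1,1,-\tfrac2{\sqrt3})&\text{Motzkin bridges}.\end{cases}\] Then, as $n\to\infty$: for $0<q<q_c$, $X_n-1\xrightarrow{\mathcal{L}}\mathrm{NegBin}(2,1-q\tau_H)$; for $q=q_c$, $\frac{-c_H}{\tau_H}\frac{X_n}{\sqrt n}\xrightarrow{\mathcal{L}}\mathcal{R}(\sqrt2)$; for $q>q_c$, there are constants $\mu$ and $\sigma>0$ (depending on $q$ and the family) such that $\frac{X_n-\mu n}{\sigma\sqrt n}\xrightarrow{\mathcal{L}}\mathcal{N}(0,1)$.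
   Context: Dyck paths use steps $(1,1)$ and $(1,-1)$; Motzkin paths use steps $(1,1)$, $(1,0)$, $(1,-1)$. A bridge of length $N$ is a path from $(0,0)$ to $(N,0)$; an excursion is a bridge that never goes below the $x$-axis. The number of returns to zero of a path of length $N$ is the number of $i\in\{1,\dots,N\}$ such that the path is at height $0$ after $i$ steps. Gibbs distribution: for a finite family $\mathcal{T}_n$ of objects and a statistic $\mathcal{X}$, $X_n(q)$ has $\mathbb{P}(X_n(q)=k)=f_{n,k}q^k/\sum_j f_{n,j}q^j$, where $f_{n,k}$ is the number of objects in $\mathcal{T}_n$ with $\mathcal{X}=k$. $\mathrm{NegBin}(r,p)$: $\mathbb{P}(X=k)=\binom{k+r-1}{k}p^r(1-p)^k$, $k\ge0$. $\mathcal{R}(\sigma)$: Rayleigh law with density $\frac{x}{\sigma^2}e^{-x^2/(2\sigma^2)}$ on $x\ge0$. $\mathcal{N}(0,1)$: standard normal law. *)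

theory Defs
  imports "HOL-Probability.Probability"
begin

text \<open>
  A path starting at the origin is represented by the list of the vertical components
  of its steps, i.e. a step \<open>(1, s)\<close> is represented by \<open>s\<close>.
\<close>

definition dyck_steps :: "int set" where
  "dyck_steps = {1, -1}"

definition motzkin_steps :: "int set" where
  "motzkin_steps = {1, 0, -1}"

definition height :: "int list \<Rightarrow> nat \<Rightarrow> int" where
  "height w i = sum_list (take i w)"

definition bridges :: "int set \<Rightarrow> nat \<Rightarrow> int list set" where
  "bridges S N = {w. length w = N \<and> set w \<subseteq> S \<and> height w N = 0}"

definition excursions :: "int set \<Rightarrow> nat \<Rightarrow> int list set" where
  "excursions S N = {w \<in> bridges S N. \<forall>i\<le>N. height w i \<ge> 0}"

definition returns :: "int list \<Rightarrow> nat" where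
  "returns w = card {i \<in> {1..length w}. height w i = 0}"

datatype path_family = Dyck_Excursions | Dyck_Bridges | Motzkin_Excursions | Motzkin_Bridges

text \<open>For the Dyck families the parameter \<open>n\<close> is the half-length.\<close>

fun paths :: "path_family \<Rightarrow> nat \<Rightarrow> int list set" where
  "paths Dyck_Excursions n = excursions dyck_steps (2 * n)"
| "paths Dyck_Bridges n = bridges dyck_steps (2 * n)"
| "paths Motzkin_Excursions n = excursions motzkin_steps n"
| "paths Motzkin_Bridges n = bridges motzkin_steps n"

fun q_c :: "path_family \<Rightarrow> real" where
  "q_c Dyck_Excursions = 2"
| "q_c Dyck_Bridges = 1"
| "q_c Motzkin_Excursions = 3 / 2"
| "q_c Motzkin_Bridges = 1"

fun tau_H :: "path_family \<Rightarrow> real" where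
  "tau_H Dyck_Excursions = 1 / 2"
| "tau_H Dyck_Bridges = 1"
| "tau_H Motzkin_Excursions = 2 / 3"
| "tau_H Motzkin_Bridges = 1"

fun c_H :: "path_family \<Rightarrow> real" where
  "c_H Dyck_Excursions = - (1 / 2)"
| "c_H Dyck_Bridges = - 1"
| "c_H Motzkin_Excursions = - (1 / sqrt 3)"
| "c_H Motzkin_Bridges = - (2 / sqrt 3)"

definition num_objects :: "'a set \<Rightarrow> ('a \<Rightarrow> nat) \<Rightarrow> nat \<Rightarrow> nat" where
  "num_objects T X k = card {t \<in> T. X t = k}"

text \<open>
  The normalising sum ranges over the values attained by \<open>X\<close>; all other terms vanish.
  The definition is meaningful for finite nonempty \<open>T\<close> and \<open>q > 0\<close>,
  see \<open>pmf_gibbs_pmf\<close> below.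
\<close>

definition gibbs_pmf :: "'a set \<Rightarrow> ('a \<Rightarrow> nat) \<Rightarrow> real \<Rightarrow> nat pmf" where
  "gibbs_pmf T X q = embed_pmf (\<lambda>k.
     real (num_objects T X k) * q ^ k / (\<Sum>j\<in>X ` T. real (num_objects T X j) * q ^ j))"

lemma pmf_gibbs_pmf:
  assumes "finite T" "T \<noteq> {}" "q > 0"
  shows "pmf (gibbs_pmf T X q) k =
    real (num_objects T X k) * q ^ k / (\<Sum>j\<in>X ` T. real (num_objects T X j) * q ^ j)"
proof -
  define Z where "Z = (\<Sum>j\<in>X ` T. real (num_objects T X j) * q ^ j)"
  define p where "p = (\<lambda>k. real (num_objects T X k) * q ^ k / Z)"
  have pos: "real (num_objects T X j) * q ^ j > 0" if "j \<in> X ` T" for j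
  proof -
    have "finite {t \<in> T. X t = j}" "{t \<in> T. X t = j} \<noteq> {}"
      using that assms by auto
    then have "num_objects T X j > 0"
      unfolding num_objects_def by (subst card_gt_0_iff) blast
    then show ?thesis using assms by simp
  qed
  have "Z > 0"
    unfolding Z_def using assms pos by (intro sum_pos) auto
  have nonneg: "p k \<ge> 0" for k
    using \<open>Z > 0\<close> assms by (simp add: p_def)
  have supp: "p k = 0" if "k \<notin> X ` T" for k
  proof -
    have "{t \<in> T. X t = k} = {}" using that by auto
    then have "num_objects T X k = 0" by (simp only: num_objects_def card.empty)
    then show ?thesis by (simp add: p_def)
  qed
  have "(\<integral>\<^sup>+ k. ennreal (p k) \<partial>count_space UNIV) = (\<Sum>k\<in>X ` T. ennreal (p k))"
    using assms supp by (intro nn_integral_count_space') auto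
  also have "\<dots> = ennreal (\<Sum>k\<in>X ` T. p k)"
    using nonneg by (intro sum_ennreal) auto
  also have "(\<Sum>k\<in>X ` T. p k) = 1"
    using \<open>Z > 0\<close> by (simp add: p_def Z_def flip: sum_divide_distrib)
  finally have "pmf (embed_pmf p) k = p k"
    by (intro pmf_embed_pmf nonneg) simp
  then show ?thesis
    by (simp add: gibbs_pmf_def p_def Z_def)
qed

lemma finite_paths: "finite (paths F n)"
proof -
  have 1: "finite (bridges S N)" if "finite S" for S N
    by (rule finite_subset[OF _ finite_lists_length_eq[OF that, of N]])
       (auto simp: bridges_def)
  have 2: "finite (excursions S N)" if "finite S" for S N
    using 1[OF that] by (simp add: excursions_def)
  show ?thesis
    by (cases F) (auto simp: dyck_steps_def motzkin_steps_def intro: 1 2)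
qed

lemma paths_nonempty: "paths F n \<noteq> {}"
proof -
  have D: "replicate n 1 @ replicate n (-1) \<in> excursions dyck_steps (2 * n)"
    by (auto simp: excursions_def bridges_def height_def dyck_steps_def sum_list_replicate
        min_def of_nat_diff)
  have M: "replicate n 0 \<in> excursions motzkin_steps n"
    by (auto simp: excursions_def bridges_def height_def motzkin_steps_def sum_list_replicate)
  show ?thesis
    using D M by (cases F) (auto simp: excursions_def)
qed

definition returns_pmf :: "path_family \<Rightarrow> real \<Rightarrow> nat \<Rightarrow> nat pmf" where
  "returns_pmf F q n = gibbs_pmf (paths F n) returns q"

definition rayleigh_density :: "real \<Rightarrow> real \<Rightarrow> real" where
  "rayleigh_density \<sigma> x = (if x \<ge> 0 then x / \<sigma>\<^sup>2 * exp (- x\<^sup>2 / (2 * \<sigma>\<^sup>2)) else 0)"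

definition rayleigh_distribution :: "real \<Rightarrow> real measure" where
  "rayleigh_distribution \<sigma> = density lborel (\<lambda>x. ennreal (rayleigh_density \<sigma> x))"

end

theory Submission
  imports Defs "HOL-Computational_Algebra.Polynomial_FPS" "HOL-Real_Asymp.Real_Asymp"
begin

text \<open>
  The substitution \<open>z = y / (1 + b y + y\<^sup>2)\<close>, with \<open>b = 1\<close> for Motzkin paths and \<open>b = 2\<close> for Dyck paths counted by
  half-length, turns the generating function of the arches of all four families into
  \<open>y (\<beta> + \<gamma> y) / (1 + b y + y\<^sup>2)\<close>. The number of paths with \<open>k\<close> returns is then a coefficient of an explicit polynomial;
  by the cycle lemma it is \<open>\<gamma> k / (n - k)\<close> times an integral over the unit circle, to which Laplace's method
  applies uniformly for \<open>k = O(sqrt n)\<close>.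

  Below the critical weight, dominated summation gives convergence of the point probabilities. At the critical weight the local
  limit is the Rayleigh density, and Scheffe's lemma gives weak convergence. Above it, the generating function with
  \<open>q exp(i s / sqrt n)\<close> in place of \<open>q\<close> has a dominant simple pole that moves analytically, so the characteristic functions
  behave like \<open>n\<close>-th powers and converge to that of the normal law.
\<close>

section \<open>Counting walks by their returns\<close>

text \<open>The variable \<open>y\<close> enumerates climbs by one level:
  \<open>y = z phi(y)\<close> decomposes such a climb, and a return to the axis costs
  \<open>z\<close> times \<open>\<beta>\<close> (from the axis itself) or \<open>\<gamma> y\<close>
  (from a neighbouring height). In \<open>y\<close> the square-root singularity of the arches
  becomes the ordinary point \<open>y = 1\<close>, and summing over the number of returns with
  weight \<open>u\<close> gives a rational function with denominator
  \<open>phi(y) - u y (\<beta> + \<gamma> y)\<close>. The phases differ in whether this denominator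
  has a zero with \<open>0 < y < 1\<close>, its first positive zero at \<open>y = 1\<close>, or none
  with \<open>0 < y \<le> 1\<close>; hence the critical weight is the reciprocal of the arch series
  at \<open>y = 1\<close>. Lagrange inversion only suggests the coefficient formula. It is verified
  against the recurrence that deletes the last step. Measuring Dyck paths by half-length is more
  than a convenience: for \<open>b = 0\<close> the circle integrand \<open>cos x\<close> has modulus
  1 at \<open>x = pi\<close> as well as at \<open>0\<close>, and Laplace's method would meet a
  second peak. With \<open>b = 2\<close> only the peak at \<open>0\<close> is left.\<close>

definition walks :: "int set \<Rightarrow> bool \<Rightarrow> nat \<Rightarrow> int \<Rightarrow> nat \<Rightarrow> int list set" where
  "walks S nn N h k = {w. length w = N \<and> set w \<subseteq> S \<and> sum_list w = h \<and> returns w = k \<and>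
     (nn \<longrightarrow> (\<forall>i\<le>N. height w i \<ge> 0))}"

lemma height_snoc:
  "i \<le> length v \<Longrightarrow> height (v @ [s]) i = height v i"
  "height (v @ [s]) (Suc (length v)) = sum_list v + s"
  by (auto simp: height_def)

lemma returns_snoc: "returns (v @ [s]) = returns v + of_bool (sum_list v + s = 0)"
proof -
  have "{i \<in> {1..length (v @ [s])}. height (v @ [s]) i = 0} =
    {i \<in> {1..length v}. height v i = 0} \<union> {i. i = Suc (length v) \<and> sum_list v + s = 0}"
    by (auto simp: le_Suc_eq height_snoc)
  then show ?thesis
    unfolding returns_def by (auto simp: card_Un_disjoint)
qed

lemma walks_0: "walks S nn 0 h k = (if h = 0 \<and> k = 0 then {[]} else {})"
proof -
  have *: "{i. i = 0 \<and> Suc 0 \<le> i} = {}" by auto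
  show ?thesis by (auto simp: walks_def returns_def height_def *)
qed

lemma walks_negative: "h < 0 \<Longrightarrow> walks S True N h k = {}"
  by (auto simp: walks_def height_def)

lemma finite_walks: "finite S \<Longrightarrow> finite (walks S nn N h k)"
  by (rule finite_subset[OF _ finite_lists_length_eq[of S N]]) (auto simp: walks_def)

text \<open>Only the endpoint is new compared with the prefix \<open>v\<close>. It adds a return
  exactly when \<open>h = 0\<close>, and the hypothesis makes it admissible for excursions.\<close>

lemma walks_Suc:
  assumes "\<not> (nn \<and> h < 0)"
  shows "walks S nn (Suc N) h k =
    (\<Union>s\<in>S. (\<lambda>v. v @ [s]) ` {v. \<exists>j. v \<in> walks S nn N (h - s) j \<and> k = j + of_bool (h = 0)})"
    (is "_ = ?R")
proof (intro set_eqI iffI)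
  fix w assume w: "w \<in> walks S nn (Suc N) h k"
  then obtain v s where ws: "w = v @ [s]" "length v = N"
    by (cases w rule: rev_cases) (auto simp: walks_def)
  have "nn \<Longrightarrow> i \<le> N \<Longrightarrow> height v i \<ge> 0" for i
    using w ws by (auto simp: walks_def height_snoc dest!: spec[of _ i])
  then have "v \<in> walks S nn N (h - s) (returns v)"
    using w ws by (auto simp: walks_def)
  moreover have "k = returns v + of_bool (h = 0)" "s \<in> S"
    using w ws by (auto simp: walks_def returns_snoc)
  ultimately show "w \<in> ?R"
    using ws by blast
next
  fix w assume "w \<in> ?R"
  then obtain v s j where *: "s \<in> S" "w = v @ [s]" "v \<in> walks S nn N (h - s) j"
    "k = j + of_bool (h = 0)" by auto
  then have len: "length v = N" "sum_list v + s = h" by (auto simp: walks_def)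
  have "height w i \<ge> 0" if "nn" "i \<le> Suc N" for i
  proof (cases "i = Suc N")
    case True
    then show ?thesis using height_snoc(2)[of v s] len * assms that by auto
  next
    case False
    then show ?thesis using height_snoc(1)[of i v s] len * that by (auto simp: walks_def)
  qed
  then show "w \<in> walks S nn (Suc N) h k"
    using * len by (auto simp: walks_def returns_snoc)
qed

lemma card_walks_Suc:
  assumes "\<not> (nn \<and> h < 0)" "finite S"
  shows "card (walks S nn (Suc N) h k) =
    (\<Sum>s\<in>S. card {v. \<exists>j. v \<in> walks S nn N (h - s) j \<and> k = j + of_bool (h = 0)})"
proof -
  have fin: "finite {v. \<exists>j. v \<in> walks S nn N (h - s) j \<and> k = j + of_bool (h = 0)}" for s
  proof (rule finite_subset)
    show "{v. \<exists>j. v \<in> walks S nn N (h - s) j \<and> k = j + of_bool (h = 0)} \<subseteq>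
      (\<Union>j\<in>{..k}. walks S nn N (h - s) j)"
      by fastforce
  qed (use assms finite_walks in auto)
  show ?thesis
    unfolding walks_Suc[OF assms(1)]
    by (subst card_UN_disjoint) (use assms fin in \<open>auto intro!: sum.cong card_image inj_onI\<close>)
qed

lemma card_walks_Suc_nonzero:
  assumes "\<not> (nn \<and> h < 0)" "finite S" "h \<noteq> 0"
  shows "card (walks S nn (Suc N) h k) = (\<Sum>s\<in>S. card (walks S nn N (h - s) k))"
  by (subst card_walks_Suc) (use assms in auto)

lemma card_walks_Suc_zero:
  assumes "finite S"
  shows "card (walks S nn (Suc N) 0 0) = 0"
    and "card (walks S nn (Suc N) 0 (Suc k)) = (\<Sum>s\<in>S. card (walks S nn N (- s) k))"
  by (subst card_walks_Suc; use assms in auto)+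

section \<open>Lagrange coefficients that satisfy the last-step recurrence\<close>

abbreviation phi :: "complex \<Rightarrow> complex fps" where
  "phi b \<equiv> 1 + fps_const b * fps_X + fps_X ^ 2"

text \<open>
  With \<open>z = y / phi(y)\<close> the arches have generating function \<open>H(z) = y (\<beta> + \<gamma> y) / phi(y)\<close>, and a final
  climb to height \<open>h\<close> contributes \<open>y ^ h\<close>. By Lagrange inversion \<open>walk_coeff\<close> is the coefficient of
  \<open>z ^ N\<close> in \<open>H(z) ^ k y ^ h\<close>.
\<close>

definition walk_coeff :: "complex \<Rightarrow> complex \<Rightarrow> complex \<Rightarrow> nat \<Rightarrow> nat \<Rightarrow> nat \<Rightarrow> complex" where
  "walk_coeff b \<beta> \<gamma> N h k = fps_nth (fps_X ^ h * (fps_X * (fps_const \<beta> + fps_const \<gamma> * fps_X)) ^ k *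
      phi b ^ N * inverse (phi b) ^ Suc k * (1 - fps_X ^ 2)) N"

lemma phi_inverse: "phi b * inverse (phi b) = 1"
  by (rule inverse_mult_eq_1') simp

lemma fps_nth_X_mult_Suc: "fps_nth (fps_X * P) (Suc n) = fps_nth (P :: complex fps) n"
  by simp

lemma walk_coeff_0: "walk_coeff b \<beta> \<gamma> 0 h k = of_bool (h = 0 \<and> k = 0)"
  by (cases h; cases k) (simp_all add: walk_coeff_def power2_eq_square)

text \<open>The extra factor \<open>phi b\<close> is the last step: its terms \<open>1\<close>,
  \<open>b X\<close>, \<open>X\<^sup>2\<close> stand for arrivals from below, from the same height
  and from above.\<close>

lemma walk_coeff_Suc_height:
  "walk_coeff b \<beta> \<gamma> (Suc N) (Suc h) k =
     walk_coeff b \<beta> \<gamma> N h k + b * walk_coeff b \<beta> \<gamma> N (Suc h) k + walk_coeff b \<beta> \<gamma> N (Suc (Suc h)) k"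
proof -
  define Q where "Q = (fps_X * (fps_const \<beta> + fps_const \<gamma> * fps_X)) ^ k *
      phi b ^ N * inverse (phi b) ^ Suc k * (1 - fps_X ^ 2)"
  have "walk_coeff b \<beta> \<gamma> (Suc N) (Suc h) k = fps_nth (fps_X * (fps_X ^ h * phi b * Q)) (Suc N)"
    by (simp only: walk_coeff_def Q_def power_Suc mult_ac)
  also have "\<dots> = fps_nth (fps_X ^ h * Q + fps_const b * (fps_X ^ Suc h * Q) + fps_X ^ Suc (Suc h) * Q) N"
    unfolding fps_nth_X_mult_Suc by (simp only: power_Suc power2_eq_square) (simp only: ring_distribs mult_1_right mult_1_left mult_ac)
  also have "\<dots> = walk_coeff b \<beta> \<gamma> N h k + b * walk_coeff b \<beta> \<gamma> N (Suc h) k + walk_coeff b \<beta> \<gamma> N (Suc (Suc h)) k"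
    by (simp only: fps_add_nth fps_mult_left_const_nth walk_coeff_def Q_def mult_ac)
  finally show ?thesis .
qed

text \<open>Here the extra \<open>phi b\<close> cancels against the extra
  \<open>inverse (phi b)\<close>, and one arch factor is left over: the axis is reached from itself
  (\<open>\<beta>\<close>) or from height 1 (\<open>\<gamma>\<close>).\<close>

lemma walk_coeff_Suc_return:
  "walk_coeff b \<beta> \<gamma> (Suc N) 0 (Suc k) = \<beta> * walk_coeff b \<beta> \<gamma> N 0 k + \<gamma> * walk_coeff b \<beta> \<gamma> N 1 k"
proof -
  define Q where "Q = (fps_X * (fps_const \<beta> + fps_const \<gamma> * fps_X)) ^ k *
      phi b ^ N * inverse (phi b) ^ Suc k * (1 - fps_X ^ 2)"
  have "walk_coeff b \<beta> \<gamma> (Suc N) 0 (Suc k) =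
    fps_nth (fps_X * ((phi b * inverse (phi b)) * ((fps_const \<beta> + fps_const \<gamma> * fps_X) * Q))) (Suc N)"
    by (simp only: walk_coeff_def Q_def power_Suc power_0 mult_1_left mult_ac)
  also have "\<dots> = fps_nth (fps_const \<beta> * Q + fps_const \<gamma> * (fps_X * Q)) N"
    unfolding fps_nth_X_mult_Suc phi_inverse by (simp only: ring_distribs mult_1_left mult_ac)
  also have "\<dots> = \<beta> * fps_nth Q N + \<gamma> * fps_nth (fps_X * Q) N"
    by (simp only: fps_add_nth fps_mult_left_const_nth)
  also have "fps_nth Q N = walk_coeff b \<beta> \<gamma> N 0 k"
    by (simp only: walk_coeff_def Q_def power_0 mult_1_left)
  also have "fps_nth (fps_X * Q) N = walk_coeff b \<beta> \<gamma> N 1 k"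
    by (simp only: walk_coeff_def Q_def power_one_right mult.assoc)
  finally show ?thesis .
qed

lemma fps_nth_mult_deriv: "fps_nth (fps_X * fps_deriv P) n = of_nat n * fps_nth (P :: complex fps) n"
  by (cases n) simp_all

text \<open>The factor \<open>1 - X\<^sup>2\<close> of \<open>walk_coeff\<close> is the Jacobian
  factor of Lagrange inversion; in this form it can be absorbed into a derivative.\<close>

lemma phi_minus_X_deriv: "phi b - fps_X * fps_deriv (phi b) = 1 - fps_X ^ 2"
  by (simp add: fps_deriv_power algebra_simps power2_eq_square)

text \<open>With \<open>n = N + 1\<close>, the series \<open>n phi^N (phi - X phi')\<close> equals
  \<open>n phi^n - X (phi^n)'\<close>. The operator \<open>X d/dX\<close> multiplies the coefficient
  of \<open>X^n\<close> by \<open>n\<close>, so the two terms cancel there.\<close>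

lemma walk_coeff_Suc_0_0: "walk_coeff b \<beta> \<gamma> (Suc N) 0 0 = 0"
proof -
  have "of_nat (Suc N) * (phi b ^ N * (1 - fps_X ^ 2)) =
     of_nat (Suc N) * phi b ^ Suc N - fps_X * fps_deriv (phi b ^ Suc N)"
  proof -
    have "c * (P ^ N * (P - fps_X * D)) = c * P ^ Suc N - fps_X * (c * D * P ^ N)"
      for c D P :: "complex fps"
      by (simp add: algebra_simps)
    then show ?thesis
      unfolding phi_minus_X_deriv[symmetric, of b] fps_deriv_power by (simp only: fps_of_nat diff_Suc_1)
  qed
  then have "fps_nth (fps_const (of_nat (Suc N)) * (phi b ^ N * (1 - fps_X ^ 2))) (Suc N) =
    fps_nth (fps_const (of_nat (Suc N)) * phi b ^ Suc N - fps_X * fps_deriv (phi b ^ Suc N)) (Suc N)"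
    by (simp only: fps_of_nat)
  then have "of_nat (Suc N) * fps_nth (phi b ^ N * (1 - fps_X ^ 2)) (Suc N) = 0"
    by (simp only: fps_mult_left_const_nth fps_sub_nth fps_nth_mult_deriv) simp
  moreover have "walk_coeff b \<beta> \<gamma> (Suc N) 0 0 =
      fps_nth ((phi b * inverse (phi b)) * (phi b ^ N * (1 - fps_X ^ 2))) (Suc N)"
    by (simp only: walk_coeff_def power_0 power_Suc mult_ac mult_1_left mult_1_right)
  ultimately show ?thesis
    unfolding phi_inverse by (simp del: of_nat_Suc)
qed

text \<open>Induction on the length, with one case per recurrence. A bridge reaches the axis equally
  often from \<open>1\<close> and from \<open>-1\<close>, hence \<open>2\<close> for
  \<open>\<gamma>\<close> and the absolute value of \<open>h\<close>; for excursions the term at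
  \<open>-1\<close> is zero.\<close>

lemma card_walks_eq_walk_coeff:
  fixes flat :: bool
  defines "S \<equiv> (if flat then motzkin_steps else dyck_steps)"
  shows "of_nat (card (walks S nn N h k)) =
    (if nn \<and> h < 0 then 0
     else walk_coeff (of_bool flat) (of_bool flat) (if nn then 1 else 2) N (nat \<bar>h\<bar>) k)"
proof (induction N arbitrary: h k)
  case 0
  show ?case by (auto simp: walks_0 walk_coeff_0)
next
  case (Suc N)
  let ?c = "walk_coeff (of_bool flat) (of_bool flat) (if nn then 1 else 2)"
  have fin: "finite S" by (simp add: S_def dyck_steps_def motzkin_steps_def)
  have sumS: "(\<Sum>s\<in>S. g s) = g 1 + of_bool flat * g 0 + g (-1)" for g :: "int \<Rightarrow> complex"
    by (simp add: S_def dyck_steps_def motzkin_steps_def)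
  consider "nn \<and> h < 0" | "\<not> (nn \<and> h < 0)" "h \<noteq> 0" | "h = 0" "k = 0" | k' where "h = 0" "k = Suc k'"
    by (cases k) auto
  then show ?case
  proof cases
    case 1
    then show ?thesis by (simp add: walks_negative)
  next
    case 2
    obtain m where m: "nat \<bar>h\<bar> = Suc m" using 2 by (cases "nat \<bar>h\<bar>") auto
    have *: "(of_nat :: nat \<Rightarrow> complex) (card (walks S nn (Suc N) h k)) =
       of_nat (card (walks S nn N (h - 1) k)) + of_bool flat * of_nat (card (walks S nn N h k))
       + of_nat (card (walks S nn N (h + 1) k))"
      using 2 fin by (simp add: card_walks_Suc_nonzero sumS)
    show ?thesis
    proof (cases "h > 0")
      case True
      then have "nat \<bar>h - 1\<bar> = m" "nat \<bar>h + 1\<bar> = Suc (Suc m)" using m by auto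
      then show ?thesis using True 2 m
        unfolding * Suc.IH by (simp add: walk_coeff_Suc_height)
    next
      case False
      then have "nat \<bar>h + 1\<bar> = m" "nat \<bar>h - 1\<bar> = Suc (Suc m)" using m 2 by auto
      then show ?thesis using False 2 m
        unfolding * Suc.IH by (simp add: walk_coeff_Suc_height)
    qed
  next
    case 3
    then show ?thesis using fin by (simp add: card_walks_Suc_zero walk_coeff_Suc_0_0)
  next
    case 4
    have "(of_nat :: nat \<Rightarrow> complex) (card (walks S nn (Suc N) h k)) =
       of_nat (card (walks S nn N (-1) k')) + of_bool flat * of_nat (card (walks S nn N 0 k'))
       + of_nat (card (walks S nn N 1 k'))"
      using 4 fin by (simp add: card_walks_Suc_zero sumS)
    then show ?thesis
      unfolding Suc.IH using 4 by (simp add: walk_coeff_Suc_return)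
  qed
qed

lemma fps_nth_compose_X2: "fps_nth (fps_compose P (fps_X ^ 2)) (2 * n) = fps_nth (P :: complex fps) n"
  by (simp add: fps_compose_nth fps_X_power_nth if_distrib sum.delta cong: if_cong flip: power_mult)

text \<open>Two steps of a Dyck walk make one step of a Motzkin walk with two flat steps.\<close>

lemma walk_coeff_double:
  "walk_coeff 0 0 \<gamma> (2 * n) 0 k = walk_coeff 2 \<gamma> \<gamma> n 0 k"
proof -
  let ?X = "fps_X :: complex fps"
  define Y where "Y = inverse (1 + ?X)"
  have Y: "(1 + ?X) * Y = 1" unfolding Y_def by (rule inverse_mult_eq_1') simp
  have phi2: "phi 2 = (1 + ?X) ^ 2"
    by (simp add: power2_eq_square algebra_simps numeral_fps_const[symmetric])
  \<comment> \<open>The series for \<open>b = 2\<close> after cancellation: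
    \<open>phi 2 = (1 + X)\<^sup>2\<close>, and the arch power together with
    \<open>1 - X\<^sup>2\<close> supplies \<open>k + 1\<close> factors \<open>1 + X\<close>, which
    remove half of the \<open>2 (k + 1)\<close> inverse factors. Replacing \<open>X\<close> by
    \<open>X\<^sup>2\<close> then yields the series for \<open>b = 0\<close>.\<close>
  define P where "P = (fps_const \<gamma> * ?X) ^ k * (1 + ?X) ^ (2 * n) * Y ^ Suc k * (1 - ?X)"
  have inv: "inverse (phi 2) = Y ^ 2"
    unfolding phi2 Y_def by (simp add: fps_inverse_power)
  have "(fps_X * (fps_const \<gamma> + fps_const \<gamma> * fps_X)) ^ k * phi 2 ^ n * inverse (phi 2) ^ Suc k * (1 - fps_X ^ 2)
    = (fps_const \<gamma> * ?X) ^ k * (1 + ?X) ^ (2 * n) * Y ^ Suc k * (1 - ?X) * ((1 + ?X) * Y) ^ Suc k"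
  proof -
    have 1: "fps_X * (fps_const \<gamma> + fps_const \<gamma> * fps_X) = fps_const \<gamma> * ?X * (1 + ?X)"
      and 2: "1 - fps_X ^ 2 = (1 - ?X) * (1 + ?X)"
      by (simp_all add: algebra_simps power2_eq_square)
    show ?thesis
      unfolding inv unfolding phi2 1 2
      by (simp add: power_mult_distrib power_mult power2_eq_square mult_ac)
  qed
  then have "walk_coeff 2 \<gamma> \<gamma> n 0 k = fps_nth P n"
    by (simp add: walk_coeff_def Y P_def)
  moreover have "walk_coeff 0 0 \<gamma> (2 * n) 0 k = fps_nth (fps_compose P (fps_X ^ 2)) (2 * n)"
  proof -
    have "fps_compose Y (?X ^ 2) = inverse (1 + ?X ^ 2)"
      unfolding Y_def by (subst fps_inverse_compose) (simp_all add: fps_compose_add_distrib)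
    then have "fps_compose P (?X ^ 2) = (fps_const \<gamma> * ?X ^ 2) ^ k * (1 + ?X ^ 2) ^ (2 * n) *
       inverse (1 + ?X ^ 2) ^ Suc k * (1 - ?X ^ 2)"
      unfolding P_def
      by (simp add: fps_compose_mult_distrib fps_compose_power[symmetric] fps_compose_add_distrib fps_compose_sub_distrib
           del: power_Suc)
    then show ?thesis
      by (simp add: walk_coeff_def power2_eq_square mult_ac)
  qed
  ultimately show ?thesis by (simp add: fps_nth_compose_X2)
qed

text \<open>
  Generating functions of the Dyck families are taken in the half-length, which makes \<open>b = 2\<close>;
  \<open>\<beta> + \<gamma> y\<close> is the arch polynomial.
\<close>

fun fam_b :: "path_family \<Rightarrow> real" where
  "fam_b Dyck_Excursions = 2" | "fam_b Dyck_Bridges = 2"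
| "fam_b Motzkin_Excursions = 1" | "fam_b Motzkin_Bridges = 1"

fun fam_beta :: "path_family \<Rightarrow> real" where
  "fam_beta Dyck_Excursions = 1" | "fam_beta Dyck_Bridges = 2"
| "fam_beta Motzkin_Excursions = 1" | "fam_beta Motzkin_Bridges = 1"

fun fam_gamma :: "path_family \<Rightarrow> real" where
  "fam_gamma Dyck_Excursions = 1" | "fam_gamma Dyck_Bridges = 2"
| "fam_gamma Motzkin_Excursions = 1" | "fam_gamma Motzkin_Bridges = 2"

lemma num_objects_bridges: "num_objects (bridges S N) returns k = card (walks S False N 0 k)"
  by (auto simp: num_objects_def bridges_def walks_def height_def intro!: arg_cong[where f = card])

lemma num_objects_excursions: "num_objects (excursions S N) returns k = card (walks S True N 0 k)"
  by (auto simp: num_objects_def excursions_def bridges_def walks_def height_def intro!: arg_cong[where f = card])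

lemma num_objects_paths:
  "of_nat (num_objects (paths F n) returns k) = walk_coeff (fam_b F) (fam_beta F) (fam_gamma F) n 0 k"
  using card_walks_eq_walk_coeff[of False True "2 * n" 0 k] card_walks_eq_walk_coeff[of False False "2 * n" 0 k]
    card_walks_eq_walk_coeff[of True True n 0 k] card_walks_eq_walk_coeff[of True False n 0 k]
  by (cases F) (simp_all add: num_objects_bridges num_objects_excursions walk_coeff_double)

section \<open>Coefficient extraction\<close>

abbreviation arch :: "complex \<Rightarrow> complex \<Rightarrow> complex fps" where
  "arch \<beta> \<gamma> \<equiv> fps_const \<beta> + fps_const \<gamma> * fps_X"

text \<open>For \<open>k < n\<close> the inverse powers of \<open>phi\<close> are absorbed and a
  polynomial remains, to which circle integrals apply. The case \<open>k = n\<close> is left to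
  \<open>walk_coeff_top\<close>.\<close>

lemma walk_coeff_return_eq:
  assumes "k < n"
  shows "walk_coeff b \<beta> \<gamma> n 0 k =
    fps_nth (arch \<beta> \<gamma> ^ k * phi b ^ (n - k - 1) * (1 - fps_X ^ 2)) (n - k)"
proof -
  have "phi b ^ n * inverse (phi b) ^ Suc k = phi b ^ (n - k - 1) * (phi b * inverse (phi b)) ^ Suc k"
  proof -
    have "phi b ^ n = phi b ^ (n - k - 1) * phi b ^ Suc k"
      unfolding power_add[symmetric] using assms by simp
    then show ?thesis by (simp only: power_mult_distrib mult_ac)
  qed
  then have *: "phi b ^ n * inverse (phi b) ^ Suc k = phi b ^ (n - k - 1)"
    unfolding phi_inverse by simp
  have "walk_coeff b \<beta> \<gamma> n 0 k =
    fps_nth (fps_X ^ k * (arch \<beta> \<gamma> ^ k * (phi b ^ n * inverse (phi b) ^ Suc k) * (1 - fps_X ^ 2))) n"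
    by (simp only: walk_coeff_def power_mult_distrib mult_ac power_0 mult_1_left mult_1_right)
  then show ?thesis
    unfolding * using assms by (simp only: fps_X_power_mult_nth) simp
qed

lemma walk_coeff_top: "walk_coeff b \<beta> \<gamma> n 0 n = \<beta> ^ n"
proof -
  have "phi b ^ n * inverse (phi b) ^ Suc n = inverse (phi b) * (phi b * inverse (phi b)) ^ n"
    by (simp only: power_mult_distrib mult_ac power_Suc)
  then have *: "phi b ^ n * inverse (phi b) ^ Suc n = inverse (phi b)"
    unfolding phi_inverse by simp
  have "walk_coeff b \<beta> \<gamma> n 0 n =
    fps_nth (fps_X ^ n * (arch \<beta> \<gamma> ^ n * (phi b ^ n * inverse (phi b) ^ Suc n) * (1 - fps_X ^ 2))) n"
    by (simp only: walk_coeff_def power_mult_distrib mult_ac power_0 mult_1_left mult_1_right)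
  then show ?thesis
    unfolding * fps_X_power_mult_nth by (simp add: fps_nth_power_0)
qed

lemma walk_coeff_eq_0:
  assumes "n < k"
  shows "walk_coeff b \<beta> \<gamma> n 0 k = 0"
proof -
  have "walk_coeff b \<beta> \<gamma> n 0 k =
    fps_nth (fps_X ^ k * (arch \<beta> \<gamma> ^ k * (phi b ^ n * inverse (phi b) ^ Suc k) * (1 - fps_X ^ 2))) n"
    by (simp only: walk_coeff_def power_mult_distrib mult_ac power_0 mult_1_left mult_1_right)
  then show ?thesis
    using assms unfolding fps_X_power_mult_nth by simp
qed

text \<open>The cycle lemma: integrating by parts with \<open>1 - X\<^sup>2 = phi - X phi'\<close> makes the factor \<open>k\<close> explicit.\<close>

lemma walk_coeff_cycle:
  assumes "1 \<le> k" "k < n"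
  shows "walk_coeff b \<beta> \<gamma> n 0 k =
    of_nat k * \<gamma> / of_nat (n - k) * fps_nth (arch \<beta> \<gamma> ^ (k - 1) * phi b ^ (n - k)) (n - k - 1)"
proof -
  define m where "m = n - k - 1"
  have m: "n - k = Suc m" using assms by (simp add: m_def)
  obtain l where k: "k = Suc l" using assms by (cases k) auto
  let ?c = "fps_const (of_nat (Suc m)) :: complex fps"
  let ?A = "arch \<beta> \<gamma>" and ?P = "phi b"
  have dA: "fps_deriv (?A ^ k) = fps_const (of_nat k * \<gamma>) * ?A ^ l"
  proof -
    have "fps_deriv ?A = fps_const \<gamma>" by simp
    then show ?thesis
      unfolding fps_deriv_power k by (simp only: fps_of_nat diff_Suc_1 fps_const_mult[symmetric])
  qed
  have dP: "fps_deriv (?P ^ Suc m) = ?c * fps_deriv ?P * ?P ^ m"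
    unfolding fps_deriv_power by (simp only: fps_of_nat diff_Suc_1)
  have alg: "c * (AA * P ^ m * (P - X * D)) = c * (AA * P ^ Suc m) - X * (AA * (c * D * P ^ m) + A' * P ^ Suc m) + X * (A' * P ^ Suc m)"
    for c AA P X D A' :: "complex fps"
    by (simp add: algebra_simps)
  \<comment> \<open>Product rule for \<open>arch^k phi^(m+1)\<close>. At index \<open>m + 1\<close>
    the first two terms on the right cancel, because \<open>X d/dX\<close> multiplies that
    coefficient by \<open>m + 1\<close>; what survives is the derivative of the arch power with its
    factor \<open>k \<gamma>\<close>.\<close>
  have "?c * (?A ^ k * ?P ^ m * (1 - fps_X ^ 2)) =
     ?c * (?A ^ k * ?P ^ Suc m) - fps_X * fps_deriv (?A ^ k * ?P ^ Suc m)
     + fps_X * (fps_const (of_nat k * \<gamma>) * ?A ^ l * ?P ^ Suc m)"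
    unfolding fps_deriv_mult dA dP unfolding phi_minus_X_deriv[symmetric, of b] by (rule alg)
  then have "fps_nth (?c * (?A ^ k * ?P ^ m * (1 - fps_X ^ 2))) (Suc m) =
     fps_nth (?c * (?A ^ k * ?P ^ Suc m) - fps_X * fps_deriv (?A ^ k * ?P ^ Suc m)
     + fps_X * (fps_const (of_nat k * \<gamma>) * ?A ^ l * ?P ^ Suc m)) (Suc m)"
    by (rule arg_cong)
  then have *: "of_nat (Suc m) * fps_nth (?A ^ k * ?P ^ m * (1 - fps_X ^ 2)) (Suc m) =
     of_nat k * \<gamma> * fps_nth (?A ^ l * ?P ^ Suc m) m"
    unfolding fps_sub_nth fps_add_nth fps_nth_mult_deriv unfolding fps_nth_X_mult_Suc
    by (simp only: fps_mult_left_const_nth mult.assoc) simp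
  show ?thesis
  proof -
    have "Z1 = of_nat k * \<gamma> / of_nat (Suc m) * Z2" if "of_nat (Suc m) * Z1 = of_nat k * \<gamma> * Z2" for Z1 Z2
      using that by (simp add: field_simps del: of_nat_Suc)
    from this[OF *] show ?thesis
      unfolding walk_coeff_return_eq[OF assms(2)] m by (simp only: k diff_Suc_1)
  qed
qed

text \<open>A geometric sum in \<open>x\<close>, the arch series times \<open>u\<close>. Its
  remainder contains \<open>x^(n+1)\<close>, is divisible by \<open>X^(n+1)\<close> and so cannot
  reach the coefficient of \<open>X^n\<close>.\<close>

lemma sum_walk_coeff:
  "(\<Sum>k\<le>n. walk_coeff b \<beta> \<gamma> n 0 k * u ^ k) =
    fps_nth (phi b ^ n * (1 - fps_X ^ 2) * inverse (phi b - fps_const u * fps_X * arch \<beta> \<gamma>)) n"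
proof -
  let ?P = "phi b" and ?A = "arch \<beta> \<gamma>"
  define x where "x = fps_const u * fps_X * ?A * inverse ?P"
  define D where "D = ?P - fps_const u * fps_X * ?A"
  define S where "S = (\<Sum>k\<le>n. x ^ k * inverse ?P)"
  have DD: "D * inverse D = 1"
    by (rule inverse_mult_eq_1') (simp add: D_def)
  have D: "?P * (1 - x) = D"
  proof -
    have "?P * x = fps_const u * fps_X * ?A * (?P * inverse ?P)"
      unfolding x_def by (simp only: mult_ac)
    then show ?thesis unfolding phi_inverse D_def right_diff_distrib by simp
  qed
  have "S * D = (?P * inverse ?P) * ((1 - x) * (\<Sum>k\<le>n. x ^ k))"
    unfolding S_def D[symmetric] sum_distrib_right[symmetric] by (simp only: mult_ac)
  then have "S * D = 1 - x ^ Suc n"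
    unfolding phi_inverse one_diff_power_eq by (simp only: lessThan_Suc_atMost mult_1_left)
  then have "S * D * inverse D = (1 - x ^ Suc n) * inverse D" by simp
  then have S: "S = inverse D - x ^ Suc n * inverse D"
    using DD by (simp add: mult.assoc ring_distribs)
  have "(\<Sum>k\<le>n. walk_coeff b \<beta> \<gamma> n 0 k * u ^ k) = fps_nth (?P ^ n * (1 - fps_X ^ 2) * S) n"
  proof -
    have "walk_coeff b \<beta> \<gamma> n 0 k * u ^ k = fps_nth (?P ^ n * (1 - fps_X ^ 2) * (x ^ k * inverse ?P)) n" for k
    proof -
      have "fps_nth (?P ^ n * (1 - fps_X ^ 2) * (x ^ k * inverse ?P)) n =
        fps_nth (fps_const (u ^ k) * ((fps_X * ?A) ^ k * ?P ^ n * inverse ?P ^ Suc k * (1 - fps_X ^ 2))) n"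
        unfolding x_def by (simp only: power_mult_distrib fps_const_power power_Suc mult_ac)
      then show ?thesis
        by (simp only: fps_mult_left_const_nth walk_coeff_def power_0 mult_1_left mult_ac)
    qed
    then show ?thesis
      by (simp add: S_def sum_distrib_left fps_sum_nth)
  qed
  also have "?P ^ n * (1 - fps_X ^ 2) * S = ?P ^ n * (1 - fps_X ^ 2) * inverse D -
     fps_X ^ Suc n * (?P ^ n * (1 - fps_X ^ 2) * (fps_const u * ?A * inverse ?P) ^ Suc n * inverse D)"
    unfolding S by (simp only: x_def right_diff_distrib power_mult_distrib mult_ac)
  also have "fps_nth \<dots> n = fps_nth (?P ^ n * (1 - fps_X ^ 2) * inverse D) n"
    by (simp only: fps_sub_nth fps_X_power_mult_nth) simp
  finally show ?thesis by (simp add: D_def)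
qed

section \<open>Coefficients as integrals over the unit circle\<close>

lemma integral_cis:
  "(\<integral>x. indicator {-pi..pi} x *\<^sub>R cis (of_int j * x) \<partial>lborel) = (if j = 0 then 2 * pi else 0)"
proof (cases "j = 0")
  case True
  have "(\<integral>x. indicator {-pi..pi} x *\<^sub>R (1::complex) \<partial>lborel) = 2 * pi"
    by (simp add: scaleR_conv_of_real)
  then show ?thesis using True by simp
next
  case False
  have D: "((\<lambda>x. cis (of_int j * x) / (\<i> * of_int j)) has_vector_derivative cis (of_int j * x)) (at x within A)" for x A
    unfolding has_vector_derivative_def
    by (rule derivative_eq_intros refl | simp add: False)+
       (use False in \<open>simp add: fun_eq_iff scaleR_conv_of_real field_simps\<close>)
  have "(\<integral>x. indicator {-pi..pi} x *\<^sub>R cis (of_int j * x) \<partial>lborel) =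
      cis (of_int j * pi) / (\<i> * of_int j) - cis (of_int j * (- pi)) / (\<i> * of_int j)"
    by (rule integral_FTC_atLeastAtMost[OF _ D]) (auto intro!: continuous_intros)
  also have "cis (of_int j * (- pi)) = cis (of_int j * pi)"
  proof -
    have "cis (of_int j * pi) = cis (of_int j * (- pi)) * cis (2 * pi * of_int j)"
      unfolding cis_mult by (rule arg_cong[where f = cis]) (simp add: algebra_simps)
    then show ?thesis by (simp add: cis_multiple_2pi)
  qed
  finally show ?thesis using False by simp
qed

lemma coeff_eq_integral:
  fixes P :: "complex poly"
  shows "coeff P m = (\<integral>x. indicator {-pi..pi} x *\<^sub>R (poly P (cis x) * cis (- real m * x)) \<partial>lborel) / (2 * pi)"
proof -
  have int: "integrable lborel (\<lambda>x. indicator {-pi..pi} x *\<^sub>R cis (real_of_int j * x))" for j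
    by (rule borel_integrable_compact[OF compact_Icc]) (auto intro!: continuous_intros)
  have "(\<integral>x. indicator {-pi..pi} x *\<^sub>R (poly P (cis x) * cis (- real m * x)) \<partial>lborel) =
    (\<integral>x. (\<Sum>i\<le>degree P. coeff P i * (indicator {-pi..pi} x *\<^sub>R cis (of_int (int i - int m) * x))) \<partial>lborel)"
  proof (intro Bochner_Integration.integral_cong refl)
    fix x
    have "cis x ^ i * cis (- real m * x) = cis (of_int (int i - int m) * x)" for i
      by (simp add: Complex.DeMoivre cis_mult algebra_simps)
    then show "indicator {-pi..pi} x *\<^sub>R (poly P (cis x) * cis (- real m * x)) =
      (\<Sum>i\<le>degree P. coeff P i * (indicator {-pi..pi} x *\<^sub>R cis (of_int (int i - int m) * x)))"
      by (simp add: poly_altdef sum_distrib_right scaleR_sum_right mult.assoc)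
  qed
  also have "\<dots> = (\<Sum>i\<le>degree P. coeff P i * (if int i - int m = 0 then 2 * pi else 0))"
    by (subst Bochner_Integration.integral_sum)
       (auto simp del: of_int_diff mult_scaleR_right simp: integral_cis int intro!: sum.cong)
  also have "\<dots> = coeff P m * (2 * pi)"
    by (cases "m \<le> degree P") (auto simp: if_distrib coeff_eq_0 scaleR_conv_of_real cong: if_cong)
  finally show ?thesis by simp
qed

text \<open>On the unit circle the palindromic \<open>phi\<close> is \<open>y (b + 2 cos x)\<close>.
  The phase \<open>cis (m x)\<close> of \<open>phi^m\<close> cancels against the index
  \<open>m - j\<close> up to \<open>cis (j x)\<close>, leaving a real power.\<close>

lemma fps_nth_arch_phi_integral:
  fixes b :: real
  assumes "j \<le> m"
  shows "fps_nth (arch \<beta> \<gamma> ^ l * phi b ^ m) (m - j) =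
    (\<integral>x. indicator {-pi..pi} x *\<^sub>R ((\<beta> + \<gamma> * cis x) ^ l * cis (real j * x) * of_real ((b + 2 * cos x) ^ m)) \<partial>lborel) / (2 * pi)"
proof -
  have "arch \<beta> \<gamma> = fps_of_poly [:\<beta>, \<gamma>:]" "phi b = fps_of_poly [:1, of_real b, 1:]"
    by (simp_all add: fps_of_poly_pCons algebra_simps power2_eq_square)
  then have "arch \<beta> \<gamma> ^ l * phi b ^ m = fps_of_poly ([:\<beta>, \<gamma>:] ^ l * [:1, of_real b, 1:] ^ m)"
    by (simp only: fps_of_poly_mult fps_of_poly_power)
  moreover have "poly ([:\<beta>, \<gamma>:] ^ l * [:1, of_real b, 1:] ^ m) (cis x) * cis (- real (m - j) * x) =
     (\<beta> + \<gamma> * cis x) ^ l * cis (real j * x) * of_real ((b + 2 * cos x) ^ m)" for x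
  proof -
    have "1 + cis x * (of_real b + cis x) = cis x * of_real (b + 2 * cos x)"
      using sin_cos_squared_add3[of x] by (simp add: complex_eq_iff algebra_simps)
    moreover have "cis (real m * x) * cis (- real (m - j) * x) = cis (real j * x)"
      unfolding cis_mult using assms by (intro arg_cong[where f = cis]) (simp add: of_nat_diff algebra_simps)
    ultimately show ?thesis
      by (simp add: power_mult_distrib Complex.DeMoivre mult_ac)
  qed
  ultimately show ?thesis by (simp only: fps_of_poly_nth coeff_eq_integral)
qed

section \<open>Laplace's method on the circle\<close>

lemma integrable_gaussian:
  assumes "d > 0"
  shows "integrable lborel (\<lambda>s::real. exp (- s\<^sup>2 / d))"
proof -
  have "integrable lborel (\<lambda>s. sqrt (pi * d) * normal_density 0 (sqrt (d / 2)) s)"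
    using assms by (intro integrable_mult_right integrable_normal_density) auto
  then show ?thesis
    using assms by (simp add: normal_density_def)
qed

lemma integral_gaussian_cis:
  fixes a d :: real
  assumes "d > 0"
  shows "(\<integral>s. cis (a * s) * of_real (exp (- s\<^sup>2 / d)) \<partial>lborel) = of_real (sqrt (pi * d) * exp (- a\<^sup>2 * d / 4))"
proof -
  \<comment> \<open>This scale turns \<open>exp (- s\<^sup>2 / d)\<close> into
    \<open>exp (- (c s)\<^sup>2 / 2)\<close>, so that the characteristic function of the standard
    normal law can be read off.\<close>
  define c where "c = sqrt (2 / d)"
  have c: "c > 0" "c\<^sup>2 = 2 / d" using assms by (auto simp: c_def)
  define t where "t = a / c"
  have "of_real (exp (- t\<^sup>2 / 2)) = (\<integral>x. std_normal_density x *\<^sub>R iexp (t * x) \<partial>lborel)"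
    using fun_cong[OF char_std_normal_distribution, of t]
    unfolding char_def by (subst (asm) integral_density) (auto simp: normal_density_nonneg)
  also have "\<dots> = c *\<^sub>R (\<integral>s. std_normal_density (c * s) *\<^sub>R iexp (t * (c * s)) \<partial>lborel)"
    using c by (subst lborel_integral_real_affine[of c _ 0]) auto
  also have "(\<lambda>s. std_normal_density (c * s) *\<^sub>R iexp (t * (c * s))) =
      (\<lambda>s. of_real (1 / sqrt (2 * pi)) * (cis (a * s) * of_real (exp (- s\<^sup>2 / d))))"
    using c assms
    by (auto simp: std_normal_density_def fun_eq_iff power_mult_distrib t_def cis_conv_exp scaleR_conv_of_real mult_ac)
  also have "c *\<^sub>R (\<integral>s. of_real (1 / sqrt (2 * pi)) * (cis (a * s) * of_real (exp (- s\<^sup>2 / d))) \<partial>lborel) =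
     of_real (c / sqrt (2 * pi)) * (\<integral>s. cis (a * s) * of_real (exp (- s\<^sup>2 / d)) \<partial>lborel)"
    by (simp add: scaleR_conv_of_real)
  also have "c / sqrt (2 * pi) = 1 / sqrt (pi * d)"
    using assms by (simp add: c_def real_sqrt_divide real_sqrt_mult field_simps)
  also have "- t\<^sup>2 / 2 = - a\<^sup>2 * d / 4"
    using assms by (simp add: t_def power_divide c(2))
  finally show ?thesis
    using assms by (simp add: field_simps)
qed

lemma integral_gaussian:
  fixes d :: real
  assumes "d > 0"
  shows "(\<integral>s. exp (- s\<^sup>2 / d) \<partial>lborel) = sqrt (pi * d)"
proof -
  have "of_real (\<integral>s. exp (- s\<^sup>2 / d) \<partial>lborel) = complex_of_real (sqrt (pi * d))"
    using integral_gaussian_cis[OF assms, of 0]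
    by (simp only: integral_complex_of_real mult_zero_left cis_zero mult_1_left) simp
  then show ?thesis using of_real_eq_iff by blast
qed

text \<open>Sine is concave on \<open>{0..pi/2}\<close> and lies above its chord, so
  \<open>sin (\<bar>x\<bar> / 2) \<ge> \<bar>x\<bar> / pi\<close>; the half-angle formula does the
  rest.\<close>

lemma one_minus_cos_ge:
  fixes x :: real
  assumes "\<bar>x\<bar> \<le> pi"
  shows "x\<^sup>2 / pi\<^sup>2 \<le> (1 - cos x) / 2"
proof -
  have cvx: "convex_on {0..pi/2} (\<lambda>x. - sin x)"
    by (rule f''_ge0_imp_convex[where f' = "\<lambda>x. - cos x" and f'' = sin])
       (auto intro!: derivative_eq_intros sin_ge_zero)
  define t where "t = \<bar>x\<bar> / pi"
  have t: "0 \<le> t" "t \<le> 1" "\<bar>x\<bar> / 2 = t * (pi / 2)" using assms by (auto simp: t_def field_simps)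
  have "- sin ((1 - t) *\<^sub>R 0 + t *\<^sub>R (pi / 2)) \<le> (1 - t) * (- sin 0) + t * (- sin (pi / 2))"
    by (rule convex_onD[OF cvx]) (use t in auto)
  then have "t \<le> sin (\<bar>x\<bar> / 2)" using t(3) by simp
  then have "t\<^sup>2 \<le> (sin (\<bar>x\<bar> / 2))\<^sup>2" using t by (intro power_mono) auto
  moreover have "cos x = 1 - 2 * (sin (\<bar>x\<bar> / 2))\<^sup>2"
    using cos_double_sin[of "\<bar>x\<bar> / 2"] by simp
  ultimately show ?thesis by (simp add: t_def power_divide)
qed

text \<open>\<open>om b x\<close> is \<open>phi(y) / (y phi(1))\<close> at \<open>y = cis x\<close>.\<close>

definition om :: "real \<Rightarrow> real \<Rightarrow> real" where
  "om b x = (b + 2 * cos x) / (b + 2)"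

text \<open>Dominating function for Laplace's method on the whole circle. Negative values of
  \<open>om\<close> are the danger: \<open>b \<ge> 1\<close> keeps them above \<open>-1/3\<close>,
  while \<open>exp (- x\<^sup>2 / pi\<^sup>2) \<ge> exp (-1) \<ge> 1/3\<close> for
  \<open>\<bar>x\<bar> \<le> pi\<close>.\<close>

lemma om_le_exp:
  assumes "1 \<le> b" "b \<le> 2" "\<bar>x\<bar> \<le> pi"
  shows "\<bar>om b x\<bar> \<le> exp (- x\<^sup>2 / pi\<^sup>2)"
proof (rule abs_leI)
  have "x\<^sup>2 / pi\<^sup>2 \<le> 2 * (1 - cos x) / 4"
    by (rule order.trans[OF one_minus_cos_ge[OF assms(3)]]) simp
  also have "\<dots> \<le> 2 * (1 - cos x) / (b + 2)"
    using assms by (intro divide_left_mono) auto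
  also have "\<dots> = 1 - om b x"
    using assms by (simp add: om_def field_simps)
  finally show "om b x \<le> exp (- x\<^sup>2 / pi\<^sup>2)"
    using exp_ge_add_one_self[of "- x\<^sup>2 / pi\<^sup>2"] by simp
  have "- om b x = (- b - 2 * cos x) / (b + 2)" by (simp add: om_def minus_divide_left)
  also have "\<dots> \<le> 1 / 3"
  proof -
    have "- 1 \<le> cos x" by simp
    then have "- (6 * cos x) \<le> 4 * b + 2" using assms(1) by linarith
    then show ?thesis using assms(1) by (simp add: divide_simps)
  qed
  also have "\<dots> \<le> exp (-1)"
    using exp_le by (simp add: exp_minus inverse_eq_divide frac_le)
  also have "\<dots> \<le> exp (- x\<^sup>2 / pi\<^sup>2)"
    using power_mono[OF assms(3), of 2] by simp
  finally show "- om b x \<le> exp (- x\<^sup>2 / pi\<^sup>2)" .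
qed

lemma one_plus_power_tendsto_exp:
  fixes a :: "nat \<Rightarrow> complex" and m :: "nat \<Rightarrow> nat"
  assumes a: "a \<longlonglongrightarrow> 0" and ma: "(\<lambda>n. of_nat (m n) * a n) \<longlonglongrightarrow> L"
  shows "(\<lambda>n. (1 + a n) ^ m n) \<longlonglongrightarrow> exp L"
proof -
  \<comment> \<open>The value \<open>1\<close> extends \<open>Ln (1 + z) / z\<close> continuously to
    \<open>0\<close>, so \<open>(1 + a)^m = exp (m a g(a))\<close> also covers indices with
    \<open>a n = 0\<close>.\<close>
  define g where "g z = (if z = 0 then 1 else Ln (1 + z) / z)" for z :: complex
  have g0: "g 0 = 1" by (simp add: g_def)
  have "((\<lambda>z. Ln z) has_field_derivative 1) (at 1)"
    using has_field_derivative_Ln[of 1] by simp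
  then have "((\<lambda>h. Ln (1 + h) / h) \<longlongrightarrow> 1) (at 0)"
    unfolding DERIV_def by simp
  then have "(g \<longlongrightarrow> 1) (at 0)"
    by (rule Lim_transform_eventually) (auto simp: g_def eventually_at_filter)
  then have "isCont g 0" by (simp add: isCont_def g_def)
  then have "(\<lambda>n. g (a n)) \<longlonglongrightarrow> 1"
    using isCont_tendsto_compose[OF _ a, of g] g0 by simp
  then have "(\<lambda>n. exp (of_nat (m n) * a n * g (a n))) \<longlonglongrightarrow> exp (L * 1)"
    by (intro tendsto_intros ma)
  moreover have "eventually (\<lambda>n. exp (of_nat (m n) * a n * g (a n)) = (1 + a n) ^ m n) sequentially"
    using tendstoD[OF a zero_less_one]
  proof eventually_elim
    case (elim n)
    then have "1 + a n \<noteq> 0"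
      by (metis add_eq_0_iff dist_0_norm dist_commute norm_minus_cancel norm_one order_less_irrefl minus_minus)
    moreover have "a n * g (a n) = Ln (1 + a n)"
      by (simp add: g_def)
    ultimately show ?case by (simp add: exp_of_nat_mult mult.assoc)
  qed
  ultimately show ?thesis
    by (auto elim: Lim_transform_eventually)
qed

lemma sqrt_scaled_tendsto:
  fixes f :: "real \<Rightarrow> 'a :: real_normed_vector"
  assumes "(f has_vector_derivative D) (at 0)" "f 0 = 0"
  shows "(\<lambda>n. sqrt (real n) *\<^sub>R f (s / sqrt (real n))) \<longlonglongrightarrow> s *\<^sub>R D"
proof (cases "s = 0")
  case True
  then show ?thesis using assms by simp
next
  case False
  have h: "filterlim (\<lambda>n. s / sqrt (real n)) (at 0) sequentially"
  proof (rule filterlim_atI)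
    show "(\<lambda>n. s / sqrt (real n)) \<longlonglongrightarrow> 0" by real_asymp
    show "\<forall>\<^sub>F n in sequentially. s / sqrt (real n) \<noteq> 0"
      using False by (auto intro: eventually_mono[OF eventually_gt_at_top[of 0]])
  qed
  have "((\<lambda>h. (1 / h) *\<^sub>R f h) \<longlongrightarrow> D) (at 0)"
  proof -
    have "((\<lambda>h. norm (f h - h *\<^sub>R D) / norm h) \<longlongrightarrow> 0) (at 0)"
      using assms by (simp add: has_vector_derivative_def has_derivative_at)
    then have "((\<lambda>h. norm ((1 / h) *\<^sub>R f h - D)) \<longlongrightarrow> 0) (at 0)"
    proof (rule Lim_transform_eventually)
      have "norm (f h - h *\<^sub>R D) / norm h = norm ((1 / h) *\<^sub>R f h - D)" if "h \<noteq> 0" for h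
      proof -
        have "(1 / h) *\<^sub>R f h - D = (1 / h) *\<^sub>R (f h - h *\<^sub>R D)"
          using that by (simp add: scaleR_diff_right)
        then show ?thesis by simp
      qed
      then show "\<forall>\<^sub>F h in at 0. norm (f h - h *\<^sub>R D) / norm h = norm ((1 / h) *\<^sub>R f h - D)"
        by (auto simp: eventually_at_filter)
    qed
    then show ?thesis
      by (rule LIM_zero_cancel[OF tendsto_norm_zero_cancel])
  qed
  then have "(\<lambda>n. s *\<^sub>R (1 / (s / sqrt (real n))) *\<^sub>R f (s / sqrt (real n))) \<longlonglongrightarrow> s *\<^sub>R D"
    by (rule tendsto_scaleR[OF tendsto_const filterlim_compose[OF _ h]])
  then show ?thesis using False by simp
qed


text \<open>Common form of the coefficients after division by their exponential factor: the power of
  \<open>om\<close> carries the concentration at \<open>x = 0\<close>, and \<open>V\<close> the arch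
  powers and phases.\<close>

definition osc_integral :: "real \<Rightarrow> nat \<Rightarrow> (real \<Rightarrow> complex) \<Rightarrow> complex" where
  "osc_integral b m V =
    (\<integral>x. indicator {-pi..pi} x *\<^sub>R (V x * of_real (om b x ^ m)) \<partial>lborel) / (2 * pi)"

lemma om_measurable [measurable]: "om b \<in> borel_measurable borel"
  unfolding om_def[abs_def] by measurable

text \<open>Integrating the bound \<open>om_le_exp\<close> gives an estimate for every
  \<open>m > 0\<close>, uniform in \<open>V\<close>. It supplies the majorants when sums over
  \<open>k\<close> or \<open>j\<close> are passed to the limit termwise.\<close>

lemma norm_osc_integral_le:
  assumes b: "1 \<le> b" "b \<le> 2" and m: "m > 0"
    and V: "V \<in> borel_measurable borel" "\<And>x. norm (V x) \<le> 1"
  shows "norm (osc_integral b m V) \<le> pi / sqrt (real m)"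
proof -
  let ?f = "\<lambda>x. indicator {-pi..pi} x *\<^sub>R (V x * of_real (om b x ^ m))"
  let ?g = "\<lambda>x. exp (- x\<^sup>2 / (pi\<^sup>2 / m))"
  have g: "integrable lborel ?g" using m by (intro integrable_gaussian) simp
  have le: "norm (?f x) \<le> ?g x" for x
  proof (cases "x \<in> {-pi..pi}")
    case True
    then have "\<bar>om b x\<bar> ^ m \<le> exp (- x\<^sup>2 / pi\<^sup>2) ^ m"
      by (intro power_mono om_le_exp b) auto
    also have "\<dots> = ?g x" by (simp flip: exp_of_nat_mult)
    finally show ?thesis
      using True mult_mono[OF V(2)[of x], of "\<bar>om b x\<bar> ^ m" "?g x"] by (simp add: norm_mult norm_power)
  qed simp
  have meas: "?f \<in> borel_measurable lborel" using V(1) by measurable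
  have "integrable lborel ?f"
    by (rule Bochner_Integration.integrable_bound[OF g meas AE_I2]) (use le in simp)
  then have "norm (\<integral>x. ?f x \<partial>lborel) \<le> (\<integral>x. ?g x \<partial>lborel)"
    by (rule order.trans[OF integral_norm_bound integral_mono[OF integrable_norm g le]])
  also have "\<dots> = sqrt (pi * (pi\<^sup>2 / m))"
    using m by (subst integral_gaussian) auto
  also have "\<dots> = pi * sqrt pi / sqrt m"
    by (simp add: real_sqrt_mult real_sqrt_divide)
  also have "\<dots> \<le> pi * (2 * pi) / sqrt m"
  proof -
    have "sqrt pi \<le> sqrt (4 * pi\<^sup>2)"
      using pi_gt3 by (intro real_sqrt_le_mono) (simp add: power2_eq_square)
    then have "sqrt pi \<le> 2 * pi" by (simp add: real_sqrt_mult)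
    then show ?thesis using m by (intro divide_right_mono mult_left_mono) auto
  qed
  finally show ?thesis
    by (simp add: osc_integral_def norm_divide field_simps)
qed

text \<open>By the half-angle formula \<open>om b x - 1\<close> is exactly
  \<open>- 4 / (b + 2)\<close> times \<open>sin (x / 2)\<close> squared, which is
  \<open>- x\<^sup>2 / (b + 2)\<close> to second order.\<close>

lemma om_power_tendsto:
  assumes b: "1 \<le> b" and m: "(\<lambda>n. real (m n) / real n) \<longlonglongrightarrow> 1"
  shows "(\<lambda>n. om b (s / sqrt (real n)) ^ m n) \<longlonglongrightarrow> exp (- s\<^sup>2 / (b + 2))"
proof -
  define a where "a n = om b (s / sqrt (real n)) - 1" for n
  have a: "a n = - 4 / (b + 2) * (sin (s / sqrt (real n) / 2))\<^sup>2" for n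
  proof -
    have "cos (s / sqrt (real n)) = 1 - 2 * (sin (s / sqrt (real n) / 2))\<^sup>2"
      using cos_double_sin[of "s / sqrt (real n) / 2"] by simp
    moreover have "(b + 2 * (1 - 2 * S)) / (b + 2) - 1 = - 4 / (b + 2) * S" for S
      using b by (simp add: field_simps)
    ultimately show ?thesis by (simp only: a_def om_def)
  qed
  have "((\<lambda>x. sin (x / 2)) has_vector_derivative (1 / 2)) (at (0::real))"
    by (auto intro!: derivative_eq_intros simp flip: has_real_derivative_iff_has_vector_derivative)
  from sqrt_scaled_tendsto[OF this, of s]
  have "(\<lambda>n. sqrt (real n) * sin (s / sqrt (real n) / 2)) \<longlonglongrightarrow> s / 2" by simp
  then have lim1: "(\<lambda>n. (real (m n) / real n) * (- 4 / (b + 2) * (sqrt (real n) * sin (s / sqrt (real n) / 2))\<^sup>2))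
      \<longlonglongrightarrow> 1 * (- 4 / (b + 2) * (s / 2)\<^sup>2)"
    by (intro tendsto_mult m tendsto_const tendsto_power)
  have ev1: "\<forall>\<^sub>F n in sequentially. (real (m n) / real n) * (- 4 / (b + 2) * (sqrt (real n) * sin (s / sqrt (real n) / 2))\<^sup>2)
     = real (m n) * a n"
    using eventually_gt_at_top[of 0]
    by eventually_elim (simp add: a power_mult_distrib)
  have ma: "(\<lambda>n. real (m n) * a n) \<longlonglongrightarrow> - s\<^sup>2 / (b + 2)"
  proof -
    have "1 * (- 4 / (b + 2) * (s / 2)\<^sup>2) = - s\<^sup>2 / (b + 2)"
      using b by (simp add: divide_simps)
    then show ?thesis
      using Lim_transform_eventually[OF lim1 ev1] by (simp only:)
  qed
  have a0: "a \<longlonglongrightarrow> 0"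
  proof -
    have "(\<lambda>n. s / sqrt (real n) / 2) \<longlonglongrightarrow> 0" by real_asymp
    then have "(\<lambda>n. - 4 / (b + 2) * (sin (s / sqrt (real n) / 2))\<^sup>2) \<longlonglongrightarrow> - 4 / (b + 2) * (sin 0)\<^sup>2"
      by (intro tendsto_intros)
    moreover have "a = (\<lambda>n. - 4 / (b + 2) * (sin (s / sqrt (real n) / 2))\<^sup>2)"
      by (rule ext) (rule a)
    ultimately show ?thesis by simp
  qed
  have "(\<lambda>n. (1 + complex_of_real (a n)) ^ m n) \<longlonglongrightarrow> exp (complex_of_real (- s\<^sup>2 / (b + 2)))"
  proof (rule one_plus_power_tendsto_exp)
    show "(\<lambda>n. complex_of_real (a n)) \<longlonglongrightarrow> 0"
      using tendsto_of_real[OF a0, where 'a = complex] by simp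
    show "(\<lambda>n. of_nat (m n) * complex_of_real (a n)) \<longlonglongrightarrow> of_real (- s\<^sup>2 / (b + 2))"
      using tendsto_of_real[OF ma, where 'a = complex] by simp
  qed
  then have "(\<lambda>n. complex_of_real ((1 + a n) ^ m n)) \<longlonglongrightarrow> of_real (exp (- s\<^sup>2 / (b + 2)))"
    by (simp only: exp_of_real of_real_power of_real_add of_real_1)
  then show ?thesis
    unfolding tendsto_of_real_iff by (simp add: a_def)
qed

lemma osc_integral_tendsto:
  fixes V :: "nat \<Rightarrow> real \<Rightarrow> complex" and W :: "real \<Rightarrow> complex"
  assumes b: "1 \<le> b" "b \<le> 2" and m: "(\<lambda>n. real (m n) / real n) \<longlonglongrightarrow> 1"
    and V: "\<And>n. V n \<in> borel_measurable borel" "\<And>n x. norm (V n x) \<le> 1"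
    and lim: "\<And>s. (\<lambda>n. V n (s / sqrt (real n))) \<longlonglongrightarrow> W s"
  shows "(\<lambda>n. sqrt (real n) * osc_integral b (m n) (V n)) \<longlonglongrightarrow>
    (\<integral>s. W s * of_real (exp (- s\<^sup>2 / (b + 2))) \<partial>lborel) / (2 * pi)"
proof -
  define f where "f n s = indicator {-pi..pi} (s / sqrt (real n)) *\<^sub>R
    (V n (s / sqrt (real n)) * of_real (om b (s / sqrt (real n)) ^ m n))" for n s
  \<comment> \<open>Dominated convergence needs its bound for every \<open>n\<close>. The finitely
    many \<open>n\<close> with \<open>n = 0\<close> or \<open>2 * m n < n\<close> are set to zero;
    for all others the exponent is at least \<open>n / 2\<close>, whence the majorant
    \<open>exp (- s\<^sup>2 / (2 * pi\<^sup>2))\<close>.\<close>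
  define f' where "f' n = (if n > 0 \<and> 2 * m n \<ge> n then f n else (\<lambda>_. 0))" for n
  have ev: "\<forall>\<^sub>F n in sequentially. n > 0 \<and> 2 * m n \<ge> n"
  proof -
    have "\<forall>\<^sub>F n in sequentially. 1 / 2 < real (m n) / real n"
      by (rule order_tendstoD(1)[OF m]) simp
    then show ?thesis
      using eventually_gt_at_top[of 0] by eventually_elim (auto simp: field_simps)
  qed
  have [measurable]: "V n \<in> borel_measurable borel" for n by (rule V)
  have "W \<in> borel_measurable borel"
  proof (rule borel_measurable_LIMSEQ_metric)
    show "(\<lambda>s. V n (s / sqrt (real n))) \<in> borel_measurable borel" for n by measurable
  qed (rule lim)
  note [measurable] = this
  have [measurable]: "f n \<in> borel_measurable lborel" for n
    unfolding f_def by measurable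
  have "(\<lambda>n. \<integral>s. f' n s \<partial>lborel) \<longlonglongrightarrow> (\<integral>s. W s * of_real (exp (- s\<^sup>2 / (b + 2))) \<partial>lborel)"
  proof (rule integral_dominated_convergence)
    show "(\<lambda>s. W s * of_real (exp (- s\<^sup>2 / (b + 2)))) \<in> borel_measurable lborel" by measurable
    show "f' n \<in> borel_measurable lborel" for n by (auto simp: f'_def)
    show "integrable lborel (\<lambda>s::real. exp (- s\<^sup>2 / (2 * pi\<^sup>2)))"
      by (intro integrable_gaussian) simp
    show "AE s in lborel. (\<lambda>n. f' n s) \<longlonglongrightarrow> W s * of_real (exp (- s\<^sup>2 / (b + 2)))"
    proof (intro AE_I2)
      fix s :: real
      have "(\<lambda>n. V n (s / sqrt (real n)) * of_real (om b (s / sqrt (real n)) ^ m n)) \<longlonglongrightarrow>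
        W s * of_real (exp (- s\<^sup>2 / (b + 2)))"
        by (intro tendsto_mult lim tendsto_of_real om_power_tendsto b m)
      moreover have "\<forall>\<^sub>F n in sequentially.
         V n (s / sqrt (real n)) * of_real (om b (s / sqrt (real n)) ^ m n) = f' n s"
      proof -
        have "(\<lambda>n. s / sqrt (real n)) \<longlonglongrightarrow> 0" by real_asymp
        then have "\<forall>\<^sub>F n in sequentially. \<bar>s / sqrt (real n)\<bar> < pi"
          using tendstoD[of "\<lambda>n. s / sqrt (real n)" 0 sequentially pi] by (auto simp: dist_real_def)
        then show ?thesis using ev
        proof eventually_elim
          case (elim n)
          then have "s / sqrt (real n) \<in> {-pi..pi}"
            by (simp only: abs_less_iff atLeastAtMost_iff) linarith
          then show ?case using elim by (simp add: f'_def f_def)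
        qed
      qed
      ultimately show "(\<lambda>n. f' n s) \<longlonglongrightarrow> W s * of_real (exp (- s\<^sup>2 / (b + 2)))"
        by (rule Lim_transform_eventually)
    qed
    show "AE s in lborel. norm (f' n s) \<le> exp (- s\<^sup>2 / (2 * pi\<^sup>2))" for n
    proof (intro AE_I2)
      fix s :: real
      show "norm (f' n s) \<le> exp (- s\<^sup>2 / (2 * pi\<^sup>2))"
      proof (cases "n > 0 \<and> 2 * m n \<ge> n \<and> s / sqrt (real n) \<in> {-pi..pi}")
        case True
        define x where "x = s / sqrt (real n)"
        have x: "\<bar>x\<bar> \<le> pi" using True by (auto simp: x_def)
        have "\<bar>om b x\<bar> ^ m n \<le> exp (- x\<^sup>2 / pi\<^sup>2) ^ m n"
          by (intro power_mono om_le_exp b x) auto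
        also have "\<dots> = exp (- (real (m n) * (x\<^sup>2 / pi\<^sup>2)))" by (simp flip: exp_of_nat_mult)
        also have "\<dots> \<le> exp (- ((real n / 2) * (x\<^sup>2 / pi\<^sup>2)))"
          using True by (intro iffD2[OF exp_le_cancel_iff] iffD2[OF neg_le_iff_le] mult_right_mono) auto
        also have "(real n / 2) * (x\<^sup>2 / pi\<^sup>2) = s\<^sup>2 / (2 * pi\<^sup>2)"
          using True by (simp add: x_def power_divide)
        finally have "\<bar>om b x\<bar> ^ m n \<le> exp (- s\<^sup>2 / (2 * pi\<^sup>2))" by simp
        from mult_mono[OF V(2)[of n x] this]
        show ?thesis using True by (simp add: f'_def f_def norm_mult norm_power flip: x_def)
      qed (auto simp: f'_def f_def)
    qed
  qed
  then have "(\<lambda>n. (\<integral>s. f' n s \<partial>lborel) / (2 * pi)) \<longlonglongrightarrow>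
    (\<integral>s. W s * of_real (exp (- s\<^sup>2 / (b + 2))) \<partial>lborel) / (2 * pi)"
    by (intro tendsto_divide tendsto_const) auto
  moreover have "\<forall>\<^sub>F n in sequentially. (\<integral>s. f' n s \<partial>lborel) / (2 * pi) = sqrt (real n) * osc_integral b (m n) (V n)"
    using ev
  proof eventually_elim
    case (elim n)
    define c where "c = 1 / sqrt (real n)"
    have c: "c > 0" using elim by (simp add: c_def)
    have "osc_integral b (m n) (V n) = c *\<^sub>R (\<integral>s. f n s \<partial>lborel) / (2 * pi)"
      unfolding osc_integral_def using c
      by (subst lborel_integral_real_affine[of c _ 0]) (auto simp: f_def[abs_def] c_def)
    then show ?case using elim c by (simp add: f'_def scaleR_conv_of_real c_def)
  qed
  ultimately show ?thesis by (rule Lim_transform_eventually)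
qed

lemma fps_nth_inverse_one_minus_linear:
  fixes t :: "'a :: field"
  shows "fps_nth (inverse (1 - fps_const t * fps_X)) j = t ^ j"
proof -
  have "(1 - fps_const t * fps_X) * Abs_fps (\<lambda>n. t ^ n) = 1"
  proof (rule fps_ext)
    fix n show "fps_nth ((1 - fps_const t * fps_X) * Abs_fps (\<lambda>n. t ^ n)) n = fps_nth 1 n"
      by (cases n) (simp_all add: left_diff_distrib mult.assoc)
  qed
  from fps_inverse_unique[OF this] show ?thesis by simp
qed

section \<open>The local limit theorem\<close>

text \<open>The bound \<open>b * \<gamma> \<le> 2 * \<beta>\<close> keeps the second zero of the
  critical denominator out of the open unit disc (\<open>r \<ge> - 1\<close>), and above the
  critical weight it makes the larger reciprocal zero dominate strictly. The bound
  \<open>\<beta> \<le> b * \<gamma>\<close> is what makes the limiting variance visibly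
  positive.\<close>

locale weighted_walks =
  fixes b \<beta> \<gamma> :: real and f :: "nat \<Rightarrow> nat \<Rightarrow> nat"
  assumes b: "1 \<le> b" "b \<le> 2"
    and pos: "\<beta> > 0" "\<gamma> > 0"
    and ratio: "b * \<gamma> \<le> 2 * \<beta>" "\<beta> \<le> b * \<gamma>"
    and f: "of_nat (f n k) = walk_coeff b \<beta> \<gamma> n 0 k"
begin

text \<open>\<open>\<tau>\<close> is the arch generating function at its singularity; \<open>v x\<close> is the arch polynomial at \<open>cis x\<close>,
  divided by its value at \<open>1\<close>.\<close>

definition \<kappa> :: real where "\<kappa> = \<gamma> / (\<beta> + \<gamma>)"
definition \<tau> :: real where "\<tau> = (\<beta> + \<gamma>) / (b + 2)"
text \<open>The point \<open>y = 1\<close> corresponds to \<open>z = 1 / (b + 2)\<close>, so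
  \<open>(b + 2) ^ n\<close> is the exponential growth. In terms of \<open>g\<close> the weight
  \<open>q\<close> turns into \<open>q * \<tau>\<close>, and the critical value into
  \<open>1\<close>.\<close>

definition g :: "nat \<Rightarrow> nat \<Rightarrow> real" where "g n k = real (f n k) / (\<tau> ^ k * (b + 2) ^ n)"
definition v :: "real \<Rightarrow> complex" where "v x = (of_real \<beta> + of_real \<gamma> * cis x) / of_real (\<beta> + \<gamma>)"
text \<open>The Gaussian integral that Laplace's method produces when \<open>v\<close> is raised to
  a power close to \<open>x sqrt n\<close>.\<close>

definition ell :: "real \<Rightarrow> real" where
  "ell x = sqrt (pi * (b + 2)) * exp (- (\<kappa> * x)\<^sup>2 * (b + 2) / 4) / (2 * pi)"

lemma \<kappa>: "0 < \<kappa>" "\<kappa> < 1" and \<tau>: "0 < \<tau>" and ell_pos: "ell x > 0"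
  using pos b by (auto simp: \<kappa>_def \<tau>_def ell_def)

lemma g_nonneg: "g n k \<ge> 0"
  using \<tau> b by (simp add: g_def)

lemma norm_v_le: "norm (v x) \<le> 1"
proof -
  have "norm (of_real \<beta> + of_real \<gamma> * cis x) \<le> \<beta> + \<gamma>"
    using norm_triangle_ineq[of "of_real \<beta>" "of_real \<gamma> * cis x"] pos by (simp add: norm_mult)
  then show ?thesis using pos by (simp add: v_def norm_divide flip: of_real_add)
qed

lemma v_continuous: "continuous_on UNIV v"
  unfolding v_def using pos by (intro continuous_intros) (simp flip: of_real_add)

lemma v_measurable [measurable]: "v \<in> borel_measurable borel"
  by (intro borel_measurable_continuous_onI v_continuous)

lemma cis_isCont: "isCont cis x"
proof -
  have "continuous_on UNIV (\<lambda>x. cis x)" by (intro continuous_intros)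
  then show ?thesis by (simp add: continuous_on_eq_continuous_at)
qed

lemma cis_measurable: "cis \<in> borel_measurable borel"
  by (intro borel_measurable_continuous_onI continuous_intros)

lemma fps_nth_osc_integral:
  assumes "j \<le> m"
  shows "fps_nth (arch \<beta> \<gamma> ^ l * phi b ^ m) (m - j) =
    of_real ((\<beta> + \<gamma>) ^ l * (b + 2) ^ m) * osc_integral b m (\<lambda>x. v x ^ l * cis (real j * x))"
proof -
  let ?c = "complex_of_real ((\<beta> + \<gamma>) ^ l * (b + 2) ^ m)"
  have eq: "indicator {-pi..pi} x *\<^sub>R ((\<beta> + \<gamma> * cis x) ^ l * cis (real j * x) * of_real ((b + 2 * cos x) ^ m)) =
    ?c * (indicator {-pi..pi} x *\<^sub>R (v x ^ l * cis (real j * x) * of_real (om b x ^ m)))" for x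
  proof -
    have "of_real \<beta> + of_real \<gamma> * cis x = of_real (\<beta> + \<gamma>) * v x"
      using pos by (simp add: v_def flip: of_real_add)
    moreover have "b + 2 * cos x = (b + 2) * om b x"
      using b by (simp add: om_def)
    ultimately show ?thesis
      by (simp only: power_mult_distrib of_real_mult of_real_power scaleR_conv_of_real mult_ac)
  qed
  show ?thesis
    unfolding fps_nth_arch_phi_integral[OF assms] osc_integral_def eq integral_mult_right_zero
    by (rule times_divide_eq_right[symmetric])
qed

lemma g_cycle:
  assumes "1 \<le> k" "k < n"
  shows "of_real (g n k) =
    of_real (real k * \<kappa> / real (n - k)) * osc_integral b (n - k) (\<lambda>x. v x ^ (k - 1) * cis x)"
proof -
  have "complex_of_real (real (f n k)) = of_real (real k * \<gamma> / real (n - k) * ((\<beta> + \<gamma>) ^ (k - 1) * (b + 2) ^ (n - k)))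
      * osc_integral b (n - k) (\<lambda>x. v x ^ (k - 1) * cis x)"
    using assms fps_nth_osc_integral[of 1 "n - k" "k - 1"]
    by (simp add: f walk_coeff_cycle)
  then have "complex_of_real (g n k) =
      of_real (real k * \<gamma> / real (n - k) * ((\<beta> + \<gamma>) ^ (k - 1) * (b + 2) ^ (n - k)) / (\<tau> ^ k * (b + 2) ^ n))
      * osc_integral b (n - k) (\<lambda>x. v x ^ (k - 1) * cis x)"
    unfolding g_def of_real_divide by simp
  also have "real k * \<gamma> / real (n - k) * ((\<beta> + \<gamma>) ^ (k - 1) * (b + 2) ^ (n - k)) / (\<tau> ^ k * (b + 2) ^ n)
      = real k * \<kappa> / real (n - k)"
  proof -
    have "\<tau> ^ k * (b + 2) ^ n = (\<beta> + \<gamma>) * ((\<beta> + \<gamma>) ^ (k - 1) * (b + 2) ^ (n - k))"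
    proof -
      have "(b + 2) ^ n = (b + 2) ^ k * (b + 2) ^ (n - k)"
        using assms by (simp flip: power_add)
      moreover have "(\<beta> + \<gamma>) ^ k = (\<beta> + \<gamma>) * (\<beta> + \<gamma>) ^ (k - 1)"
        using assms by (simp flip: power_Suc)
      ultimately show ?thesis using b by (simp add: \<tau>_def power_divide)
    qed
    moreover have "(\<beta> + \<gamma>) ^ (k - 1) * (b + 2) ^ (n - k) \<noteq> 0" using pos b by simp
    ultimately show ?thesis using pos b by (simp add: \<kappa>_def)
  qed
  finally show ?thesis .
qed

lemma g_top: "g n n = (\<beta> / (\<beta> + \<gamma>)) ^ n"
proof -
  have "complex_of_real (real (f n n)) = complex_of_real (\<beta> ^ n)" by (simp add: f walk_coeff_top)
  then have "real (f n n) = \<beta> ^ n" by (simp only: of_real_eq_iff)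
  then show ?thesis
    using b by (simp add: g_def \<tau>_def power_divide)
qed

lemma g_eq_0: "n < k \<Longrightarrow> g n k = 0"
  using f[of n k] by (simp add: g_def walk_coeff_eq_0)

lemma g_Suc_0: "g (Suc n) 0 = 0"
  using f[of "Suc n" 0] by (simp add: g_def walk_coeff_Suc_0_0)

text \<open>Majorant for the subcritical sums, uniform in \<open>n\<close>. For \<open>k < n\<close>
  and \<open>m = n - k\<close> the cycle lemma gives order \<open>k / (m sqrt m)\<close>, and
  \<open>n \<le> (k + 1) m\<close> trades \<open>n / m\<close> for \<open>k + 1\<close>. The cube
  collects \<open>n / m\<close>, its square root rounded up, and the factor
  \<open>k\<close>.\<close>

lemma g_le:
  assumes "n \<ge> 1"
  shows "real n * sqrt (real n) * g n k \<le> pi * (real k + 1) ^ 3"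
proof -
  consider "k = 0" | "1 \<le> k" "k < n" | "k = n" | "n < k" by linarith
  then show ?thesis
  proof cases
    case 1
    then show ?thesis using assms g_Suc_0[of "n - 1"] by simp
  next
    case 2
    define m where "m = n - k"
    have m: "m > 0" "real n \<le> (real k + 1) * real m" "real n = real m + real k"
    proof -
      have "real k * 1 \<le> real k * real m" using 2 by (intro mult_left_mono) (auto simp: m_def)
      then show "m > 0" "real n \<le> (real k + 1) * real m" "real n = real m + real k"
        using 2 by (auto simp: m_def algebra_simps of_nat_diff)
    qed
    have "norm (complex_of_real (g n k)) = norm (complex_of_real (real k * \<kappa> / real m)) * norm (osc_integral b m (\<lambda>x. v x ^ (k - 1) * cis x))"
      unfolding g_cycle[OF 2] m_def by (rule norm_mult)
    also have "\<dots> \<le> (real k * \<kappa> / real m) * (pi / sqrt (real m))"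
    proof (intro mult_mono norm_osc_integral_le b m)
      show "(\<lambda>x. v x ^ (k - 1) * cis x) \<in> borel_measurable borel"
        using cis_measurable by measurable
      show "cmod (v x ^ (k - 1) * cis x) \<le> 1" for x
        by (simp add: norm_mult norm_power power_le_one norm_v_le)
    qed (use \<kappa> in \<open>auto simp: norm_mult norm_divide\<close>)
    finally have "g n k \<le> real k * \<kappa> * pi / (real m * sqrt (real m))"
      using g_nonneg[of n k] by simp
    also have "\<dots> \<le> real k * 1 * pi / (real m * sqrt (real m))"
      using \<kappa> by (intro divide_right_mono mult_right_mono mult_left_mono) auto
    finally have "real n * sqrt (real n) * g n k \<le> real n * sqrt (real n) * (real k * pi / (real m * sqrt (real m)))"
      by (intro mult_left_mono) auto
    also have "\<dots> = (real n / real m) * sqrt (real n / real m) * (real k * pi)"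
      by (simp add: real_sqrt_divide)
    also have "\<dots> \<le> (real k + 1) * (real k + 1) * ((real k + 1) * pi)"
    proof (intro mult_mono)
      show le: "real n / real m \<le> real k + 1" using m by (simp add: field_simps)
      have "sqrt (real n / real m) \<le> sqrt ((real k + 1)\<^sup>2)"
      proof (rule real_sqrt_le_mono)
        show "real n / real m \<le> (real k + 1)\<^sup>2"
          by (rule order.trans[OF le self_le_power]) auto
      qed
      then show "sqrt (real n / real m) \<le> real k + 1" by simp
    qed auto
    also have "\<dots> = pi * (real k + 1) ^ 3" by (simp add: power3_eq_cube)
    finally show ?thesis .
  next
    case 3
    have "g n k \<le> 1"
      unfolding 3 g_top using pos by (intro power_le_one) auto
    moreover have "sqrt (real n) \<le> real n + 1"
    proof -
      have "sqrt (real n) \<le> sqrt ((real n + 1)\<^sup>2)"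
        by (rule real_sqrt_le_mono) (simp add: power2_eq_square algebra_simps)
      then show ?thesis by simp
    qed
    ultimately have "real n * sqrt (real n) * g n k \<le> (real n + 1) * (real n + 1) * 1"
      by (intro mult_mono g_nonneg) auto
    also have "\<dots> \<le> (real n + 1) * (real n + 1) * (pi * (real n + 1))"
      using pi_gt3 by (intro mult_left_mono) (auto intro: order.trans[OF _ mult_mono[of 1 pi 1]])
    finally show ?thesis by (simp add: 3 power3_eq_cube mult_ac)
  next
    case 4
    then show ?thesis by (simp add: g_eq_0)
  qed
qed

text \<open>As \<open>v x = 1 + \<i> \<kappa> x + o(x)\<close>, an exponent of order
  \<open>sqrt n\<close> balances an argument of order \<open>1 / sqrt n\<close> and leaves a pure
  phase.\<close>

lemma v_power_tendsto:
  assumes l: "(\<lambda>n. real (l n) / sqrt (real n)) \<longlonglongrightarrow> x"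
  shows "(\<lambda>n. v (s / sqrt (real n)) ^ l n) \<longlonglongrightarrow> cis (\<kappa> * x * s)"
proof -
  define a where "a n = v (s / sqrt (real n)) - 1" for n
  have v0: "v 0 = 1" using pos by (simp add: v_def flip: of_real_add)
  have dv: "((\<lambda>x. v x - 1) has_vector_derivative (\<i> * \<kappa>)) (at 0)"
  proof -
    have "v t - 1 = of_real \<kappa> * (cis t - 1)" for t
    proof -
      have "complex_of_real \<beta> + complex_of_real \<gamma> \<noteq> 0" using pos by (simp flip: of_real_add)
      then show ?thesis by (simp add: v_def \<kappa>_def field_simps)
    qed
    moreover have "((\<lambda>t. of_real \<kappa> * (cis t - 1)) has_vector_derivative (\<i> * \<kappa>)) (at 0)"
      unfolding has_vector_derivative_def
      by (rule derivative_eq_intros refl)+ (simp add: fun_eq_iff scaleR_conv_of_real)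
    ultimately show ?thesis by simp
  qed
  have sa: "(\<lambda>n. sqrt (real n) *\<^sub>R a n) \<longlonglongrightarrow> s *\<^sub>R (\<i> * \<kappa>)"
    using sqrt_scaled_tendsto[OF dv, of s] v0 by (simp add: a_def)
  have la: "(\<lambda>n. of_nat (l n) * a n) \<longlonglongrightarrow> of_real x * (s *\<^sub>R (\<i> * \<kappa>))"
  proof (rule Lim_transform_eventually)
    show "(\<lambda>n. of_real (real (l n) / sqrt (real n)) * (sqrt (real n) *\<^sub>R a n)) \<longlonglongrightarrow> of_real x * (s *\<^sub>R (\<i> * \<kappa>))"
      by (intro tendsto_mult tendsto_of_real l sa)
    show "\<forall>\<^sub>F n in sequentially. of_real (real (l n) / sqrt (real n)) * (sqrt (real n) *\<^sub>R a n) = of_nat (l n) * a n"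
      using eventually_gt_at_top[of 0] by eventually_elim (simp add: scaleR_conv_of_real)
  qed
  have "(\<lambda>n. v (s / sqrt (real n))) \<longlonglongrightarrow> v 0"
  proof (rule isCont_tendsto_compose[of 0 v])
    show "(\<lambda>n. s / sqrt (real n)) \<longlonglongrightarrow> 0" by real_asymp
    show "isCont v 0" using v_continuous by (simp add: continuous_on_eq_continuous_at)
  qed
  then have "a \<longlonglongrightarrow> 0"
    unfolding a_def v0 by (simp add: LIM_zero_iff)
  from one_plus_power_tendsto_exp[OF this la] show ?thesis
    by (simp add: a_def cis_conv_exp scaleR_conv_of_real mult_ac)
qed

lemma osc_integral_v_tendsto:
  assumes l: "(\<lambda>n. real (l n) / sqrt (real n)) \<longlonglongrightarrow> x"
    and m: "(\<lambda>n. real (m n) / real n) \<longlonglongrightarrow> 1"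
  shows "(\<lambda>n. sqrt (real n) * osc_integral b (m n) (\<lambda>t. v t ^ l n * cis (real j * t))) \<longlonglongrightarrow> of_real (ell x)"
proof -
  have "(\<lambda>n. sqrt (real n) * osc_integral b (m n) (\<lambda>t. v t ^ l n * cis (real j * t))) \<longlonglongrightarrow>
    (\<integral>s. cis (\<kappa> * x * s) * of_real (exp (- s\<^sup>2 / (b + 2))) \<partial>lborel) / (2 * pi)"
  proof (rule osc_integral_tendsto[OF b m])
    show "(\<lambda>t. v t ^ l n * cis (real j * t)) \<in> borel_measurable borel" for n
      using cis_measurable by measurable
    show "cmod (v t ^ l n * cis (real j * t)) \<le> 1" for n t
      by (simp add: norm_mult norm_power power_le_one norm_v_le)
    show "(\<lambda>n. v (s / sqrt (real n)) ^ l n * cis (real j * (s / sqrt (real n)))) \<longlonglongrightarrow> cis (\<kappa> * x * s)" for s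
    proof -
      have "(\<lambda>n. real j * (s / sqrt (real n))) \<longlonglongrightarrow> 0" by real_asymp
      then have "(\<lambda>n. cis (real j * (s / sqrt (real n)))) \<longlonglongrightarrow> cis 0"
        by (rule isCont_tendsto_compose[OF cis_isCont])
      from tendsto_mult[OF v_power_tendsto[OF l, of s] this] show ?thesis by simp
    qed
  qed
  also have "(\<integral>s. cis (\<kappa> * x * s) * of_real (exp (- s\<^sup>2 / (b + 2))) \<partial>lborel) / (2 * pi) = of_real (ell x)"
    using b by (subst integral_gaussian_cis) (auto simp: ell_def)
  finally show ?thesis .
qed

text \<open>Dividing by \<open>k n\<close>, the factor of the cycle lemma, keeps the limit positive
  even for \<open>x = 0\<close>. One statement thus serves fixed \<open>k\<close> below the critical
  weight and \<open>k\<close> of order \<open>sqrt n\<close> at it.\<close>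

lemma g_tendsto:
  assumes k: "(\<lambda>n. real (k n) / sqrt (real n)) \<longlonglongrightarrow> x" and k1: "\<forall>\<^sub>F n in sequentially. 1 \<le> k n"
  shows "(\<lambda>n. real n * sqrt (real n) * g n (k n) / real (k n)) \<longlonglongrightarrow> \<kappa> * ell x"
proof -
  have inv: "(\<lambda>n. 1 / sqrt (real n)) \<longlonglongrightarrow> 0" by real_asymp
  have kn: "(\<lambda>n. real (k n) / real n) \<longlonglongrightarrow> 0"
    using tendsto_mult[OF k inv] by (simp add: mult.assoc)
  have klt: "\<forall>\<^sub>F n in sequentially. k n < n"
  proof -
    have "\<forall>\<^sub>F n in sequentially. real (k n) / real n < 1"
      by (rule order_tendstoD(2)[OF kn]) simp
    then show ?thesis
      using eventually_gt_at_top[of 0] by eventually_elim (simp add: field_simps)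
  qed
  have nk: "(\<lambda>n. real (n - k n) / real n) \<longlonglongrightarrow> 1"
  proof (rule Lim_transform_eventually)
    show "(\<lambda>n. 1 - real (k n) / real n) \<longlonglongrightarrow> 1"
      using tendsto_diff[OF tendsto_const[of 1] kn] by simp
    show "\<forall>\<^sub>F n in sequentially. 1 - real (k n) / real n = real (n - k n) / real n"
      using klt by eventually_elim (simp add: of_nat_diff diff_divide_distrib)
  qed
  have k': "(\<lambda>n. real (k n - 1) / sqrt (real n)) \<longlonglongrightarrow> x"
  proof (rule Lim_transform_eventually)
    show "(\<lambda>n. real (k n) / sqrt (real n) - 1 / sqrt (real n)) \<longlonglongrightarrow> x"
      using tendsto_diff[OF k inv] by simp
    show "\<forall>\<^sub>F n in sequentially. real (k n) / sqrt (real n) - 1 / sqrt (real n) = real (k n - 1) / sqrt (real n)"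
      using k1 by eventually_elim (simp add: of_nat_diff diff_divide_distrib)
  qed
  have "(\<lambda>n. of_real (\<kappa> / (real (n - k n) / real n)) *
      (sqrt (real n) * osc_integral b (n - k n) (\<lambda>t. v t ^ (k n - 1) * cis (real 1 * t)))) \<longlonglongrightarrow>
    of_real (\<kappa> / 1) * of_real (ell x)"
    by (intro tendsto_mult tendsto_of_real tendsto_divide tendsto_const nk osc_integral_v_tendsto k') simp
  moreover have "\<forall>\<^sub>F n in sequentially. of_real (\<kappa> / (real (n - k n) / real n)) *
      (sqrt (real n) * osc_integral b (n - k n) (\<lambda>t. v t ^ (k n - 1) * cis (real 1 * t))) =
      complex_of_real (real n * sqrt (real n) * g n (k n) / real (k n))"
    using klt k1
  proof eventually_elim
    case (elim n)
    then show ?case by (simp add: g_cycle)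
  qed
  ultimately have "(\<lambda>n. complex_of_real (real n * sqrt (real n) * g n (k n) / real (k n))) \<longlonglongrightarrow> of_real (\<kappa> * ell x)"
    using Lim_transform_eventually by fastforce
  then show ?thesis unfolding tendsto_of_real_iff .
qed

end

section \<open>Subcritical and critical weights\<close>

lemma sums_of_nat_geometric:
  fixes x :: real
  assumes "0 \<le> x" "x < 1"
  shows "(\<lambda>k. real k * x ^ k) sums (x / (1 - x)\<^sup>2)"
proof -
  have "(\<lambda>n. real (Suc n) * x ^ n) sums (1 / (1 - x)\<^sup>2)"
    using geometric_deriv_sums[of x] assms by simp
  then have "(\<lambda>n. x * (real (Suc n) * x ^ n)) sums (x * (1 / (1 - x)\<^sup>2))"
    by (rule sums_mult)
  then have "(\<lambda>n. real (Suc n) * x ^ Suc n) sums (x / (1 - x)\<^sup>2)"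
    by (simp add: mult_ac)
  then show ?thesis by (subst (asm) sums_Suc_iff) simp
qed

context weighted_walks
begin

text \<open>For fixed \<open>k\<close>, \<open>g_tendsto\<close> shows that
  \<open>n sqrt n * g n k\<close> tends to \<open>c * k\<close>. By \<open>g_le\<close> the limit
  may be taken inside the sum over \<open>k\<close>, and the constant \<open>c\<close> cancels in
  the quotient.\<close>

lemma subcritical_limit:
  assumes x: "0 < x" "x < 1"
  shows "(\<lambda>n. g n k * x ^ k / (\<Sum>j\<le>n. g n j * x ^ j)) \<longlonglongrightarrow> (1 - x)\<^sup>2 * (real k * x ^ (k - 1))"
proof -
  define h where "h k n = real n * sqrt (real n) * g n k * x ^ k" for k n
  define c where "c = \<kappa> * ell 0"
  have c: "c > 0" using \<kappa> ell_pos by (simp add: c_def)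
  have h: "h k \<longlonglongrightarrow> c * (real k * x ^ k)" for k
  proof (cases "k = 0")
    case True
    have "\<forall>\<^sub>F n in sequentially. 0 = h k n"
      using eventually_gt_at_top[of 0]
      by eventually_elim (use True g_Suc_0 in \<open>auto simp: h_def gr0_conv_Suc\<close>)
    then show ?thesis
      using True by (auto intro: Lim_transform_eventually[OF tendsto_const])
  next
    case False
    have "(\<lambda>n. real k / sqrt (real n)) \<longlonglongrightarrow> 0" by real_asymp
    from g_tendsto[OF this] False have "(\<lambda>n. real n * sqrt (real n) * g n k / real k) \<longlonglongrightarrow> c"
      by (simp add: c_def)
    then have "(\<lambda>n. real n * sqrt (real n) * g n k / real k * (real k * x ^ k)) \<longlonglongrightarrow> c * (real k * x ^ k)"
      by (intro tendsto_mult tendsto_const)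
    moreover have "(\<lambda>n. real n * sqrt (real n) * g n k / real k * (real k * x ^ k)) = h k"
      using False by (simp add: h_def fun_eq_iff)
    ultimately show ?thesis by (simp only:)
  qed
  have total: "(\<lambda>n. \<Sum>k. h k n) \<longlonglongrightarrow> (\<Sum>k. c * (real k * x ^ k))"
  proof (rule tannerys_theorem[THEN conjunct2, THEN conjunct2])
    show "(\<lambda>n. h k n) \<longlonglongrightarrow> c * (real k * x ^ k)" for k by (rule h)
    show "summable (\<lambda>k. pi * (real k + 1) ^ 3 * x ^ k)"
    proof (rule summable_comparison_test_ev)
      \<comment> \<open>Splitting \<open>x ^ k\<close> into \<open>y ^ k * y ^ k\<close> lets one
        factor absorb the cubic polynomial and the other serve as a convergent majorant.\<close>
      define y where "y = sqrt x"
      have y: "0 < y" "y < 1" "x = y * y" using x by (auto simp: y_def)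
      have lim0: "(\<lambda>k. pi * (real k + 1) ^ 3 * y ^ k) \<longlonglongrightarrow> 0" using y by real_asymp
      then have "\<forall>\<^sub>F k in sequentially. norm (pi * (real k + 1) ^ 3 * y ^ k) < 1"
        using tendstoD[OF lim0, of 1] by (simp add: dist_norm)
      then show "\<forall>\<^sub>F k in sequentially. norm (pi * (real k + 1) ^ 3 * x ^ k) \<le> y ^ k"
      proof eventually_elim
        case (elim k)
        have "norm (pi * (real k + 1) ^ 3 * x ^ k) = norm (pi * (real k + 1) ^ 3 * y ^ k) * y ^ k"
          using y by (simp add: power_mult_distrib abs_mult)
        also have "\<dots> \<le> 1 * y ^ k" using elim y by (intro mult_right_mono) auto
        finally show ?case by simp
      qed
      show "summable (\<lambda>k. y ^ k)" using y by simp
    qed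
    have "norm (h k n) \<le> pi * (real k + 1) ^ 3 * x ^ k" for k n
    proof (cases "n \<ge> 1")
      case True
      then show ?thesis
        using g_le[OF True, of k] g_nonneg[of n k] x by (simp add: h_def abs_mult mult_right_mono)
    next
      case False
      then show ?thesis using x by (auto simp: h_def not_le intro!: mult_nonneg_nonneg)
    qed
    then show "\<forall>\<^sub>F (k, n) in at_top \<times>\<^sub>F sequentially. norm (h k n) \<le> pi * (real k + 1) ^ 3 * x ^ k"
      by (intro always_eventually) auto
  qed auto
  have eq1: "(\<Sum>k. h k n) = real n * sqrt (real n) * (\<Sum>j\<le>n. g n j * x ^ j)" for n
    by (subst suminf_finite[of "{..n}"]) (auto simp: h_def g_eq_0 sum_distrib_left mult_ac)
  have eq2: "(\<Sum>k. c * (real k * x ^ k)) = c * (x / (1 - x)\<^sup>2)"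
    using sums_mult[OF sums_of_nat_geometric[of x], of c] x by (simp add: sums_iff)
  have "(\<lambda>n. h k n / (real n * sqrt (real n) * (\<Sum>j\<le>n. g n j * x ^ j))) \<longlonglongrightarrow>
    c * (real k * x ^ k) / (c * (x / (1 - x)\<^sup>2))"
    using total unfolding eq1 eq2 by (intro tendsto_divide h) (use x c in auto)
  moreover have "c * (real k * x ^ k) / (c * (x / (1 - x)\<^sup>2)) = (1 - x)\<^sup>2 * (real k * x ^ (k - 1))"
    using x c by (cases k) (auto simp: field_simps)
  moreover have "\<forall>\<^sub>F n in sequentially. h k n / (real n * sqrt (real n) * (\<Sum>j\<le>n. g n j * x ^ j)) =
      g n k * x ^ k / (\<Sum>j\<le>n. g n j * x ^ j)"
    using eventually_gt_at_top[of 0] by eventually_elim (simp add: h_def)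
  ultimately show ?thesis
    using Lim_transform_eventually by fastforce
qed

text \<open>At the critical weight \<open>phi(y) - u y (\<beta> + \<gamma> y) = (1 - y) (1 - r y)\<close>, so the total weight is the coefficient of
  \<open>y ^ n\<close> in \<open>phi(y) ^ n (1 + y) / (1 - r y)\<close>; \<open>K\<close> lists the coefficients of the last quotient.\<close>

definition r :: real where "r = 1 - \<gamma> / \<tau>"

lemma r: "- 1 \<le> r" "r < 1" "1 - r = (b + 2) * \<kappa>"
  using pos b ratio by (auto simp: r_def \<tau>_def \<kappa>_def field_simps)

definition K :: "nat \<Rightarrow> real" where "K j = r ^ j + (if j = 0 then 0 else r ^ (j - 1))"

text \<open>The sum is the value of \<open>(1 + y) / (1 - r y)\<close> at \<open>y = 1\<close>. The
  case \<open>r = - 1\<close> does occur (for both Dyck families and for Motzkin bridges); there the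
  geometric series diverges, but the quotient is the constant \<open>1\<close>.\<close>

lemma K_sums: "K sums (2 / (1 - r))" and K_summable: "summable (\<lambda>j. \<bar>K j\<bar>)"
proof -
  have "K sums (2 / (1 - r)) \<and> summable (\<lambda>j. \<bar>K j\<bar>)"
  proof (cases "r = - 1")
    case True
    then have K0: "K j = 0" if "j \<noteq> 0" for j
      using that by (cases j) (auto simp: K_def)
    have "K sums (\<Sum>j\<in>{0}. K j)" using K0 by (intro sums_finite) auto
    moreover have "summable (\<lambda>j. \<bar>K j\<bar>)" using K0 by (intro summable_finite[of "{0}"]) auto
    ultimately show ?thesis using True by (simp add: K_def)
  next
    case False
    then have r1: "\<bar>r\<bar> < 1" using r by (auto simp: abs_less_iff)
    have "(\<lambda>j. if j = 0 then 0 else r ^ (j - 1)) sums (1 / (1 - r))"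
      using sums_Suc[of "\<lambda>j. if j = 0 then 0 else r ^ (j - 1)"] geometric_sums[of r] r1 by simp
    then have "K sums (1 / (1 - r) + 1 / (1 - r))"
      unfolding K_def using r1 by (intro sums_add geometric_sums) auto
    moreover have "summable (\<lambda>j. \<bar>K j\<bar>)"
    proof (rule summable_comparison_test')
      show "summable (\<lambda>j. \<bar>r\<bar> ^ j + (if j = 0 then 0 else \<bar>r\<bar> ^ (j - 1)))"
      proof (intro summable_add summable_geometric)
        show "summable (\<lambda>j. if j = 0 then 0 else \<bar>r\<bar> ^ (j - 1))"
          using r1 by (subst summable_Suc_iff[symmetric]) simp
      qed (use r1 in auto)
      show "norm \<bar>K j\<bar> \<le> \<bar>r\<bar> ^ j + (if j = 0 then 0 else \<bar>r\<bar> ^ (j - 1))" for j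
        using abs_triangle_ineq[of "r ^ j" "r ^ (j - 1)"] by (simp add: K_def power_abs)
    qed
    ultimately show ?thesis by simp
  qed
  then show "K sums (2 / (1 - r))" "summable (\<lambda>j. \<bar>K j\<bar>)" by auto
qed

lemma critical_total_eq:
  "of_real (\<Sum>k\<le>n. g n k) = (\<Sum>j\<le>n. of_real (K j) * osc_integral b n (\<lambda>x. cis (real j * x)))"
proof -
  define u where "u = complex_of_real (1 / \<tau>)"
  let ?X = "fps_X :: complex fps"
  define R where "R = fps_const (complex_of_real r)"
  define U where "U = fps_const u"
  \<comment> \<open>Comparing coefficients in the factorisation requires
    \<open>u \<gamma> = 1 - r\<close> and \<open>u \<beta> = b + 1 + r\<close>. The first defines
    \<open>r\<close>; their sum is the criticality condition \<open>u \<tau> = 1\<close>.\<close>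
  have u1: "u * of_real \<gamma> = 1 - of_real r"
    by (simp add: r_def u_def)
  have "(1 / \<tau>) * (\<beta> + \<gamma>) = b + 2" using pos b by (simp add: \<tau>_def)
  then have "u * of_real (\<beta> + \<gamma>) = of_real (b + 2)"
    unfolding u_def by (simp only: of_real_mult[symmetric])
  then have u2: "u * of_real \<beta> = of_real b + 1 + of_real r"
    using u1 by (simp add: algebra_simps)
  have "phi b - U * fps_X * arch \<beta> \<gamma> = (1 - ?X) * (1 - R * ?X)"
  proof -
    have UB: "U * fps_const (of_real \<beta>) = fps_const (of_real b) + 1 + R"
      unfolding U_def R_def fps_const_mult u2 by (simp only: fps_const_add[symmetric] fps_const_1_eq_1)
    have UG: "U * fps_const (of_real \<gamma>) = 1 - R"
      unfolding U_def R_def fps_const_mult u1 by (simp only: fps_const_sub[symmetric] fps_const_1_eq_1)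
    have "phi b - U * fps_X * arch \<beta> \<gamma> = phi b - (U * fps_const (of_real \<beta>)) * ?X - (U * fps_const (of_real \<gamma>)) * ?X ^ 2"
      by (simp add: algebra_simps power2_eq_square)
    also have "\<dots> = (1 - ?X) * (1 - R * ?X)"
      unfolding UB UG by (simp add: algebra_simps power2_eq_square)
    finally show ?thesis .
  qed
  then have "(1 - ?X ^ 2) * inverse (phi b - U * fps_X * arch \<beta> \<gamma>) =
      ((1 - ?X) * inverse (1 - ?X)) * ((1 + ?X) * inverse (1 - R * ?X))"
  proof -
    have "1 - ?X ^ 2 = (1 - ?X) * (1 + ?X)" by (simp add: algebra_simps power2_eq_square)
    then show ?thesis using \<open>phi b - _ = _\<close> by (simp only: fps_inverse_mult mult_ac)
  qed
  \<comment> \<open>The zero \<open>y = 1\<close> of the denominator cancels the zero of the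
    Jacobian factor at the Laplace peak. This is why the critical total has order
    \<open>n^(-1/2)\<close>, against \<open>n^(-3/2)\<close> below the critical weight.\<close>
  also have "(1 - ?X) * inverse (1 - ?X) = 1"
    by (rule inverse_mult_eq_1') simp
  finally have D: "(1 - ?X ^ 2) * inverse (phi b - U * fps_X * arch \<beta> \<gamma>) = (1 + ?X) * inverse (1 - R * ?X)"
    by simp
  have K: "fps_nth ((1 + ?X) * inverse (1 - R * ?X)) j = of_real (K j)" for j
    by (cases j) (simp_all add: distrib_right R_def fps_nth_inverse_one_minus_linear K_def)
  have "of_real (\<Sum>k\<le>n. g n k) = (\<Sum>k\<le>n. walk_coeff b \<beta> \<gamma> n 0 k * u ^ k) / of_real ((b + 2) ^ n)"
    unfolding of_real_sum sum_divide_distrib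
    by (intro sum.cong refl) (simp add: g_def u_def f[symmetric] power_divide mult_ac)
  also have "\<dots> = fps_nth (((1 + ?X) * inverse (1 - R * ?X)) * phi b ^ n) n / of_real ((b + 2) ^ n)"
    unfolding sum_walk_coeff U_def[symmetric] mult.assoc D[symmetric] by (simp only: mult_ac)
  also have "\<dots> = (\<Sum>j\<le>n. of_real (K j) * (fps_nth (phi b ^ n) (n - j) / of_real ((b + 2) ^ n)))"
    unfolding fps_mult_nth[of "(1 + ?X) * inverse (1 - R * ?X)"] K
    by (simp add: sum_divide_distrib atLeast0AtMost)
  also have "\<dots> = (\<Sum>j\<le>n. of_real (K j) * osc_integral b n (\<lambda>x. cis (real j * x)))"
  proof (intro sum.cong refl arg_cong2[where f = "(*)"])
    fix j assume "j \<in> {..n}"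
    then have "fps_nth (phi b ^ n) (n - j) = of_real ((b + 2) ^ n) * osc_integral b n (\<lambda>x. cis (real j * x))"
      using fps_nth_osc_integral[of j n 0] by simp
    moreover have nz: "complex_of_real ((b + 2) ^ n) \<noteq> 0" unfolding of_real_eq_0_iff using b by simp
    ultimately show "fps_nth (phi b ^ n) (n - j) / of_real ((b + 2) ^ n) = osc_integral b n (\<lambda>x. cis (real j * x))"
      by (simp only: nonzero_mult_div_cancel_left[OF nz])
  qed
  finally show ?thesis .
qed

text \<open>The phase \<open>cis (j x)\<close> is invisible at scale \<open>1 / sqrt n\<close>, so
  every term has limit \<open>K j * ell 0\<close>; absolute summability of \<open>K\<close> permits
  the exchange of limit and sum.\<close>

lemma critical_total_tendsto:
  "(\<lambda>n. sqrt (real n) * (\<Sum>k\<le>n. g n k)) \<longlonglongrightarrow> 2 / ((b + 2) * \<kappa>) * ell 0"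
proof -
  define h where "h j n = (if j \<le> n then of_real (K j) * (sqrt (real n) * osc_integral b n (\<lambda>x. cis (real j * x))) else 0)" for j n
  have lim: "(\<lambda>n. h j n) \<longlonglongrightarrow> of_real (K j) * of_real (ell 0)" for j
  proof (rule Lim_transform_eventually)
    have "(\<lambda>n. real n / real n) \<longlonglongrightarrow> 1" by real_asymp
    then show "(\<lambda>n. of_real (K j) * (sqrt (real n) * osc_integral b n (\<lambda>x. cis (real j * x)))) \<longlonglongrightarrow> of_real (K j) * of_real (ell 0)"
      using osc_integral_v_tendsto[of "\<lambda>_. 0" 0 "\<lambda>n. n" j] by (intro tendsto_mult tendsto_const) simp
    show "\<forall>\<^sub>F n in sequentially. of_real (K j) * (sqrt (real n) * osc_integral b n (\<lambda>x. cis (real j * x))) = h j n"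
      using eventually_ge_at_top[of j] by eventually_elim (simp add: h_def)
  qed
  have bound: "norm (h j n) \<le> \<bar>K j\<bar> * pi" for j n
  proof (cases "j \<le> n \<and> n > 0")
    case True
    then have "norm (osc_integral b n (\<lambda>x. cis (real j * x))) \<le> pi / sqrt (real n)"
      using cis_measurable by (intro norm_osc_integral_le b) auto
    then have "sqrt (real n) * norm (osc_integral b n (\<lambda>x. cis (real j * x))) \<le> pi"
      using True by (simp add: field_simps)
    then show ?thesis using True by (simp add: h_def norm_mult mult_left_mono)
  qed (auto simp: h_def)
  have total: "(\<lambda>n. \<Sum>j. h j n) \<longlonglongrightarrow> (\<Sum>j. of_real (K j) * of_real (ell 0))"
  proof (rule tannerys_theorem[THEN conjunct2, THEN conjunct2, OF lim])
    show "summable (\<lambda>j. \<bar>K j\<bar> * pi)" by (intro summable_mult2 K_summable)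
    show "\<forall>\<^sub>F (j, n) in at_top \<times>\<^sub>F sequentially. norm (h j n) \<le> \<bar>K j\<bar> * pi"
      using bound by (auto intro: always_eventually)
  qed auto
  have eq1: "(\<Sum>j. h j n) = of_real (sqrt (real n) * (\<Sum>k\<le>n. g n k))" for n
    unfolding of_real_mult critical_total_eq
    by (subst suminf_finite[of "{..n}"]) (auto simp: h_def sum_distrib_left mult_ac)
  have eq2: "(\<Sum>j. of_real (K j) * of_real (ell 0)) = complex_of_real (2 / (1 - r) * ell 0)"
  proof -
    have "(\<lambda>j. complex_of_real (K j * ell 0)) sums of_real (2 / (1 - r) * ell 0)"
      by (intro sums_of_real sums_mult2 K_sums)
    then show ?thesis by (simp add: sums_iff)
  qed
  show ?thesis using total unfolding eq1 eq2 tendsto_of_real_iff r(3) .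
qed

text \<open>Equals \<open>- c_H F / tau_H F\<close> for each family \<open>F\<close>. With this
  choice the Gaussian in \<open>ell (y / scale)\<close> becomes
  \<open>exp (- y\<^sup>2 / 4)\<close>.\<close>

definition scale :: real where "scale = \<kappa> * sqrt (b + 2)"

lemma scale_pos: "scale > 0" using \<kappa> b by (simp add: scale_def)

text \<open>The factor \<open>y\<close> descends from the factor \<open>k\<close> of the cycle
  lemma, the exponential from \<open>ell\<close>; together they form the Rayleigh density with
  \<open>\<sigma>\<^sup>2 = 2\<close>.\<close>

lemma critical_local_limit:
  assumes y: "y > 0"
  shows "(\<lambda>n. sqrt (real n) / scale * (g n (nat \<lfloor>y * sqrt (real n) / scale\<rfloor>) / (\<Sum>j\<le>n. g n j)))
    \<longlonglongrightarrow> y / 2 * exp (- y\<^sup>2 / 4)"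
proof -
  define k where "k n = nat \<lfloor>y * sqrt (real n) / scale\<rfloor>" for n
  have lim: "(\<lambda>n. real (k n) / sqrt (real n)) \<longlonglongrightarrow> y / scale"
  proof (rule real_tendsto_sandwich)
    have nn: "y * sqrt (real n) / scale \<ge> 0" for n using y scale_pos by simp
    then have fl: "real (k n) \<le> y * sqrt (real n) / scale" "y * sqrt (real n) / scale - 1 \<le> real (k n)" for n
      unfolding k_def using of_int_floor_le[of "y * sqrt (real n) / scale"] floor_correct[of "y * sqrt (real n) / scale"]
      by (simp_all add: of_nat_nat)
    show "\<forall>\<^sub>F n in sequentially. y / scale - 1 / sqrt (real n) \<le> real (k n) / sqrt (real n)"
      using eventually_gt_at_top[of 0]
    proof eventually_elim
      case (elim n)
      have "(y * sqrt (real n) / scale - 1) / sqrt (real n) \<le> real (k n) / sqrt (real n)"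
        using fl by (intro divide_right_mono) auto
      then show ?case using elim by (simp add: diff_divide_distrib)
    qed
    show "\<forall>\<^sub>F n in sequentially. real (k n) / sqrt (real n) \<le> y / scale"
      using eventually_gt_at_top[of 0]
    proof eventually_elim
      case (elim n)
      have "real (k n) / sqrt (real n) \<le> (y * sqrt (real n) / scale) / sqrt (real n)"
        using fl by (intro divide_right_mono) auto
      then show ?case using elim by simp
    qed
    show "(\<lambda>n. y / scale - 1 / sqrt (real n)) \<longlonglongrightarrow> y / scale" by real_asymp
  qed auto
  have k1: "\<forall>\<^sub>F n in sequentially. 1 \<le> k n"
  proof -
    have "\<forall>\<^sub>F n in sequentially. real (k n) / sqrt (real n) > 0"
      using y scale_pos by (intro order_tendstoD(1)[OF lim]) auto
    then show ?thesis by eventually_elim (auto simp: zero_less_divide_iff Suc_le_eq)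
  qed
  have Z: "2 / ((b + 2) * \<kappa>) * ell 0 \<noteq> 0" using \<kappa> b ell_pos[of 0] by simp
  have L: "(\<lambda>n. (1 / scale) * ((real (k n) / sqrt (real n)) * (real n * sqrt (real n) * g n (k n) / real (k n)) / (sqrt (real n) * (\<Sum>j\<le>n. g n j))))
    \<longlonglongrightarrow> (1 / scale) * ((y / scale) * (\<kappa> * ell (y / scale)) / (2 / ((b + 2) * \<kappa>) * ell 0))"
    by (intro tendsto_mult tendsto_divide tendsto_const lim g_tendsto[OF lim k1] critical_total_tendsto Z)
  have EV: "\<forall>\<^sub>F n in sequentially. (1 / scale) * ((real (k n) / sqrt (real n)) * (real n * sqrt (real n) * g n (k n) / real (k n)) / (sqrt (real n) * (\<Sum>j\<le>n. g n j)))
    = sqrt (real n) / scale * (g n (k n) / (\<Sum>j\<le>n. g n j))"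
    using k1 eventually_gt_at_top[of 0]
  proof eventually_elim
    case (elim n)
    have n3: "real n * sqrt (real n) = sqrt (real n) * sqrt (real n) * sqrt (real n)" by simp
    have "(1 / scale) * ((real (k n) / s) * (s * s * s * G / real (k n)) / (s * Z)) = s / scale * (G / Z)"
      if "s \<noteq> 0" for s G Z
      using that elim by simp
    from this[of "sqrt (real n)"] show ?case unfolding n3 using elim by simp
  qed
  have EQ: "(1 / scale) * ((y / scale) * (\<kappa> * ell (y / scale)) / (2 / ((b + 2) * \<kappa>) * ell 0)) = y / 2 * exp (- y\<^sup>2 / 4)"
  proof -
    have sc: "scale\<^sup>2 = \<kappa>\<^sup>2 * (b + 2)" using b by (simp add: scale_def power_mult_distrib)
    have "ell (y / scale) = ell 0 * exp (- ((\<kappa> * (y / scale))\<^sup>2 * (b + 2) / 4))"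
      by (simp add: ell_def)
    also have "(\<kappa> * (y / scale))\<^sup>2 * (b + 2) / 4 = y\<^sup>2 / 4"
      using sc scale_pos b \<kappa> by (simp add: power_mult_distrib power_divide)
    finally have e: "ell (y / scale) = ell 0 * exp (- y\<^sup>2 / 4)" by simp
    have id: "(1 / scale) * ((y / scale) * (\<kappa> * (L * E)) / (2 / ((b + 2) * \<kappa>) * L)) = (\<kappa>\<^sup>2 * (b + 2)) / scale\<^sup>2 * (y / 2 * E)"
      if "L \<noteq> 0" for L E
      using that \<kappa> b by (simp add: power2_eq_square mult_ac)
    have one: "(\<kappa>\<^sup>2 * (b + 2)) / scale\<^sup>2 = 1" using sc scale_pos \<kappa> b by simp
    have nz: "ell 0 \<noteq> 0" using ell_pos[of 0] by simp
    show ?thesis unfolding e id[OF nz] one by simp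
  qed
  show ?thesis using Lim_transform_eventually[OF L EV] unfolding EQ k_def .
qed

end

section \<open>Weak convergence of lattice distributions\<close>

lemma cdf_distr_pmf:
  "cdf (distr (measure_pmf p) borel h) x = measure_pmf.prob p {k. h k \<le> x}"
proof -
  have "h -` {..x} \<inter> space (measure_pmf p) = {k. h k \<le> x}" by auto
  moreover have "h \<in> measurable (measure_pmf p) borel" by simp
  ultimately show ?thesis by (simp only: cdf_def measure_distr atMost_borel)
qed

text \<open>Only finitely many lattice points lie below a threshold, so the distribution functions
  converge at every \<open>x\<close>. The atom at \<open>0\<close> is moved to \<open>-1\<close>,
  has no counterpart in the limit, and must die out.\<close>

lemma weak_conv_m_shifted_pmf:
  fixes p :: "nat \<Rightarrow> nat pmf"
  assumes zero: "(\<lambda>n. pmf (p n) 0) \<longlonglongrightarrow> 0"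
    and Suc: "\<And>k. (\<lambda>n. pmf (p n) (Suc k)) \<longlonglongrightarrow> pmf N k"
  shows "weak_conv_m (\<lambda>n. distr (measure_pmf (p n)) borel (\<lambda>k. real k - 1)) (distr (measure_pmf N) borel real)"
  unfolding weak_conv_m_def weak_conv_def cdf_distr_pmf
proof (intro allI impI)
  fix x :: real
  define A where "A = {j. real j \<le> x}"
  have "A \<subseteq> {..nat \<lfloor>x\<rfloor>}" by (auto simp: A_def le_nat_floor)
  then have A: "finite A" by (rule finite_subset) simp
  show "(\<lambda>n. measure_pmf.prob (p n) {k. real k - 1 \<le> x}) \<longlonglongrightarrow> measure_pmf.prob N {k. real k \<le> x}"
  proof (cases "x < - 1")
    case True
    then have "{k. real k - 1 \<le> x} = {}" "{k. real k \<le> x} = {}" by auto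
    then show ?thesis by (simp only: measure_empty tendsto_const)
  next
    case False
    have "{k. real k - 1 \<le> x} = insert 0 (Suc ` A)"
    proof (intro set_eqI)
      show "k \<in> {k. real k - 1 \<le> x} \<longleftrightarrow> k \<in> insert 0 (Suc ` A)" for k
        using False by (cases k) (auto simp: A_def)
    qed
    then have "measure_pmf.prob (p n) {k. real k - 1 \<le> x} = pmf (p n) 0 + (\<Sum>k\<in>A. pmf (p n) (Suc k))" for n
      using A by (subst measure_measure_pmf_finite) (auto simp: sum.reindex)
    moreover have "measure_pmf.prob N {k. real k \<le> x} = 0 + (\<Sum>k\<in>A. pmf N k)"
      using A by (subst measure_measure_pmf_finite) (auto simp: A_def)
    ultimately show ?thesis
      by (simp only:) (intro tendsto_add zero tendsto_sum Suc)
  qed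
qed

text \<open>The half-open cells of width \<open>\<delta>\<close> partition the half-line; this is
  the passage between lattice masses and step densities.\<close>

lemma nn_integral_step_function:
  fixes w :: "nat \<Rightarrow> ennreal"
  assumes \<delta>: "\<delta> > 0"
  shows "(\<integral>\<^sup>+y. (if y \<ge> 0 then w (nat \<lfloor>y / \<delta>\<rfloor>) else 0) \<partial>lborel) = (\<Sum>k. w k * ennreal \<delta>)"
proof -
  define I where "I k = {real k * \<delta>..<real (Suc k) * \<delta>}" for k
  have I: "y \<in> I k \<longleftrightarrow> y \<ge> 0 \<and> k = nat \<lfloor>y / \<delta>\<rfloor>" for y k
  proof -
    have "y \<in> I k \<longleftrightarrow> real k \<le> y / \<delta> \<and> y / \<delta> < real k + 1"
      using \<delta> by (simp add: I_def field_simps)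
    also have "\<dots> \<longleftrightarrow> \<lfloor>y / \<delta>\<rfloor> = int k"
      by (simp add: floor_eq_iff)
    also have "\<dots> \<longleftrightarrow> 0 \<le> \<lfloor>y / \<delta>\<rfloor> \<and> k = nat \<lfloor>y / \<delta>\<rfloor>"
    proof -
      have "z = int k \<longleftrightarrow> 0 \<le> z \<and> k = nat z" for z by auto
      then show ?thesis .
    qed
    also have "0 \<le> \<lfloor>y / \<delta>\<rfloor> \<longleftrightarrow> y \<ge> 0" using \<delta> by (simp add: zero_le_divide_iff)
    finally show ?thesis .
  qed
  have "(if y \<ge> 0 then w (nat \<lfloor>y / \<delta>\<rfloor>) else 0) = (\<Sum>k. w k * indicator (I k) y)" for y
  proof (cases "y \<ge> 0")
    case True
    have "(\<Sum>k. w k * indicator (I k) y) = (\<Sum>k\<in>{nat \<lfloor>y / \<delta>\<rfloor>}. w k * indicator (I k) y)"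
      by (rule suminf_finite) (auto simp: I)
    then show ?thesis using True by (simp add: I indicator_def)
  qed (simp add: I indicator_def)
  then have "(\<integral>\<^sup>+y. (if y \<ge> 0 then w (nat \<lfloor>y / \<delta>\<rfloor>) else 0) \<partial>lborel) = (\<integral>\<^sup>+y. (\<Sum>k. w k * indicator (I k) y) \<partial>lborel)"
    by simp
  also have "\<dots> = (\<Sum>k. \<integral>\<^sup>+y. w k * indicator (I k) y \<partial>lborel)"
    by (rule nn_integral_suminf) (auto simp: I_def)
  also have "\<dots> = (\<Sum>k. w k * ennreal \<delta>)"
    using \<delta> by (subst nn_integral_cmult_indicator) (auto simp: I_def algebra_simps)
  finally show ?thesis .
qed

text \<open>The local limit makes step densities converge almost everywhere, and Scheffe's lemma
  upgrades this to convergence in mean. The lattice distribution function at \<open>x\<close> is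
  exactly the integral of the step density up to a cell boundary \<open>t n\<close>, which for
  \<open>x \<ge> 0\<close> tends to \<open>x\<close>.\<close>

lemma weak_conv_m_local_limit:
  fixes p :: "nat \<Rightarrow> nat pmf" and d :: "real \<Rightarrow> real"
  assumes C: "C > 0"
    and d: "d \<in> borel_measurable borel" "\<And>y. d y \<ge> 0" "\<And>y. y < 0 \<Longrightarrow> d y = 0" "(\<integral>\<^sup>+y. d y \<partial>lborel) = 1"
    and lim: "\<And>y. y > 0 \<Longrightarrow> (\<lambda>n. sqrt (real n) / C * pmf (p n) (nat \<lfloor>y * sqrt (real n) / C\<rfloor>)) \<longlonglongrightarrow> d y"
  shows "weak_conv_m (\<lambda>n. distr (measure_pmf (p n)) borel (\<lambda>k. C * (real k / sqrt (real n)))) (density lborel (\<lambda>y. ennreal (d y)))"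
  unfolding weak_conv_m_def weak_conv_def cdf_distr_pmf
proof (intro allI impI)
  fix x :: real
  have [measurable]: "d \<in> borel_measurable borel" by (rule d)
  have int_d: "integrable lborel d"
    using d by (intro integrableI_nonneg) auto
  \<comment> \<open>The mass at \<open>k\<close> is spread evenly over the cell of width
    \<open>C / sqrt n\<close> whose left end is the rescaled atom.\<close>
  define F where "F n y = (if y \<ge> 0 \<and> n > 0 then sqrt (real n) / C * pmf (p n) (nat \<lfloor>y / (C / sqrt (real n))\<rfloor>) else 0)" for n y
  have F0: "F n y \<ge> 0" for n y using C by (simp add: F_def)
  have [measurable]: "F n \<in> borel_measurable borel" for n unfolding F_def[abs_def] by measurable
  have F_cut: "(\<integral>\<^sup>+y. ennreal (F n y) * indicator {..<real m * (C / sqrt (real n))} y \<partial>lborel) = ennreal (measure_pmf.prob (p n) {..<m})"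
    if n: "n > 0" for n m
  proof -
    let ?d = "C / sqrt (real n)"
    have d: "?d > 0" using C n by simp
    have "(\<integral>\<^sup>+y. ennreal (F n y) * indicator {..<real m * ?d} y \<partial>lborel) =
      (\<integral>\<^sup>+y. (if y \<ge> 0 then (\<lambda>k. if k < m then ennreal (pmf (p n) k / ?d) else 0) (nat \<lfloor>y / ?d\<rfloor>) else 0) \<partial>lborel)"
    proof (rule nn_integral_cong)
      fix y
      have "y < real m * ?d \<longleftrightarrow> nat \<lfloor>y / ?d\<rfloor> < m" if "y \<ge> 0"
      proof -
        have "y < real m * ?d \<longleftrightarrow> y / ?d < real m" using pos_divide_less_eq[OF d, of y "real m"] by simp
        also have "\<dots> \<longleftrightarrow> \<lfloor>y / ?d\<rfloor> < int m" by (simp add: floor_less_iff)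
        also have "\<dots> \<longleftrightarrow> nat \<lfloor>y / ?d\<rfloor> < m" using that C by (subst nat_less_iff) auto
        finally show ?thesis .
      qed
      then show "ennreal (F n y) * indicator {..<real m * ?d} y =
         (if y \<ge> 0 then (\<lambda>k. if k < m then ennreal (pmf (p n) k / ?d) else 0) (nat \<lfloor>y / ?d\<rfloor>) else 0)"
        using n by (auto simp: F_def indicator_def mult.commute)
    qed
    also have "\<dots> = (\<Sum>k. (if k < m then ennreal (pmf (p n) k / ?d) else 0) * ennreal ?d)"
      by (rule nn_integral_step_function[OF d])
    also have "\<dots> = (\<Sum>k<m. (if k < m then ennreal (pmf (p n) k / ?d) else 0) * ennreal ?d)"
      by (rule suminf_finite) auto
    also have "\<dots> = (\<Sum>k<m. ennreal (pmf (p n) k))"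
      using d n C by (intro sum.cong refl) (auto simp flip: ennreal_mult'')
    also have "\<dots> = ennreal (measure_pmf.prob (p n) {..<m})"
      by (simp add: measure_measure_pmf_finite sum_ennreal)
    finally show ?thesis .
  qed
  have F_le: "(\<integral>\<^sup>+y. ennreal (F n y) \<partial>lborel) \<le> 1" for n
  proof (cases "n > 0")
    case True
    let ?d = "C / sqrt (real n)"
    have d: "?d > 0" using C True by simp
    have "(\<integral>\<^sup>+y. ennreal (F n y) \<partial>lborel) = (\<integral>\<^sup>+y. (if y \<ge> 0 then (\<lambda>k. ennreal (pmf (p n) k / ?d)) (nat \<lfloor>y / ?d\<rfloor>) else 0) \<partial>lborel)"
      using True by (intro nn_integral_cong) (auto simp: F_def mult.commute)
    also have "\<dots> = (\<Sum>k. ennreal (pmf (p n) k / ?d) * ennreal ?d)"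
      by (rule nn_integral_step_function[OF d])
    also have "\<dots> = (\<Sum>k. ennreal (pmf (p n) k))"
      using d True C by (intro suminf_cong) (auto simp flip: ennreal_mult'')
    also have "\<dots> = 1"
      using nn_integral_pmf_eq_1[of "p n"] by (simp add: nn_integral_count_space_nat)
    finally show ?thesis by simp
  qed (simp add: F_def)
  have F_lim: "AE y in lborel. (\<lambda>n. F n y) \<longlonglongrightarrow> d y"
    using AE_lborel_singleton[of 0]
  proof eventually_elim
    case (elim y)
    show ?case
    proof (cases "y > 0")
      case True
      have "\<forall>\<^sub>F n in sequentially. sqrt (real n) / C * pmf (p n) (nat \<lfloor>y * sqrt (real n) / C\<rfloor>) = F n y"
        using eventually_gt_at_top[of 0] by eventually_elim (use True in \<open>simp add: F_def\<close>)
      then show ?thesis by (rule Lim_transform_eventually[OF lim[OF True]])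
    next
      case False
      then show ?thesis using elim d(3)[of y] by (simp add: F_def)
    qed
  qed
  have scheffe: "(\<lambda>n. \<integral>\<^sup>+y. norm (F n y - d y) \<partial>lborel) \<longlonglongrightarrow> 0"
    by (rule Scheffe_lemma2[OF _ int_d F_lim]) (use F_le F0 d in auto)
  have int_F: "integrable lborel (F n)" for n
    using F_le[of n] F0 by (intro integrableI_nonneg) (auto simp: order.strict_trans1 intro: le_less_trans)
  have L1: "(\<lambda>n. \<integral>y. \<bar>F n y - d y\<bar> \<partial>lborel) \<longlonglongrightarrow> 0"
  proof -
    have "(\<integral>\<^sup>+y. norm (F n y - d y) \<partial>lborel) = ennreal (\<integral>y. \<bar>F n y - d y\<bar> \<partial>lborel)" for n
      using int_F[of n] int_d by (subst nn_integral_eq_integral) auto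
    then show ?thesis using scheffe
      by (simp add: ennreal_0[symmetric] tendsto_ennreal_iff del: ennreal_0)
  qed
  \<comment> \<open>The number of cells up to and including the one that contains \<open>x\<close>:
    the atom sits at the left end of its cell, so that cell counts in full, hence the
    \<open>Suc\<close>. For \<open>x < 0\<close> there is none.\<close>
  define m where "m n = (if x \<ge> 0 then Suc (nat \<lfloor>x / (C / sqrt (real n))\<rfloor>) else 0)" for n
  define t where "t n = real (m n) * (C / sqrt (real n))" for n
  have cdf_eq: "measure_pmf.prob (p n) {k. C * (real k / sqrt (real n)) \<le> x} = (\<integral>y. F n y * indicator {..<t n} y \<partial>lborel)"
    if n: "n > 0" for n
  proof -
    have "{k. C * (real k / sqrt (real n)) \<le> x} = {..<m n}"
    proof (cases "x \<ge> 0")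
      case True
      have iff: "C * (real k / sqrt (real n)) \<le> x \<longleftrightarrow> k \<le> nat \<lfloor>x / (C / sqrt (real n))\<rfloor>" for k
      proof -
        define q where "q = C / sqrt (real n)"
        have q: "q > 0" using n C by (simp add: q_def)
        have "C * (real k / sqrt (real n)) = real k * q" by (simp add: q_def)
        moreover have "real k * q \<le> x \<longleftrightarrow> real k \<le> x / q" using q by (simp add: pos_le_divide_eq)
        moreover have "real k \<le> x / q \<longleftrightarrow> int k \<le> \<lfloor>x / q\<rfloor>" by (simp add: le_floor_iff)
        moreover have "int k \<le> \<lfloor>x / q\<rfloor> \<longleftrightarrow> k \<le> nat \<lfloor>x / q\<rfloor>"
        proof -
          have "0 \<le> \<lfloor>x / q\<rfloor>" using True q by simp
          then show ?thesis by linarith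
        qed
        ultimately show ?thesis unfolding q_def by (simp only:)
      qed
      have "m n = Suc (nat \<lfloor>x / (C / sqrt (real n))\<rfloor>)"
        unfolding m_def by (rule if_P[OF True])
      then show ?thesis unfolding iff
        by (simp only: lessThan_Suc_atMost atMost_def)
    next
      case False
      have "\<not> C * (real k / sqrt (real n)) \<le> x" for k
      proof -
        have "0 \<le> C * (real k / sqrt (real n))" using C by simp
        then show ?thesis using False by linarith
      qed
      then show ?thesis using False by (simp add: m_def)
    qed
    moreover have "ennreal (\<integral>y. F n y * indicator {..<t n} y \<partial>lborel) = ennreal (measure_pmf.prob (p n) {..<m n})"
    proof -
      have "ennreal (\<integral>y. F n y * indicator {..<t n} y \<partial>lborel) = (\<integral>\<^sup>+y. ennreal (F n y * indicator {..<t n} y) \<partial>lborel)"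
        using F0 by (intro nn_integral_eq_integral[symmetric] integrable_real_mult_indicator int_F) auto
      also have "\<dots> = (\<integral>\<^sup>+y. ennreal (F n y) * indicator {..<t n} y \<partial>lborel)"
        by (intro nn_integral_cong) (auto simp: indicator_def)
      also have "\<dots> = ennreal (measure_pmf.prob (p n) {..<m n})"
        unfolding t_def by (rule F_cut[OF n])
      finally show ?thesis .
    qed
    moreover have "(\<integral>y. F n y * indicator {..<t n} y \<partial>lborel) \<ge> 0"
      using F0 by (intro Bochner_Integration.integral_nonneg) auto
    ultimately show ?thesis by simp
  qed
  have lim_d: "(\<lambda>n. \<integral>y. d y * indicator {..<t n} y \<partial>lborel) \<longlonglongrightarrow> (\<integral>y. d y * indicator {..x} y \<partial>lborel)"
  proof (rule integral_dominated_convergence[OF _ _ int_d])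
    show "AE y in lborel. (\<lambda>n. d y * indicator {..<t n} y) \<longlonglongrightarrow> d y * indicator {..x} y"
      using AE_lborel_singleton[of x]
    proof eventually_elim
      case (elim y)
      show ?case
      proof (cases "y < 0")
        case True
        then show ?thesis by (simp add: d)
      next
        case False
        show ?thesis
        proof (cases "x \<ge> 0")
          case True
          have "t \<longlonglongrightarrow> x"
          proof (rule real_tendsto_sandwich)
            have bnd: "x \<le> t n \<and> t n \<le> x + C / sqrt (real n)" if n: "n > 0" for n
            proof -
              define q where "q = C / sqrt (real n)"
              have q: "q > 0" using C n by (simp add: q_def)
              have rm: "real (m n) = of_int \<lfloor>x / q\<rfloor> + 1"
                using True q by (simp add: m_def flip: q_def)
              have "x / q \<le> real (m n)" "real (m n) \<le> x / q + 1"
                unfolding rm by linarith+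
              then have "x / q * q \<le> real (m n) * q" "real (m n) * q \<le> (x / q + 1) * q"
                using q by (simp_all only: mult_le_cancel_right_pos)
              then show ?thesis using q by (simp add: t_def distrib_right flip: q_def)
            qed
            show "\<forall>\<^sub>F n in sequentially. x \<le> t n" "\<forall>\<^sub>F n in sequentially. t n \<le> x + C / sqrt (real n)"
              using eventually_gt_at_top[of 0] by (eventually_elim, use bnd in blast)+
            have "(\<lambda>n. C * inverse (sqrt (real n))) \<longlonglongrightarrow> C * 0"
              by (intro tendsto_mult tendsto_const tendsto_inverse_0_at_top filterlim_compose[OF sqrt_at_top] filterlim_real_sequentially)
            then show "(\<lambda>n. x + C / sqrt (real n)) \<longlonglongrightarrow> x"
              using tendsto_add[OF tendsto_const[of x]] by (fastforce simp: divide_inverse)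
          qed auto
          then have "\<forall>\<^sub>F n in sequentially. indicator {..x} y = (indicator {..<t n} y :: real)"
          proof (cases "y < x")
            case True
            from order_tendstoD(1)[OF \<open>t \<longlonglongrightarrow> x\<close> True] show ?thesis
              by eventually_elim (use True in \<open>simp add: indicator_def\<close>)
          next
            case False
            then have "x < y" using elim by simp
            from order_tendstoD(2)[OF \<open>t \<longlonglongrightarrow> x\<close> this] show ?thesis
              by eventually_elim (use \<open>x < y\<close> in \<open>simp add: indicator_def\<close>)
          qed
          then have "\<forall>\<^sub>F n in sequentially. d y * indicator {..x} y = d y * indicator {..<t n} y"
            by eventually_elim simp
          then show ?thesis by (rule Lim_transform_eventually[OF tendsto_const])
        next
          case x: False
          then show ?thesis using False by (simp add: t_def m_def indicator_def)
        qed
      qed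
    qed
    show "AE y in lborel. norm (d y * indicator {..<t n} y) \<le> d y" for n
      using d by (auto simp: indicator_def)
  qed measurable
  have diff0: "(\<lambda>n. (\<integral>y. (F n y - d y) * indicator {..<t n} y \<partial>lborel)) \<longlonglongrightarrow> 0"
  proof (rule Lim_null_comparison[OF _ L1])
    show "\<forall>\<^sub>F n in sequentially. norm (\<integral>y. (F n y - d y) * indicator {..<t n} y \<partial>lborel) \<le> (\<integral>y. \<bar>F n y - d y\<bar> \<partial>lborel)"
    proof (intro always_eventually allI)
      fix n
      have "integrable lborel (\<lambda>y. (F n y - d y) * indicator {..<t n} y)"
        by (intro integrable_real_mult_indicator Bochner_Integration.integrable_diff int_F int_d) auto
      then show "norm (\<integral>y. (F n y - d y) * indicator {..<t n} y \<partial>lborel) \<le> (\<integral>y. \<bar>F n y - d y\<bar> \<partial>lborel)"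
        using int_F[of n] int_d
        by (intro order.trans[OF integral_norm_bound] integral_mono) (auto simp: indicator_def)
    qed
  qed
  have L: "(\<lambda>n. (\<integral>y. F n y * indicator {..<t n} y \<partial>lborel)) \<longlonglongrightarrow> (\<integral>y. d y * indicator {..x} y \<partial>lborel)"
  proof -
    have "(\<integral>y. (F n y - d y) * indicator {..<t n} y \<partial>lborel) + (\<integral>y. d y * indicator {..<t n} y \<partial>lborel) = (\<integral>y. F n y * indicator {..<t n} y \<partial>lborel)" for n
      by (subst Bochner_Integration.integral_add[symmetric])
        (auto intro!: integrable_real_mult_indicator Bochner_Integration.integrable_diff int_F int_d simp: algebra_simps)
    then show ?thesis
      using tendsto_add[OF diff0 lim_d] by (simp only: add_0_left)
  qed
  have EV: "\<forall>\<^sub>F n in sequentially. (\<integral>y. F n y * indicator {..<t n} y \<partial>lborel) = measure_pmf.prob (p n) {k. C * (real k / sqrt (real n)) \<le> x}"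
    using eventually_gt_at_top[of 0] by eventually_elim (rule cdf_eq[symmetric])
  have EQ: "cdf (density lborel (\<lambda>y. ennreal (d y))) x = (\<integral>y. d y * indicator {..x} y \<partial>lborel)"
  proof -
    have "emeasure (density lborel (\<lambda>y. ennreal (d y))) {..x} = (\<integral>\<^sup>+y. ennreal (d y * indicator {..x} y) \<partial>lborel)"
      by (subst emeasure_density) (auto intro!: nn_integral_cong simp: indicator_def)
    also have "\<dots> = ennreal (\<integral>y. d y * indicator {..x} y \<partial>lborel)"
      using d by (intro nn_integral_eq_integral integrable_real_mult_indicator int_d) auto
    finally show ?thesis
      using d by (simp add: cdf_def measure_def Bochner_Integration.integral_nonneg)
  qed
  show "(\<lambda>n. measure_pmf.prob (p n) {k. C * (real k / sqrt (real n)) \<le> x}) \<longlonglongrightarrow>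
      cdf (density lborel (\<lambda>y. ennreal (d y))) x"
    using Lim_transform_eventually[OF L EV] unfolding EQ .
qed

lemma nn_integral_rayleigh_density:
  assumes \<sigma>: "\<sigma> > 0"
  shows "(\<integral>\<^sup>+y. ennreal (rayleigh_density \<sigma> y) \<partial>lborel) = 1"
proof -
  have "(\<integral>\<^sup>+y. ennreal (y / \<sigma>\<^sup>2 * exp (- y\<^sup>2 / (2 * \<sigma>\<^sup>2))) * indicator {0..} y \<partial>lborel) = 0 - (- exp (- 0\<^sup>2 / (2 * \<sigma>\<^sup>2)))"
  proof (rule nn_integral_FTC_atLeast)
    show "((\<lambda>y. - exp (- y\<^sup>2 / (2 * \<sigma>\<^sup>2))) has_real_derivative y / \<sigma>\<^sup>2 * exp (- y\<^sup>2 / (2 * \<sigma>\<^sup>2))) (at y)" for y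
      using \<sigma> by (auto intro!: derivative_eq_intros simp: field_simps power2_eq_square power4_eq_xxxx)
    show "((\<lambda>y. - exp (- y\<^sup>2 / (2 * \<sigma>\<^sup>2))) \<longlongrightarrow> 0) at_top"
      using \<sigma> by real_asymp
  qed (use \<sigma> in auto)
  also have "(\<integral>\<^sup>+y. ennreal (y / \<sigma>\<^sup>2 * exp (- y\<^sup>2 / (2 * \<sigma>\<^sup>2))) * indicator {0..} y \<partial>lborel) =
      (\<integral>\<^sup>+y. ennreal (rayleigh_density \<sigma> y) \<partial>lborel)"
    by (intro nn_integral_cong) (auto simp: rayleigh_density_def indicator_def)
  finally show ?thesis by simp
qed

section \<open>Supercritical weights\<close>

text \<open>\<open>h z = 1 + a z\<^sup>2 / 2 + o(z\<^sup>2)\<close>, and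
  \<open>z\<^sup>2 = - s\<^sup>2 / n\<close> at the points used. As \<open>h'\<close> is
  differentiable only at \<open>0\<close>, the remainder \<open>R\<close> is estimated by the mean
  value inequality on the disc of radius \<open>norm z\<close>.\<close>

lemma power_tendsto_exp_second_order:
  fixes h h' :: "complex \<Rightarrow> complex"
  assumes \<epsilon>: "\<epsilon> > 0"
    and d1: "\<And>x. norm x < \<epsilon> \<Longrightarrow> (h has_field_derivative h' x) (at x)"
    and d2: "(h' has_field_derivative a) (at 0)"
    and h0: "h 0 = 1" and h'0: "h' 0 = 0"
  shows "(\<lambda>n. h (\<i> * of_real (s / sqrt (real n))) ^ n) \<longlonglongrightarrow> exp (- a * of_real (s\<^sup>2) / 2)"
proof -
  define x where "x n = \<i> * complex_of_real (s / sqrt (real n))" for n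
  define R where "R z = h z - 1 - a * z\<^sup>2 / 2" for z
  have nx: "norm (x n) = \<bar>s\<bar> / sqrt (real n)" for n
    by (simp add: x_def norm_mult norm_divide)
  have x0: "x \<longlonglongrightarrow> 0"
  proof -
    have "(\<lambda>n. s / sqrt (real n)) \<longlonglongrightarrow> 0" by real_asymp
    then have "(\<lambda>n. \<i> * complex_of_real (s / sqrt (real n))) \<longlonglongrightarrow> \<i> * of_real 0"
      by (intro tendsto_intros)
    then show ?thesis by (simp add: x_def[abs_def])
  qed
  have nR: "(\<lambda>n. of_nat n * R (x n)) \<longlonglongrightarrow> 0"
  proof (rule LIMSEQ_I)
    fix e :: real assume e: "e > 0"
    define S where "S = s\<^sup>2 + 1"
    define c where "c = e / (2 * S)"
    have s1: "S > 0" unfolding S_def by (simp add: add_nonneg_pos)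
    have c: "c > 0" using e s1 by (simp add: c_def)
    have "((\<lambda>z. (h' z - h' 0) / (z - 0)) \<longlongrightarrow> a) (at 0)"
      using d2 by (simp add: has_field_derivative_iff)
    then have "\<forall>\<^sub>F z in at 0. dist (h' z / z) a < c"
      using h'0 c by (auto dest: tendstoD)
    then obtain \<delta> where \<delta>: "\<delta> > 0" "\<And>z :: complex. z \<noteq> 0 \<Longrightarrow> norm z < \<delta> \<Longrightarrow> norm (h' z / z - a) < c"
      by (auto simp: eventually_at dist_norm)
    have h'_le: "norm (h' z - a * z) \<le> c * norm z" if "norm z < \<delta>" for z
    proof (cases "z = 0")
      case False
      then have "h' z - a * z = (h' z / z - a) * z" by (simp add: field_simps)
      then show ?thesis using \<delta>(2)[OF False that] by (simp add: norm_mult mult_right_mono)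
    qed (simp add: h'0)
    have R_le: "norm (R z) \<le> c * (norm z)\<^sup>2" if z: "norm z < min \<delta> \<epsilon>" for z
    proof -
      have "norm (R z - R 0) \<le> (c * norm z) * norm (z - 0)"
      proof (rule field_differentiable_bound[where S = "cball 0 (norm z)" and f' = "\<lambda>w. h' w - a * w"])
        fix w :: complex assume "w \<in> cball 0 (norm z)"
        then have w: "norm w \<le> norm z" by simp
        have "(R has_field_derivative (h' w - 0 - a * (2 * w) / 2)) (at w)"
          unfolding R_def by (rule derivative_eq_intros d1 refl | use w z in simp)+
        then show "(R has_field_derivative h' w - a * w) (at w within cball 0 (norm z))"
          by (simp add: has_field_derivative_at_within)
        show "norm (h' w - a * w) \<le> c * norm z"
          using h'_le[of w] w z c by (intro order.trans[OF h'_le mult_left_mono]) auto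
      qed auto
      then show ?thesis by (simp add: R_def h0 power2_eq_square)
    qed
    have "\<forall>\<^sub>F n in sequentially. norm (x n) < min \<delta> \<epsilon>"
      using tendstoD[OF x0, of "min \<delta> \<epsilon>"] \<delta> \<epsilon> by simp
    then have "\<forall>\<^sub>F n in sequentially. norm (of_nat n * R (x n) - 0) < e"
      using eventually_gt_at_top[of 0]
    proof eventually_elim
      case (elim n)
      have "norm (of_nat n * R (x n)) \<le> real n * (c * (norm (x n))\<^sup>2)"
        using R_le[OF elim(1)] by (simp add: norm_mult mult_left_mono)
      also have "\<dots> = c * s\<^sup>2" using elim by (simp add: nx power_divide)
      also have "\<dots> \<le> c * S" unfolding S_def using c by (intro mult_left_mono) auto
      also have "\<dots> = e / 2" using s1 by (simp add: c_def)
      also have "\<dots> < e" using e by simp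
      finally show ?case by simp
    qed
    then show "\<exists>no. \<forall>n\<ge>no. norm (of_nat n * R (x n) - 0) < e"
      by (simp add: eventually_sequentially)
  qed
  have xn: "\<forall>\<^sub>F n in sequentially. - a * of_real (s\<^sup>2) / 2 + of_nat n * R (x n) = of_nat n * (h (x n) - 1)"
    using eventually_gt_at_top[of 0]
  proof eventually_elim
    case (elim n)
    have "of_nat n * (x n)\<^sup>2 = - of_real (s\<^sup>2)"
    proof -
      have "(x n)\<^sup>2 = - of_real (s\<^sup>2 / real n)"
      proof -
        have "(x n)\<^sup>2 = \<i>\<^sup>2 * of_real ((s / sqrt (real n))\<^sup>2)"
          by (simp only: x_def power_mult_distrib of_real_power)
        then show ?thesis by (simp add: power_divide)
      qed
      then show ?thesis using elim by simp
    qed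
    moreover have "of_nat n * (h (x n) - 1) = of_nat n * R (x n) + a * (of_nat n * (x n)\<^sup>2) / 2"
      by (simp add: R_def algebra_simps)
    ultimately show ?case by simp
  qed
  have "(\<lambda>n. (1 + (h (x n) - 1)) ^ n) \<longlonglongrightarrow> exp (- a * of_real (s\<^sup>2) / 2)"
  proof (rule one_plus_power_tendsto_exp)
    have "isCont h 0" using d1[of 0] \<epsilon> by (auto intro: DERIV_isCont)
    then have "(\<lambda>n. h (x n)) \<longlonglongrightarrow> h 0" using x0 by (rule isCont_tendsto_compose)
    then show "(\<lambda>n. h (x n) - 1) \<longlonglongrightarrow> 0" using h0 by (simp add: LIM_zero_iff)
    show "(\<lambda>n. of_nat n * (h (x n) - 1)) \<longlonglongrightarrow> - a * of_real (s\<^sup>2) / 2"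
      using Lim_transform_eventually[OF tendsto_add[OF tendsto_const nR] xn] by simp
  qed
  then show ?thesis by (simp add: x_def)
qed

section \<open>The contribution of the dominant pole, with error bounds\<close>

context weighted_walks
begin

text \<open>\<open>E n z\<close> is the coefficient of \<open>y ^ n\<close> in \<open>phi(y) ^ n (1 - y\<^sup>2) / (1 - z y)\<close>. For large \<open>z\<close> the pole at \<open>1 / z\<close>
  dominates and gives \<open>(1 - 1 / z\<^sup>2) \<Lambda> z ^ n\<close>.\<close>

definition Q :: "nat \<Rightarrow> complex poly" where "Q n = [:1, of_real b, 1:] ^ n * [:1, 0, -1:]"
definition E :: "nat \<Rightarrow> complex \<Rightarrow> complex" where "E n z = (\<Sum>i\<le>n. coeff (Q n) i * z ^ (n - i))"
definition \<Lambda> :: "complex \<Rightarrow> complex" where "\<Lambda> z = z + of_real b + 1 / z"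
definition Z :: "nat \<Rightarrow> complex \<Rightarrow> complex" where "Z n u = (\<Sum>k\<le>n. of_nat (f n k) * u ^ k)"

text \<open>By the first two assumptions \<open>t\<close> and \<open>s\<close> are the reciprocal
  zeros of the denominator in \<open>sum_walk_coeff\<close>: it factors as
  \<open>(1 - t y) (1 - s y)\<close>. Partial fractions then split the coefficient into two values
  of \<open>E\<close>.\<close>

lemma Z_eq_E:
  assumes ts: "t + s = u * of_real \<beta> - of_real b" "t * s = 1 - u * of_real \<gamma>" "t \<noteq> s"
  shows "Z n u = (t * E n t - s * E n s) / (t - s)"
proof -
  let ?X = "fps_X :: complex fps"
  define I where "I z = inverse (1 - fps_const z * ?X)" for z
  have I: "(1 - fps_const z * ?X) * I z = 1" for z
    unfolding I_def by (rule inverse_mult_eq_1') simp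
  have D: "phi b - fps_const u * ?X * arch \<beta> \<gamma> = (1 - fps_const t * ?X) * (1 - fps_const s * ?X)"
  proof -
    define U T S where "U = fps_const u" "T = fps_const t" "S = fps_const s"
    have UB: "U * fps_const (of_real \<beta>) = fps_const (of_real b) + T + S"
      using ts(1) unfolding U_T_S_def fps_const_mult fps_const_add by (simp add: algebra_simps)
    have UG: "U * fps_const (of_real \<gamma>) = 1 - T * S"
    proof -
      have "u * of_real \<gamma> = 1 - t * s" using ts(2) by simp
      then show ?thesis unfolding U_T_S_def fps_const_mult fps_const_1_eq_1[symmetric] fps_const_sub by simp
    qed
    have "phi b - U * ?X * arch \<beta> \<gamma> = phi b - (U * fps_const (of_real \<beta>)) * ?X - (U * fps_const (of_real \<gamma>)) * ?X ^ 2"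
      by (simp add: algebra_simps power2_eq_square)
    also have "\<dots> = (1 - T * ?X) * (1 - S * ?X)"
      unfolding UB UG by (simp add: algebra_simps power2_eq_square)
    finally show ?thesis by (simp add: U_T_S_def)
  qed
  have split: "fps_const (t - s) * inverse (phi b - fps_const u * ?X * arch \<beta> \<gamma>) = fps_const t * I t - fps_const s * I s"
  proof -
    have "fps_const t * I t - fps_const s * I s =
      fps_const t * I t * ((1 - fps_const s * ?X) * I s) - fps_const s * I s * ((1 - fps_const t * ?X) * I t)"
      unfolding I by simp
    also have "\<dots> = (fps_const t - fps_const s) * (I t * I s)"
    proof -
      have "T * It * ((1 - S * ?X) * Is) - S * Is * ((1 - T * ?X) * It) = (T - S) * (It * Is)"
        for T S It Is :: "complex fps" by (simp add: algebra_simps)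
      then show ?thesis .
    qed
    finally show ?thesis
      unfolding D fps_inverse_mult I_def[symmetric] fps_const_sub by (rule sym)
  qed
  have Q: "phi b ^ n * (1 - ?X ^ 2) = fps_of_poly (Q n)"
  proof -
    have "phi b = fps_of_poly [:1, of_real b, 1:]" "1 - ?X ^ 2 = fps_of_poly [:1, 0, -1:]"
      by (simp_all add: fps_of_poly_pCons algebra_simps power2_eq_square)
    then show ?thesis by (simp only: Q_def fps_of_poly_mult fps_of_poly_power)
  qed
  have E: "fps_nth (fps_of_poly (Q n) * I z) n = E n z" for z
    unfolding fps_mult_nth by (simp add: I_def fps_nth_inverse_one_minus_linear E_def atLeast0AtMost)
  have "(t - s) * Z n u = fps_nth (fps_of_poly (Q n) * (fps_const (t - s) * inverse (phi b - fps_const u * ?X * arch \<beta> \<gamma>))) n"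
    unfolding Z_def f sum_walk_coeff Q mult.left_commute[of _ "fps_const (t - s)"] fps_mult_left_const_nth ..
  also have "\<dots> = t * E n t - s * E n s"
    unfolding split E[symmetric] right_diff_distrib fps_sub_nth mult.left_commute[of _ "fps_const _"] fps_mult_left_const_nth ..
  finally show ?thesis using ts(3) by (simp add: field_simps)
qed

lemma poly_Q: "poly (Q n) y = (1 + y * (of_real b + y)) ^ n * (1 - y\<^sup>2)"
proof -
  have "poly [:1, complex_of_real b, 1:] y = 1 + y * (of_real b + y)" by simp
  moreover have "poly [:1, 0, -1:] y = 1 - y\<^sup>2" by (simp add: power2_eq_square)
  ultimately show ?thesis by (simp only: Q_def poly_mult poly_power)
qed

text \<open>Cauchy's estimate on the circle of radius \<open>R\<close>, carried out on the unit
  circle by composing with \<open>R X\<close>.\<close>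

lemma norm_coeff_Q_le:
  assumes R: "0 < R"
  shows "norm (coeff (Q n) i) \<le> (1 + b * R + R\<^sup>2) ^ n * (1 + R\<^sup>2) / R ^ i"
proof -
  define P where "P = pcompose (Q n) [:0, of_real R:]"
  define M where "M = (1 + b * R + R\<^sup>2) ^ n * (1 + R\<^sup>2)"
  have P_le: "norm (poly P (cis x)) \<le> M" for x
  proof -
    define y where "y = cis x * complex_of_real R"
    have y: "norm y = R" using R by (simp add: y_def norm_mult)
    have "norm (1 + y * (of_real b + y)) \<le> 1 + b * R + R\<^sup>2"
    proof -
      have "norm (1 + y * (of_real b + y)) \<le> norm (1::complex) + norm y * (norm (complex_of_real b) + norm y)"
        unfolding norm_mult[symmetric]
        by (intro order.trans[OF norm_triangle_ineq] add_left_mono)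
          (unfold norm_mult, intro mult_left_mono norm_triangle_ineq norm_ge_zero)
      then show ?thesis using b by (simp add: y algebra_simps power2_eq_square)
    qed
    moreover have "norm (1 - y\<^sup>2) \<le> 1 + R\<^sup>2"
      by (intro order.trans[OF norm_triangle_ineq4]) (simp add: norm_power y)
    ultimately have "norm (1 + y * (of_real b + y)) ^ n * norm (1 - y\<^sup>2) \<le> M"
      unfolding M_def using R b by (intro mult_mono power_mono) auto
    then show ?thesis
      by (simp add: P_def poly_pcompose poly_Q norm_mult norm_power flip: y_def)
  qed
  let ?f = "\<lambda>x. indicator {-pi..pi} x *\<^sub>R (poly P (cis x) * cis (- real i * x))"
  have "norm (\<integral>x. ?f x \<partial>lborel) \<le> (\<integral>x. indicator {-pi..pi} x * M \<partial>lborel)"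
  proof (rule order.trans[OF integral_norm_bound integral_mono])
    have "integrable lborel ?f"
      by (rule borel_integrable_compact[OF compact_Icc]) (auto intro!: continuous_intros)
    then show "integrable lborel (\<lambda>x. norm (?f x))" by (rule integrable_norm)
    show "integrable lborel (\<lambda>x. indicator {-pi..pi} x * M)" by simp
    show "norm (?f x) \<le> indicator {-pi..pi} x * M" for x
      using P_le by (auto simp: indicator_def norm_mult)
  qed
  then have "norm (coeff P i) \<le> M"
    unfolding coeff_eq_integral[of P i] by (simp add: norm_divide field_simps)
  then show ?thesis
    using R by (simp add: P_def coeff_pcompose_linear norm_mult norm_power M_def field_simps)
qed

text \<open>If the pole \<open>1 / z\<close> lies outside the circle of radius \<open>R\<close>,
  Cauchy's estimate and a geometric series in \<open>norm z * R\<close> bound all of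
  \<open>E\<close>.\<close>

lemma norm_E_le:
  assumes R: "0 < R" "norm z * R \<le> \<theta>" "\<theta> < 1"
  shows "norm (E n z) \<le> ((1 + b * R + R\<^sup>2) / R) ^ n * (1 + R\<^sup>2) / (1 - \<theta>)"
proof -
  define M where "M = ((1 + b * R + R\<^sup>2) / R) ^ n * (1 + R\<^sup>2)"
  have M: "M \<ge> 0" using R b by (auto simp: M_def)
  have \<theta>: "0 \<le> \<theta>" using R by (meson norm_ge_zero order.trans mult_nonneg_nonneg less_imp_le)
  have "norm (E n z) \<le> (\<Sum>i\<le>n. norm (coeff (Q n) i * z ^ (n - i)))"
    unfolding E_def by (rule norm_sum)
  also have "\<dots> \<le> (\<Sum>i\<le>n. M * \<theta> ^ (n - i))"
  proof (rule sum_mono)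
    fix i assume "i \<in> {..n}"
    then have Rn: "R ^ n = R ^ i * R ^ (n - i)" by (simp flip: power_add)
    have "norm (coeff (Q n) i * z ^ (n - i)) \<le> ((1 + b * R + R\<^sup>2) ^ n * (1 + R\<^sup>2) / R ^ i) * norm z ^ (n - i)"
      unfolding norm_mult norm_power by (intro mult_right_mono norm_coeff_Q_le R) auto
    also have "\<dots> = M * (norm z * R) ^ (n - i)"
      using R(1) by (simp add: M_def Rn power_divide power_mult_distrib)
    also have "\<dots> \<le> M * \<theta> ^ (n - i)"
      using R M by (intro mult_left_mono power_mono) auto
    finally show "norm (coeff (Q n) i * z ^ (n - i)) \<le> M * \<theta> ^ (n - i)" .
  qed
  also have "\<dots> = M * (\<Sum>i\<le>n. \<theta> ^ i)"
    unfolding sum_distrib_left[symmetric] by (subst sum.atLeastAtMost_rev[of _ 0 n, simplified atLeast0AtMost]) simp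
  also have "\<dots> \<le> M * (1 / (1 - \<theta>))"
  proof (intro mult_left_mono M)
    have "(\<Sum>i<Suc n. \<theta> ^ i) \<le> (\<Sum>i. \<theta> ^ i)"
      using R \<theta> by (intro sum_le_suminf) auto
    then show "(\<Sum>i\<le>n. \<theta> ^ i) \<le> 1 / (1 - \<theta>)"
      using R \<theta> by (simp add: suminf_geometric lessThan_Suc_atMost)
  qed
  finally show ?thesis by (simp add: M_def)
qed

lemma degree_Q_le: "degree (Q n) \<le> 2 * n + 2"
proof -
  have "degree ([:1, of_real b, 1:] ^ n :: complex poly) \<le> degree ([:1, of_real b, 1:] :: complex poly) * n"
    by (rule degree_power_le)
  then have "degree ([:1, of_real b, 1:] ^ n :: complex poly) \<le> 2 * n" by simp
  then show ?thesis
    unfolding Q_def by (intro order.trans[OF degree_mult_le]) simp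
qed

text \<open>Extending the sum in \<open>E\<close> over all degrees of \<open>Q n\<close> gives
  exactly \<open>z ^ n * poly (Q n) (1 / z)\<close>, the residue term. Only the indices
  \<open>i > n\<close> are in excess, and with the pole inside the circle of radius \<open>R\<close>
  they are a decaying geometric series.\<close>

lemma norm_E_minus_le:
  assumes R: "0 < R" "norm z * R \<ge> \<theta>" "\<theta> > 1"
  shows "norm (E n z - \<Lambda> z ^ n * (1 - 1 / z\<^sup>2)) \<le> ((1 + b * R + R\<^sup>2) / R) ^ n * (1 + R\<^sup>2) / (\<theta> - 1)"
proof -
  define M where "M = ((1 + b * R + R\<^sup>2) / R) ^ n * (1 + R\<^sup>2)"
  have M: "M \<ge> 0" using R b by (auto simp: M_def)
  have z: "z \<noteq> 0" using R by auto
  have "\<Lambda> z ^ n * (1 - 1 / z\<^sup>2) = z ^ n * poly (Q n) (1 / z)"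
  proof -
    have "\<Lambda> z = z * (1 + 1 / z * (of_real b + 1 / z))" using z by (simp add: \<Lambda>_def field_simps)
    moreover have "poly (Q n) (1 / z) = (1 + 1 / z * (of_real b + 1 / z)) ^ n * (1 - 1 / z\<^sup>2)"
      unfolding poly_Q by (simp only: power_one_over)
    ultimately show ?thesis by (simp only: power_mult_distrib mult_ac)
  qed
  also have "poly (Q n) (1 / z) = (\<Sum>i\<le>2 * n + 2. coeff (Q n) i * (1 / z) ^ i)"
    unfolding poly_altdef using degree_Q_le[of n]
    by (intro sum.mono_neutral_left) (auto simp: coeff_eq_0)
  also have "{..2 * n + 2} = {..n} \<union> {n<..2 * n + 2}" by auto
  also have "(\<Sum>i\<in>{..n} \<union> {n<..2 * n + 2}. coeff (Q n) i * (1 / z) ^ i) =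
     (\<Sum>i\<le>n. coeff (Q n) i * (1 / z) ^ i) + (\<Sum>i\<in>{n<..2 * n + 2}. coeff (Q n) i * (1 / z) ^ i)"
    by (rule sum.union_disjoint) auto
  also have "z ^ n * \<dots> = E n z + (\<Sum>i\<in>{n<..2 * n + 2}. coeff (Q n) i * (1 / z) ^ (i - n))"
  proof -
    have "z ^ n * (\<Sum>i\<le>n. coeff (Q n) i * (1 / z) ^ i) = E n z"
      unfolding E_def sum_distrib_left using z
      by (intro sum.cong refl) (auto simp: power_divide power_diff)
    moreover have "z ^ n * (\<Sum>i\<in>{n<..2 * n + 2}. coeff (Q n) i * (1 / z) ^ i) = (\<Sum>i\<in>{n<..2 * n + 2}. coeff (Q n) i * (1 / z) ^ (i - n))"
      unfolding sum_distrib_left using z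
      by (intro sum.cong refl) (auto simp: power_divide power_diff)
    ultimately show ?thesis by (simp add: distrib_left)
  qed
  finally have "norm (E n z - \<Lambda> z ^ n * (1 - 1 / z\<^sup>2)) = norm (\<Sum>i\<in>{n<..2 * n + 2}. coeff (Q n) i * (1 / z) ^ (i - n))"
    by simp
  also have "\<dots> \<le> (\<Sum>i\<in>{n<..2 * n + 2}. norm (coeff (Q n) i * (1 / z) ^ (i - n)))"
    by (rule norm_sum)
  also have "\<dots> \<le> (\<Sum>i\<in>{n<..2 * n + 2}. M * (1 / \<theta>) ^ (i - n))"
  proof (rule sum_mono)
    fix i assume "i \<in> {n<..2 * n + 2}"
    then have Ri: "R ^ i = R ^ n * R ^ (i - n)" by (simp flip: power_add)
    have "norm (coeff (Q n) i * (1 / z) ^ (i - n)) \<le> ((1 + b * R + R\<^sup>2) ^ n * (1 + R\<^sup>2) / R ^ i) * (1 / norm z) ^ (i - n)"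
      unfolding norm_mult norm_power norm_divide norm_one by (intro mult_right_mono norm_coeff_Q_le R) auto
    also have "\<dots> = M * (1 / (norm z * R)) ^ (i - n)"
      using R(1) z by (simp add: M_def Ri power_divide power_mult_distrib)
    also have "\<dots> \<le> M * (1 / \<theta>) ^ (i - n)"
      using R M z by (intro mult_left_mono power_mono divide_left_mono) (auto intro!: mult_pos_pos)
    finally show "norm (coeff (Q n) i * (1 / z) ^ (i - n)) \<le> M * (1 / \<theta>) ^ (i - n)" .
  qed
  also have "\<dots> = M * (\<Sum>j<n + 2. (1 / \<theta>) ^ Suc j)"
    unfolding sum_distrib_left
    by (rule sum.reindex_bij_witness[of _ "\<lambda>j. j + Suc n" "\<lambda>i. i - Suc n"])
      (auto simp: Suc_diff_Suc simp del: power_Suc)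
  also have "\<dots> \<le> M * (1 / (\<theta> - 1))"
  proof (intro mult_left_mono M)
    have "(\<Sum>j<n + 2. (1 / \<theta>) ^ j) \<le> (\<Sum>j. (1 / \<theta>) ^ j)"
      using R by (intro sum_le_suminf) auto
    then have "(1 / \<theta>) * (\<Sum>j<n + 2. (1 / \<theta>) ^ j) \<le> (1 / \<theta>) * (1 / (1 - 1 / \<theta>))"
      using R by (intro mult_left_mono) (auto simp: suminf_geometric)
    also have "(1 / \<theta>) * (1 / (1 - 1 / \<theta>)) = 1 / (\<theta> - 1)" using R by (simp add: field_simps)
    finally show "(\<Sum>j<n + 2. (1 / \<theta>) ^ Suc j) \<le> 1 / (\<theta> - 1)"
      by (simp only: sum_distrib_left power_Suc)
  qed
  finally show ?thesis by (simp add: M_def)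
qed

end

context weighted_walks
begin

text \<open>Take \<open>R = 1 / \<rho>\<close> with \<open>\<rho>\<close> strictly between
  \<open>max 1 \<bar>s0\<bar>\<close> and \<open>t0\<close>. The error rate is
  \<open>\<rho> + b + 1 / \<rho>\<close>, smaller than the main rate \<open>t0 + b + 1 / t0\<close>
  because \<open>y + 1 / y\<close> increases for \<open>y > 1\<close>. The margins
  \<open>\<rho>1\<close> and \<open>\<rho>2\<close> keep the moving \<open>S n\<close> and
  \<open>T n\<close> on their sides of \<open>\<rho>\<close>.\<close>

lemma Z_tendsto:
  fixes U T S :: "nat \<Rightarrow> complex" and t0 s0 :: real
  assumes T: "T \<longlonglongrightarrow> of_real t0" and S: "S \<longlonglongrightarrow> of_real s0"
    and ts: "\<And>n. T n + S n = U n * of_real \<beta> - of_real b" "\<And>n. T n * S n = 1 - U n * of_real \<gamma>"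
    and t0: "1 < t0" "\<bar>s0\<bar> < t0"
  shows "(\<lambda>n. Z n (U n) / \<Lambda> (T n) ^ n) \<longlonglongrightarrow> of_real (t0 * (1 - 1 / t0\<^sup>2) / (t0 - s0))"
proof -
  define m where "m = max 1 \<bar>s0\<bar>"
  have m: "m < t0" "1 \<le> m" "\<bar>s0\<bar> \<le> m" using t0 by (auto simp: m_def)
  obtain \<rho> where \<rho>: "m < \<rho>" "\<rho> < t0" using dense[OF m(1)] by blast
  obtain \<rho>1 where \<rho>1: "m < \<rho>1" "\<rho>1 < \<rho>" using dense[OF \<rho>(1)] by blast
  obtain \<rho>2 where \<rho>2: "\<rho> < \<rho>2" "\<rho>2 < t0" using dense[OF \<rho>(2)] by blast
  define R where "R = 1 / \<rho>"
  define c where "c = (1 + b * R + R\<^sup>2) / R"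
  have R: "R > 0" using \<rho> m by (simp add: R_def)
  have c: "c = \<rho> + b + 1 / \<rho>"
    using \<rho> m by (simp add: c_def R_def field_simps power2_eq_square)
  have c0: "c > 0" using \<rho> m b by (simp add: c add_pos_pos)
  define l0 where "l0 = t0 + b + 1 / t0"
  have "c < l0"
  proof -
    have "1 < \<rho> * t0" using \<rho> m by (simp add: less_1_mult)
    then have "(t0 - \<rho>) * (1 / (\<rho> * t0)) < (t0 - \<rho>) * 1"
      using \<rho> by (intro mult_strict_left_mono) auto
    also have "(t0 - \<rho>) * (1 / (\<rho> * t0)) = 1 / \<rho> - 1 / t0"
      using \<rho> m by (simp add: field_simps)
    finally have *: "1 / \<rho> - 1 / t0 < (t0 - \<rho>) * 1" .
    have "\<rho> + b + X < t0 + b + Y" if "X - Y < (t0 - \<rho>) * 1" for X Y :: real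
      using that unfolding mult_1_right by linarith
    from this[OF *] show ?thesis unfolding c l0_def .
  qed
  then obtain c' where c': "c < c'" "c' < l0" using dense by blast
  have t0': "complex_of_real t0 \<noteq> 0" using t0 by simp
  have "(\<lambda>n. \<Lambda> (T n)) \<longlonglongrightarrow> of_real t0 + of_real b + 1 / of_real t0"
    unfolding \<Lambda>_def by (intro tendsto_intros T t0')
  then have "(\<lambda>n. \<Lambda> (T n)) \<longlonglongrightarrow> of_real l0" by (simp add: l0_def)
  from tendsto_norm[OF this] have "(\<lambda>n. norm (\<Lambda> (T n))) \<longlonglongrightarrow> l0"
    using c' c0 by simp
  then have ev\<Lambda>: "\<forall>\<^sub>F n in sequentially. c' < norm (\<Lambda> (T n))"
    using c' by (intro order_tendstoD(1))
  have evT: "\<forall>\<^sub>F n in sequentially. \<rho>2 < norm (T n)"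
    using tendsto_norm[OF T] \<rho>2 t0 by (intro order_tendstoD(1)) auto
  have evS: "\<forall>\<^sub>F n in sequentially. norm (S n) < \<rho>1"
  proof (rule order_tendstoD(2))
    show "(\<lambda>n. norm (S n)) \<longlonglongrightarrow> \<bar>s0\<bar>" using tendsto_norm[OF S] by simp
  qed (use \<rho>1 m in auto)
  have cc: "(\<lambda>n. K * (c / c') ^ n) \<longlonglongrightarrow> 0" for K
    using tendsto_mult[OF tendsto_const LIMSEQ_realpow_zero[of "c / c'"], of K] c0 c' by simp
  have small: "X / norm (\<Lambda> (T n)) ^ n \<le> K * (c / c') ^ n"
    if "X \<le> c ^ n * (1 + R\<^sup>2) / K'" "K = (1 + R\<^sup>2) / K'" "K' > 0" "c' < norm (\<Lambda> (T n))" for X K K' n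
  proof -
    have "X / norm (\<Lambda> (T n)) ^ n \<le> (c ^ n * (1 + R\<^sup>2) / K') / c' ^ n"
      using that c0 c' by (intro frac_le power_mono) (auto intro!: divide_nonneg_pos mult_nonneg_nonneg)
    then show ?thesis using that by (simp add: power_divide mult.commute)
  qed
  have e1: "(\<lambda>n. (E n (T n) - \<Lambda> (T n) ^ n * (1 - 1 / (T n)\<^sup>2)) / \<Lambda> (T n) ^ n) \<longlonglongrightarrow> 0"
  proof (rule Lim_null_comparison[OF _ cc])
    show "\<forall>\<^sub>F n in sequentially. norm ((E n (T n) - \<Lambda> (T n) ^ n * (1 - 1 / (T n)\<^sup>2)) / \<Lambda> (T n) ^ n)
        \<le> (1 + R\<^sup>2) / (\<rho>2 / \<rho> - 1) * (c / c') ^ n"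
      using evT ev\<Lambda>
    proof eventually_elim
      case (elim n)
      have 1: "norm (T n) * R \<ge> \<rho>2 / \<rho>" "\<rho>2 / \<rho> > 1"
        using elim \<rho> \<rho>2 m by (auto simp: R_def divide_right_mono)
      show ?case
        unfolding norm_divide norm_power
        by (rule small[OF norm_E_minus_le[OF R 1, folded c_def]]) (use 1 elim in auto)
    qed
  qed
  have e2: "(\<lambda>n. E n (S n) / \<Lambda> (T n) ^ n) \<longlonglongrightarrow> 0"
  proof (rule Lim_null_comparison[OF _ cc])
    show "\<forall>\<^sub>F n in sequentially. norm (E n (S n) / \<Lambda> (T n) ^ n) \<le> (1 + R\<^sup>2) / (1 - \<rho>1 / \<rho>) * (c / c') ^ n"
      using evS ev\<Lambda>
    proof eventually_elim
      case (elim n)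
      have 1: "norm (S n) * R \<le> \<rho>1 / \<rho>" "\<rho>1 / \<rho> < 1"
        using elim \<rho> \<rho>1 m by (auto simp: R_def divide_right_mono)
      show ?case
        unfolding norm_divide norm_power
        by (rule small[OF norm_E_le[OF R 1, folded c_def]]) (use 1 elim in auto)
    qed
  qed
  have t0s0: "complex_of_real t0 - of_real s0 \<noteq> 0" using t0 by (simp flip: of_real_diff)
  have L: "(\<lambda>n. (T n * ((E n (T n) - \<Lambda> (T n) ^ n * (1 - 1 / (T n)\<^sup>2)) / \<Lambda> (T n) ^ n + (1 - 1 / (T n)\<^sup>2))
      - S n * (E n (S n) / \<Lambda> (T n) ^ n)) / (T n - S n)) \<longlonglongrightarrow>
    (of_real t0 * (0 + (1 - 1 / (of_real t0)\<^sup>2)) - of_real s0 * 0) / (of_real t0 - of_real s0)"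
    using t0' t0s0 by (intro tendsto_intros T S e1 e2) auto
  have EV: "\<forall>\<^sub>F n in sequentially.
     (T n * ((E n (T n) - \<Lambda> (T n) ^ n * (1 - 1 / (T n)\<^sup>2)) / \<Lambda> (T n) ^ n + (1 - 1 / (T n)\<^sup>2))
      - S n * (E n (S n) / \<Lambda> (T n) ^ n)) / (T n - S n) = Z n (U n) / \<Lambda> (T n) ^ n"
    using evT evS ev\<Lambda>
  proof eventually_elim
    case (elim n)
    have ne: "T n \<noteq> S n" using elim \<rho>1 \<rho>2 by auto
    have L: "\<Lambda> (T n) ^ n \<noteq> 0" using elim c0 c' by auto
    have "(A - L * B) / L + B = A / L" if "L \<noteq> 0" for A B L :: complex
      using that by (simp add: field_simps)
    from this[OF L] have eqE: "(E n (T n) - \<Lambda> (T n) ^ n * (1 - 1 / (T n)\<^sup>2)) / \<Lambda> (T n) ^ n + (1 - 1 / (T n)\<^sup>2) = E n (T n) / \<Lambda> (T n) ^ n" .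
    have eqZ: "Z n (U n) = (T n * E n (T n) - S n * E n (S n)) / (T n - S n)"
      by (rule Z_eq_E[OF ts ne])
    show ?case unfolding eqE eqZ by (simp add: diff_divide_distrib mult.commute)
  qed
  have EQ: "(of_real t0 * (0 + (1 - 1 / (of_real t0)\<^sup>2)) - of_real s0 * 0) / (of_real t0 - of_real s0) =
      complex_of_real (t0 * (1 - 1 / t0\<^sup>2) / (t0 - s0))"
    by simp
  show ?thesis using Lim_transform_eventually[OF L EV] unfolding EQ .
qed


text \<open>A quasi-power argument: with \<open>x = \<i> s / sqrt n\<close> and tilted weight
  \<open>q exp x\<close>, \<open>Z_tendsto\<close> gives \<open>Z\<close> the same constant times
  the \<open>n\<close>-th power of \<open>\<Lambda> (T x)\<close>. After centring, the quotient is
  asymptotically \<open>h x ^ n\<close>, to which the second-order expansion applies.\<close>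

lemma supercritical_limit:
  assumes q: "q > 1 / \<tau>"
  shows "\<exists>\<mu> a. a > 0 \<and> (\<forall>s. (\<lambda>n. exp (- \<i> * of_real (s * \<mu> * sqrt (real n))) *
      Z n (of_real q * exp (\<i> * of_real (s / sqrt (real n)))) / Z n (of_real q)) \<longlonglongrightarrow>
      exp (- of_real (a * s\<^sup>2 / 2)))"
proof -
  have q0: "q > 0" using q \<tau> by (meson less_trans zero_less_divide_1_iff)
  have qbg: "b + 2 < q * (\<beta> + \<gamma>)" using q pos b by (simp add: \<tau>_def divide_less_eq)
  \<comment> \<open>Here \<open>b * \<gamma> \<le> 2 * \<beta>\<close> enters. It makes
    \<open>t0 + s0 = q * \<beta> - b\<close> positive, so that \<open>t0\<close> is the larger root
    in absolute value.\<close>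
  have qb: "b < q * \<beta>"
  proof -
    have "b * (\<beta> + \<gamma>) \<le> (b + 2) * \<beta>" using ratio by (simp add: algebra_simps)
    also have "\<dots> < q * (\<beta> + \<gamma>) * \<beta>" using qbg pos by (intro mult_strict_right_mono)
    finally have "b * (\<beta> + \<gamma>) < q * \<beta> * (\<beta> + \<gamma>)" by (simp only: mult_ac)
    then show ?thesis using pos by (simp add: mult_less_cancel_right)
  qed
  define p0 where "p0 = b - q * \<beta>"
  define r0 where "r0 = 1 - q * \<gamma>"
  define d0 where "d0 = p0\<^sup>2 - 4 * r0"
  define t0 where "t0 = (- p0 + sqrt d0) / 2"
  define s0 where "s0 = (- p0 - sqrt d0) / 2"
  have p0: "p0 < 0" using qb by (simp add: p0_def)
  \<comment> \<open>The difference of the two sides is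
    \<open>4 (q (\<beta> + \<gamma>) - b - 2)\<close>: the denominator is negative at
    \<open>y = 1\<close>. This is what pushes \<open>t0\<close> beyond \<open>1\<close>.\<close>
  have d0_gt: "(p0 + 2)\<^sup>2 < d0"
    using qbg by (simp add: d0_def p0_def r0_def power2_eq_square algebra_simps)
  then have d0: "d0 > 0" by (meson le_less_trans zero_le_power2)
  have "\<bar>p0 + 2\<bar> < sqrt d0"
    using d0_gt by (metis real_sqrt_abs real_sqrt_less_iff)
  then have t0: "1 < t0" and "s0 < 1" by (auto simp: t0_def s0_def)
  then have s0: "\<bar>s0\<bar> < t0" using p0 d0 by (auto simp: abs_less_iff t0_def s0_def)

  define u where "u x = of_real q * exp x" for x :: complex
  define p where "p x = of_real b - u x * of_real \<beta>" for x
  define r' where "r' x = 1 - u x * of_real \<gamma>" for x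
  \<comment> \<open>At \<open>x = 0\<close> the radicand is \<open>d0 > 0\<close>; near
    \<open>0\<close> it stays in the right half-plane, away from the branch cut, so the principal
    root makes \<open>T\<close> differentiable there.\<close>
  define w where "w x = csqrt ((p x)\<^sup>2 - 4 * r' x)" for x
  define T where "T x = (- p x + w x) / 2" for x
  define S where "S x = (- p x - w x) / 2" for x
  have w2: "(w x)\<^sup>2 = (p x)\<^sup>2 - 4 * r' x" for x by (simp add: w_def)
  have TS_sum: "T x + S x = u x * of_real \<beta> - of_real b" for x
    by (simp add: T_def S_def p_def field_simps)
  have TS_prod: "T x * S x = 1 - u x * of_real \<gamma>" for x
  proof -
    have "T x * S x = ((p x)\<^sup>2 - (w x)\<^sup>2) / 4" by (simp add: T_def S_def field_simps power2_eq_square)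
    also have "\<dots> = r' x" unfolding w2 by simp
    finally show ?thesis by (simp only: r'_def)
  qed
  have at0: "p 0 = of_real p0" "r' 0 = of_real r0" "w 0 = of_real (sqrt d0)" "T 0 = of_real t0" "S 0 = of_real s0"
  proof -
    show 1: "p 0 = of_real p0" "r' 0 = of_real r0" by (simp_all add: p_def r'_def u_def p0_def r0_def)
    have "(p 0)\<^sup>2 - 4 * r' 0 = of_real d0" by (simp add: 1 d0_def)
    then show "w 0 = of_real (sqrt d0)" using d0 by (simp add: w_def csqrt_of_real)
    then show "T 0 = of_real t0" "S 0 = of_real s0" by (simp_all add: T_def S_def 1 t0_def s0_def)
  qed
  \<comment> \<open>The equation of the pole \<open>y = 1 / T x\<close>, cleared of denominators. It
    is used to eliminate \<open>u x\<close>, so that the logarithmic derivative depends on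
    \<open>T x\<close> alone.\<close>
  have quad: "(T x)\<^sup>2 + of_real b * T x + 1 = u x * (of_real \<beta> * T x + of_real \<gamma>)" for x
  proof -
    have "(T x)\<^sup>2 = (T x + S x) * T x - T x * S x" by (simp add: power2_eq_square algebra_simps)
    then show ?thesis unfolding TS_sum TS_prod by (simp add: algebra_simps)
  qed
  have w_eq: "w x = 2 * T x + p x" for x by (simp add: T_def field_simps)

  have du: "(u has_field_derivative u x) (at x)" for x
    unfolding u_def by (auto intro!: derivative_eq_intros)
  have dp: "(p has_field_derivative - u x * of_real \<beta>) (at x)" for x
    unfolding p_def by (auto intro!: derivative_eq_intros du)
  have dr: "(r' has_field_derivative - u x * of_real \<gamma>) (at x)" for x
    unfolding r'_def by (auto intro!: derivative_eq_intros du)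
  have dT: "(T has_field_derivative u x * (of_real \<beta> * T x + of_real \<gamma>) / w x) (at x)"
    if x: "0 < Re ((p x)\<^sup>2 - 4 * r' x)" for x
  proof -
    have "(p x)\<^sup>2 - 4 * r' x \<notin> \<real>\<^sub>\<le>\<^sub>0" using x by (auto simp: complex_nonpos_Reals_iff)
    then have "(w has_field_derivative (2 * (- u x * of_real \<beta>) * p x - 4 * (- u x * of_real \<gamma>)) / (2 * w x)) (at x)"
      unfolding w_def by (auto intro!: derivative_eq_intros dp dr)
    then have "(T has_field_derivative (- (- u x * of_real \<beta>) + (2 * (- u x * of_real \<beta>) * p x - 4 * (- u x * of_real \<gamma>)) / (2 * w x)) / 2) (at x)"
      unfolding T_def by (auto intro!: derivative_eq_intros dp)
    moreover have "w x \<noteq> 0" using x w2[of x] by (metis less_irrefl zero_complex.simps(1) zero_power2)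
    then have "(- (- u x * of_real \<beta>) + (2 * (- u x * of_real \<beta>) * p x - 4 * (- u x * of_real \<gamma>)) / (2 * w x)) / 2
        = u x * (of_real \<beta> * T x + of_real \<gamma>) / w x"
      by (simp add: T_def field_simps)
    ultimately show ?thesis by simp
  qed
  have Re0: "0 < Re ((p 0)\<^sup>2 - 4 * r' 0)"
    using d0 by (simp add: at0 d0_def flip: of_real_power)
  have isCont_p: "isCont p x" "isCont r' x" for x
    using DERIV_isCont dp dr by blast+
  have "((\<lambda>x. Re ((p x)\<^sup>2 - 4 * r' x)) \<longlongrightarrow> Re ((p 0)\<^sup>2 - 4 * r' 0)) (at 0)"
    by (intro tendsto_intros isContD isCont_p)
  then have ev1: "\<forall>\<^sub>F x in at 0. 0 < Re ((p x)\<^sup>2 - 4 * r' x)"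
    using Re0 by (rule order_tendstoD(1))
  have isCont_T: "isCont T 0" using DERIV_isCont[OF dT[OF Re0]] .
  then have "((\<lambda>x. Re (T x)) \<longlongrightarrow> Re (T 0)) (at 0)" by (intro tendsto_intros isContD)
  then have "\<forall>\<^sub>F x in at 0. 0 < Re (T x)"
    by (rule order_tendstoD(1)) (use t0 in \<open>simp add: at0\<close>)
  with ev1 have "\<forall>\<^sub>F x in at 0. 0 < Re ((p x)\<^sup>2 - 4 * r' x) \<and> 0 < Re (T x)"
    by eventually_elim simp
  then obtain \<epsilon> where \<epsilon>: "\<epsilon> > 0"
    and "\<And>x. x \<noteq> 0 \<Longrightarrow> norm x < \<epsilon> \<Longrightarrow> 0 < Re ((p x)\<^sup>2 - 4 * r' x) \<and> 0 < Re (T x)"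
    by (auto simp: eventually_at dist_norm)
  then have near: "0 < Re ((p x)\<^sup>2 - 4 * r' x)" "0 < Re (T x)" if "norm x < \<epsilon>" for x
    using that Re0 t0 by (cases "x = 0"; simp add: at0)+

  \<comment> \<open>\<open>W (T x)\<close> is the logarithmic derivative of \<open>\<Lambda> (T x)\<close>, and \<open>N / M\<^sup>2\<close> is the derivative of \<open>W\<close>
    at \<open>t0\<close>; all coefficients of \<open>N\<close> are nonnegative, hence the limiting variance is positive.\<close>
  define e where "e = b * \<gamma> - \<beta>"
  have e: "e \<ge> 0" using ratio by (simp add: e_def)
  define W where "W y = (y\<^sup>2 - 1) * (of_real \<beta> * y + of_real \<gamma>) / (y * (of_real \<beta> * y\<^sup>2 + 2 * of_real \<gamma> * y + of_real e))"
    for y :: complex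
  define \<mu> where "\<mu> = (t0\<^sup>2 - 1) * (\<beta> * t0 + \<gamma>) / (t0 * (\<beta> * t0\<^sup>2 + 2 * \<gamma> * t0 + e))"
  have W0: "W (of_real t0) = of_real \<mu>" by (simp add: W_def \<mu>_def)
  define N where "N = \<beta> * \<gamma> * t0 ^ 4 + (2 * \<beta> * e + 2 * \<beta>\<^sup>2) * t0 ^ 3 + (\<gamma> * e + 5 * \<beta> * \<gamma>) * t0\<^sup>2 + 4 * \<gamma>\<^sup>2 * t0 + e * \<gamma>"
  define M where "M = t0 * (\<beta> * t0\<^sup>2 + 2 * \<gamma> * t0 + e)"
  have M: "M > 0" unfolding M_def using t0 pos e by (intro mult_pos_pos add_pos_nonneg add_pos_pos) auto
  have N: "N > 0" unfolding N_def using t0 pos e by (intro add_pos_nonneg add_pos_pos mult_pos_pos) (auto intro!: mult_pos_pos add_nonneg_pos)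
  have dW: "(W has_field_derivative of_real (N / M\<^sup>2)) (at (of_real t0))"
  proof -
    let ?y = "complex_of_real t0"
    have M': "?y * (of_real \<beta> * ?y\<^sup>2 + 2 * of_real \<gamma> * ?y + of_real e) = of_real M" by (simp add: M_def)
    have M0: "complex_of_real M \<noteq> 0" using M by simp
    have "((\<lambda>y. (y\<^sup>2 - 1) * (of_real \<beta> * y + of_real \<gamma>)) has_field_derivative
      (2 * ?y * (of_real \<beta> * ?y + of_real \<gamma>) + of_real \<beta> * (?y\<^sup>2 - 1))) (at ?y)"
      by (auto intro!: derivative_eq_intros)
    moreover have "((\<lambda>y. y * (of_real \<beta> * y\<^sup>2 + 2 * of_real \<gamma> * y + of_real e)) has_field_derivative
      ((of_real \<beta> * ?y\<^sup>2 + 2 * of_real \<gamma> * ?y + of_real e) + (2 * of_real \<beta> * ?y + 2 * of_real \<gamma>) * ?y)) (at ?y)"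
      by (auto intro!: derivative_eq_intros)
    ultimately have "(W has_field_derivative
      ((2 * ?y * (of_real \<beta> * ?y + of_real \<gamma>) + of_real \<beta> * (?y\<^sup>2 - 1)) * of_real M -
       (?y\<^sup>2 - 1) * (of_real \<beta> * ?y + of_real \<gamma>) * ((of_real \<beta> * ?y\<^sup>2 + 2 * of_real \<gamma> * ?y + of_real e) + (2 * of_real \<beta> * ?y + 2 * of_real \<gamma>) * ?y))
       / (of_real M * of_real M)) (at ?y)"
      unfolding W_def using M0 unfolding M'[symmetric] by (rule DERIV_divide)
    also have "((2 * ?y * (of_real \<beta> * ?y + of_real \<gamma>) + of_real \<beta> * (?y\<^sup>2 - 1)) * of_real M -
       (?y\<^sup>2 - 1) * (of_real \<beta> * ?y + of_real \<gamma>) * ((of_real \<beta> * ?y\<^sup>2 + 2 * of_real \<gamma> * ?y + of_real e) + (2 * of_real \<beta> * ?y + 2 * of_real \<gamma>) * ?y))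
       = complex_of_real ((2 * t0 * (\<beta> * t0 + \<gamma>) + \<beta> * (t0\<^sup>2 - 1)) * M -
       (t0\<^sup>2 - 1) * (\<beta> * t0 + \<gamma>) * ((\<beta> * t0\<^sup>2 + 2 * \<gamma> * t0 + e) + (2 * \<beta> * t0 + 2 * \<gamma>) * t0))"
      by simp
    also have "(2 * t0 * (\<beta> * t0 + \<gamma>) + \<beta> * (t0\<^sup>2 - 1)) * M -
       (t0\<^sup>2 - 1) * (\<beta> * t0 + \<gamma>) * ((\<beta> * t0\<^sup>2 + 2 * \<gamma> * t0 + e) + (2 * \<beta> * t0 + 2 * \<gamma>) * t0) = N"
      unfolding M_def N_def by algebra
    finally show ?thesis by (simp add: power2_eq_square)
  qed
  \<comment> \<open>Chain rule: the derivative of \<open>W\<close> at \<open>t0\<close> times the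
    derivative of \<open>T\<close> at \<open>0\<close>.\<close>
  define a where "a = N / M\<^sup>2 * (q * (\<beta> * t0 + \<gamma>) / sqrt d0)"
  have a: "a > 0" unfolding a_def using M N q0 t0 pos d0 by (intro mult_pos_pos divide_pos_pos add_pos_pos) auto

  have \<Lambda>0: "\<Lambda> (of_real t0) \<noteq> 0"
  proof -
    have "t0 + b + 1 / t0 > 0" using t0 b by (intro add_pos_pos) auto
    moreover have "\<Lambda> (of_real t0) = of_real (t0 + b + 1 / t0)" by (simp add: \<Lambda>_def)
    ultimately show ?thesis by (simp only: of_real_eq_0_iff)
  qed
  \<comment> \<open>The exponential is the centring by \<open>\<mu> n\<close>; it removes the
    first-order term, so that \<open>h' 0 = 0\<close>.\<close>
  define h where "h x = \<Lambda> (T x) / \<Lambda> (of_real t0) * exp (- of_real \<mu> * x)" for x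
  define h' where "h' x = h x * (W (T x) - of_real \<mu>)" for x
  have \<Lambda>_eq: "\<Lambda> (T x) = u x * (of_real \<beta> * T x + of_real \<gamma>) / T x" if "T x \<noteq> 0" for x
    unfolding quad[symmetric] using that by (simp add: \<Lambda>_def field_simps power2_eq_square)
  have \<Lambda>_ne: "\<Lambda> (T x) \<noteq> 0" if x: "norm x < \<epsilon>" for x
  proof -
    have y0: "T x \<noteq> 0" using near(2)[OF x] by auto
    have "Re (of_real \<beta> * T x + of_real \<gamma>) > 0" using near(2)[OF x] pos by (simp add: add_pos_pos)
    then have "of_real \<beta> * T x + of_real \<gamma> \<noteq> 0"
      by (metis less_irrefl zero_complex.simps(1))
    then show ?thesis using y0 q0 by (simp add: u_def \<Lambda>_eq)
  qed
  have dh: "(h has_field_derivative h' x) (at x)" if x: "norm x < \<epsilon>" for x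
  proof -
    define y where "y = T x"
    define B where "B = of_real \<beta> * y + of_real \<gamma>"
    have y0: "y \<noteq> 0" using near(2)[OF x] by (auto simp: y_def)
    have w0: "w x \<noteq> 0" using near(1)[OF x] w2[of x] by (metis less_irrefl zero_complex.simps(1) zero_power2)
    have "Re B > 0" using near(2)[OF x] pos by (simp add: B_def y_def add_pos_pos)
    then have B0: "B \<noteq> 0" by (metis less_irrefl zero_complex.simps(1))
    have \<Lambda>y: "\<Lambda> y = u x * B / y"
      using \<Lambda>_eq[of x] y0 by (simp add: B_def y_def)
    \<comment> \<open>\<open>w x\<close> is linear in \<open>T x\<close> and \<open>u x\<close>;
      multiplying by \<open>B\<close> lets \<open>quad\<close> replace \<open>u x * B\<close>, which
      produces the denominator of \<open>W\<close>.\<close>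
    have wB: "w x * B = of_real \<beta> * y\<^sup>2 + 2 * of_real \<gamma> * y + of_real e"
    proof -
      have "w x * B = 2 * y * B + of_real b * B - of_real \<beta> * (u x * B)"
        by (simp add: w_eq p_def algebra_simps flip: y_def)
      also have "u x * B = y\<^sup>2 + of_real b * y + 1" using quad[of x] by (simp add: B_def flip: y_def)
      finally show ?thesis by (simp add: B_def e_def algebra_simps power2_eq_square)
    qed
    have "((\<lambda>x. \<Lambda> (T x)) has_field_derivative (1 - 1 / y\<^sup>2) * (u x * B / w x)) (at x)"
    proof -
      have "(\<Lambda> has_field_derivative (1 - 1 / y\<^sup>2)) (at (T x))"
        unfolding \<Lambda>_def using y0 by (auto intro!: derivative_eq_intros simp: y_def power2_eq_square divide_inverse)
      from DERIV_chain2[OF this dT[OF near(1)[OF x]]] show ?thesis by (simp add: B_def y_def)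
    qed
    also have "(1 - 1 / y\<^sup>2) * (u x * B / w x) = \<Lambda> y * W y"
      unfolding \<Lambda>y W_def wB[symmetric] B_def[symmetric] using y0 w0 B0
      by (simp add: field_simps power2_eq_square)
    finally have "((\<lambda>x. \<Lambda> (T x)) has_field_derivative \<Lambda> (T x) * W (T x)) (at x)" by (simp add: y_def)
    then have "(h has_field_derivative (\<Lambda> (T x) * W (T x) / \<Lambda> (of_real t0) * exp (- of_real \<mu> * x) +
        exp (- of_real \<mu> * x) * (- of_real \<mu>) * (\<Lambda> (T x) / \<Lambda> (of_real t0)))) (at x)"
      unfolding h_def using \<Lambda>0 by (auto intro!: derivative_eq_intros simp: diff_divide_distrib)
    also have "(\<Lambda> (T x) * W (T x) / \<Lambda> (of_real t0) * exp (- of_real \<mu> * x) +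
        exp (- of_real \<mu> * x) * (- of_real \<mu>) * (\<Lambda> (T x) / \<Lambda> (of_real t0))) = h' x"
      by (simp add: h'_def h_def algebra_simps diff_divide_distrib)
    finally show ?thesis .
  qed
  have h0: "h 0 = 1" using \<Lambda>0 by (simp add: h_def at0)
  have h'0: "h' 0 = 0" by (simp add: h'_def at0 W0)
  have dh': "(h' has_field_derivative of_real a) (at 0)"
  proof -
    have "((\<lambda>x. W (T x)) has_field_derivative of_real (N / M\<^sup>2) * (u 0 * (of_real \<beta> * T 0 + of_real \<gamma>) / w 0)) (at 0)"
      by (rule DERIV_chain2[OF _ dT[OF Re0]]) (simp only: at0 dW)
    also have "of_real (N / M\<^sup>2) * (u 0 * (of_real \<beta> * T 0 + of_real \<gamma>) / w 0) = complex_of_real a"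
      by (simp add: at0 u_def a_def)
    finally have "((\<lambda>x. h x * (W (T x) - of_real \<mu>)) has_field_derivative
        (h' 0 * (W (T 0) - of_real \<mu>) + (of_real a - 0) * h 0)) (at 0)"
      using dh[of 0] \<epsilon> by (intro DERIV_mult DERIV_diff DERIV_const) auto
    then show ?thesis by (simp add: h'_def[abs_def] h0 at0 W0)
  qed

  \<comment> \<open>The common limit of \<open>Z\<close> over its exponential factor for the tilted
    and the untilted weight. It cancels in the quotient, being nonzero because
    \<open>t0 > 1\<close>.\<close>
  define A where "A = t0 * (1 - 1 / t0\<^sup>2) / (t0 - s0)"
  have "1 < t0\<^sup>2" using t0 by (intro one_less_power) auto
  then have "A > 0" unfolding A_def using t0 s0 by (intro divide_pos_pos mult_pos_pos) auto
  then have A: "complex_of_real A \<noteq> 0" by simp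
  have "(\<lambda>n. exp (- \<i> * of_real (s * \<mu> * sqrt (real n))) *
      Z n (of_real q * exp (\<i> * of_real (s / sqrt (real n)))) / Z n (of_real q)) \<longlonglongrightarrow>
      exp (- of_real (a * s\<^sup>2 / 2))" for s
  proof -
    define x where "x n = \<i> * complex_of_real (s / sqrt (real n))" for n
    have x0: "x \<longlonglongrightarrow> 0"
    proof -
      have "(\<lambda>n. s / sqrt (real n)) \<longlonglongrightarrow> 0" by real_asymp
      then have "(\<lambda>n. \<i> * complex_of_real (s / sqrt (real n))) \<longlonglongrightarrow> \<i> * of_real 0"
        by (intro tendsto_intros)
      then show ?thesis by (simp add: x_def[abs_def])
    qed
    have Tx: "(\<lambda>n. T (x n)) \<longlonglongrightarrow> of_real t0"
      using isCont_tendsto_compose[OF isCont_T x0] by (simp add: at0)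
    have Sx: "(\<lambda>n. S (x n)) \<longlonglongrightarrow> of_real s0"
    proof -
      have "(\<lambda>n. u (x n) * of_real \<beta> - of_real b - T (x n)) \<longlonglongrightarrow> u 0 * of_real \<beta> - of_real b - T 0"
        by (intro tendsto_intros isCont_tendsto_compose[OF isCont_T x0] isCont_tendsto_compose[OF DERIV_isCont[OF du] x0])
      moreover have "u y * of_real \<beta> - of_real b - T y = S y" for y
        using TS_sum[of y] by (simp add: algebra_simps)
      ultimately have "(\<lambda>n. S (x n)) \<longlonglongrightarrow> S 0" by (simp only:)
      then show ?thesis by (simp only: at0)
    qed
    have Zx: "(\<lambda>n. Z n (u (x n)) / \<Lambda> (T (x n)) ^ n) \<longlonglongrightarrow> of_real A"
      unfolding A_def by (rule Z_tendsto[OF Tx Sx TS_sum TS_prod t0 s0])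
    have Zq: "(\<lambda>n. Z n (u 0) / \<Lambda> (of_real t0) ^ n) \<longlonglongrightarrow> of_real A"
      unfolding A_def by (rule Z_tendsto[of "\<lambda>_. of_real t0" t0 "\<lambda>_. of_real s0"])
        (use TS_sum[of 0] TS_prod[of 0] t0 s0 in \<open>auto simp: at0\<close>)
    have H: "(\<lambda>n. h (x n) ^ n) \<longlonglongrightarrow> exp (- of_real a * of_real (s\<^sup>2) / 2)"
      unfolding x_def by (rule power_tendsto_exp_second_order[OF \<epsilon> dh dh' h0 h'0])
    have "(\<lambda>n. (Z n (u (x n)) / \<Lambda> (T (x n)) ^ n) / (Z n (u 0) / \<Lambda> (of_real t0) ^ n) * h (x n) ^ n) \<longlonglongrightarrow>
        of_real A / of_real A * exp (- of_real a * of_real (s\<^sup>2) / 2)"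
      by (intro tendsto_intros Zx Zq H A)
    also have "of_real A / of_real A * exp (- of_real a * of_real (s\<^sup>2) / 2) = exp (- complex_of_real (a * s\<^sup>2 / 2))"
      using A by simp
    finally have L: "(\<lambda>n. (Z n (u (x n)) / \<Lambda> (T (x n)) ^ n) / (Z n (u 0) / \<Lambda> (of_real t0) ^ n) * h (x n) ^ n) \<longlonglongrightarrow>
        exp (- complex_of_real (a * s\<^sup>2 / 2))" .
    have ev: "\<forall>\<^sub>F n in sequentially. norm (x n) < \<epsilon>"
      using tendstoD[OF x0 \<epsilon>] by simp
    have EV: "\<forall>\<^sub>F n in sequentially. (Z n (u (x n)) / \<Lambda> (T (x n)) ^ n) / (Z n (u 0) / \<Lambda> (of_real t0) ^ n) * h (x n) ^ n =
      exp (- \<i> * of_real (s * \<mu> * sqrt (real n))) *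
      Z n (of_real q * exp (\<i> * of_real (s / sqrt (real n)))) / Z n (of_real q)"
      using ev eventually_gt_at_top[of 0]
    proof eventually_elim
      case (elim n)
      have E: "exp (- of_real \<mu> * x n) ^ n = exp (- \<i> * of_real (s * \<mu> * sqrt (real n)))"
      proof -
        have "real n * (s / sqrt (real n)) = s * sqrt (real n)"
          using elim by (simp add: field_simps)
        then have "complex_of_real (real n * (s / sqrt (real n))) = of_real (s * sqrt (real n))" by simp
        then have "of_nat n * x n = \<i> * of_real (s * sqrt (real n))"
          unfolding x_def by (simp only: of_real_mult of_real_of_nat_eq mult.left_commute)
        then have "of_nat n * (- of_real \<mu> * x n) = - \<i> * of_real (s * \<mu> * sqrt (real n))"
          by (simp add: mult_ac)
        then show ?thesis by (simp only: exp_of_nat_mult[symmetric])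
      qed
      have cancel: "(X / L ^ n) / (Y / M ^ n) * (L / M * e) ^ n = e ^ n * X / Y" if "L \<noteq> 0" "M \<noteq> 0" for X Y L M e :: complex
        using that by (cases "Y = 0") (simp_all add: field_simps)
      show ?case
        unfolding h_def cancel[OF \<Lambda>_ne[OF elim(1)] \<Lambda>0] E
        by (simp add: u_def x_def)
    qed
    show ?thesis by (rule Lim_transform_eventually[OF L EV])
  qed
  then show ?thesis using a by blast
qed

end

section \<open>The phase transition\<close>

context weighted_walks
begin

lemma weights_eq_g:
  "real (f n k) * q ^ k / (\<Sum>j\<le>n. real (f n j) * q ^ j) =
    g n k * (q * \<tau>) ^ k / (\<Sum>j\<le>n. g n j * (q * \<tau>) ^ j)"
proof -
  have *: "g n k * (q * \<tau>) ^ k = real (f n k) * q ^ k / (b + 2) ^ n" for k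
    using \<tau> by (simp add: g_def power_mult_distrib)
  have "(b + 2) ^ n \<noteq> 0" using b by simp
  then show ?thesis unfolding * by (simp flip: sum_divide_distrib)
qed

lemma weak_conv_subcritical:
  assumes p: "\<And>n k. pmf (p n) k = real (f n k) * q ^ k / (\<Sum>j\<le>n. real (f n j) * q ^ j)"
    and q: "0 < q" "q * \<tau> < 1"
  shows "weak_conv_m (\<lambda>n. distr (measure_pmf (p n)) borel (\<lambda>k. real k - 1))
    (distr (measure_pmf (neg_binomial_pmf 2 (1 - q * \<tau>))) borel real)"
proof (rule weak_conv_m_shifted_pmf)
  have x: "0 < q * \<tau>" using q \<tau> by simp
  note lim = subcritical_limit[OF x q(2)]
  show "(\<lambda>n. pmf (p n) 0) \<longlonglongrightarrow> 0"
    unfolding p weights_eq_g using lim[of 0] by simp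
  show "(\<lambda>n. pmf (p n) (Suc k)) \<longlonglongrightarrow> pmf (neg_binomial_pmf 2 (1 - q * \<tau>)) k" for k
  proof -
    have "pmf (neg_binomial_pmf 2 (1 - q * \<tau>)) k = (1 - q * \<tau>)\<^sup>2 * (real (Suc k) * (q * \<tau>) ^ (Suc k - 1))"
      using x q by (subst pmf_neg_binomial) auto
    then show ?thesis
      unfolding p weights_eq_g using lim[of "Suc k"] by (simp only:)
  qed
qed

lemma weak_conv_critical:
  assumes p: "\<And>n k. pmf (p n) k = real (f n k) * q ^ k / (\<Sum>j\<le>n. real (f n j) * q ^ j)"
    and q: "q * \<tau> = 1"
  shows "weak_conv_m (\<lambda>n. distr (measure_pmf (p n)) borel (\<lambda>k. scale * (real k / sqrt (real n))))
    (rayleigh_distribution (sqrt 2))"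
  unfolding rayleigh_distribution_def
proof (rule weak_conv_m_local_limit[OF scale_pos])
  show "rayleigh_density (sqrt 2) \<in> borel_measurable borel"
    unfolding rayleigh_density_def[abs_def] by measurable
  show "(\<integral>\<^sup>+y. ennreal (rayleigh_density (sqrt 2) y) \<partial>lborel) = 1"
    by (rule nn_integral_rayleigh_density) simp
  show "(\<lambda>n. sqrt (real n) / scale * pmf (p n) (nat \<lfloor>y * sqrt (real n) / scale\<rfloor>)) \<longlonglongrightarrow> rayleigh_density (sqrt 2) y"
    if "y > 0" for y
    using critical_local_limit[OF that] that unfolding p weights_eq_g q
    by (simp add: rayleigh_density_def)
qed (auto simp: rayleigh_density_def)

lemma weak_conv_supercritical:
  assumes p: "\<And>n k. pmf (p n) k = real (f n k) * q ^ k / (\<Sum>j\<le>n. real (f n j) * q ^ j)"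
    and q: "q > 1 / \<tau>"
  shows "\<exists>\<mu> \<sigma>. \<sigma> > 0 \<and>
    weak_conv_m (\<lambda>n. distr (measure_pmf (p n)) borel (\<lambda>k. (real k - \<mu> * real n) / (\<sigma> * sqrt (real n))))
      std_normal_distribution"
proof -
  obtain \<mu> a where a: "a > 0" and lim: "\<And>s. (\<lambda>n. exp (- \<i> * of_real (s * \<mu> * sqrt (real n))) *
      Z n (of_real q * exp (\<i> * of_real (s / sqrt (real n)))) / Z n (of_real q)) \<longlonglongrightarrow>
      exp (- of_real (a * s\<^sup>2 / 2))"
    using supercritical_limit[OF q] by blast
  define \<sigma> where "\<sigma> = sqrt a"
  have \<sigma>: "\<sigma> > 0" "\<sigma>\<^sup>2 = a" using a by (auto simp: \<sigma>_def)
  define h where "h n k = (real k - \<mu> * real n) / (\<sigma> * sqrt (real n))" for n k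
  have "weak_conv_m (\<lambda>n. distr (measure_pmf (p n)) borel (h n)) std_normal_distribution"
  proof (rule levy_continuity)
    show "real_distribution (distr (measure_pmf (p n)) borel (h n))" for n
      by (rule prob_space.real_distribution_distr[OF measure_pmf.prob_space_axioms]) simp
    show "real_distribution std_normal_distribution" by (rule real_dist_normal_dist)
    fix s :: real
    \<comment> \<open>\<open>supercritical_limit\<close> has variance \<open>a\<close> in place of
      \<open>1\<close>; evaluating it at \<open>s / \<sigma>\<close> accounts for the division by
      \<open>\<sigma>\<close> in \<open>h\<close>.\<close>
    define s' where "s' = s / \<sigma>"
    have "\<forall>\<^sub>F n in sequentially. exp (- \<i> * of_real (s' * \<mu> * sqrt (real n))) *
      Z n (of_real q * exp (\<i> * of_real (s' / sqrt (real n)))) / Z n (of_real q) = char (distr (measure_pmf (p n)) borel (h n)) s"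
      using eventually_gt_at_top[of 0]
    proof eventually_elim
      case (elim n)
      define c where "c = exp (- \<i> * of_real (s' * \<mu> * sqrt (real n)))"
      define d where "d = exp (\<i> * of_real (s' / sqrt (real n)))"
      have e: "iexp (s * h n k) = c * d ^ k" for k
      proof -
        have "s * h n k = real k * (s' / sqrt (real n)) - s' * \<mu> * (real n / sqrt (real n))"
          by (simp add: h_def s'_def diff_divide_distrib algebra_simps)
        also have "real n / sqrt (real n) = sqrt (real n)" by (rule real_div_sqrt) simp
        finally have eq: "s * h n k = real k * (s' / sqrt (real n)) - s' * \<mu> * sqrt (real n)" .
        have "\<i> * complex_of_real (s * h n k) = - \<i> * of_real (s' * \<mu> * sqrt (real n)) + of_nat k * (\<i> * of_real (s' / sqrt (real n)))"
          unfolding eq by (simp add: algebra_simps)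
        then show ?thesis unfolding c_def d_def by (simp only: exp_add exp_of_nat_mult)
      qed
      have "char (distr (measure_pmf (p n)) borel (h n)) s = (LINT k|measure_pmf (p n). iexp (s * h n k))"
        unfolding char_def by (rule integral_distr) auto
      also have "\<dots> = (\<Sum>k\<le>n. pmf (p n) k *\<^sub>R iexp (s * h n k))"
      proof (rule integral_measure_pmf)
        fix k assume "k \<in> set_pmf (p n)"
        then have "f n k \<noteq> 0" by (auto simp: set_pmf_iff p)
        then show "k \<in> {..n}"
          using f[of n k] walk_coeff_eq_0[of n k] by (metis atMost_iff not_le of_nat_eq_0_iff)
      qed simp
      also have "\<dots> = c * Z n (of_real q * d) / Z n (of_real q)"
      proof -
        have "complex_of_real (\<Sum>j\<le>n. real (f n j) * q ^ j) = Z n (of_real q)" by (simp add: Z_def)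
        then have "pmf (p n) k *\<^sub>R iexp (s * h n k) = c * (of_nat (f n k) * (of_real q * d) ^ k) / Z n (of_real q)" for k
          unfolding p e scaleR_conv_of_real of_real_divide by (simp add: power_mult_distrib)
        then show ?thesis
          by (simp add: Z_def sum_distrib_left flip: sum_divide_distrib)
      qed
      finally show ?case by (simp only: c_def d_def)
    qed
    with lim[of s'] have "(\<lambda>n. char (distr (measure_pmf (p n)) borel (h n)) s) \<longlonglongrightarrow> exp (- of_real (a * s'\<^sup>2 / 2))"
      by (rule Lim_transform_eventually)
    moreover have "a * s'\<^sup>2 = s\<^sup>2" using \<sigma> a by (simp add: s'_def power_divide)
    ultimately show "(\<lambda>n. char (distr (measure_pmf (p n)) borel (h n)) s) \<longlonglongrightarrow> char std_normal_distribution s"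
      by (simp add: char_std_normal_distribution exp_of_real[symmetric])
  qed
  then show ?thesis using \<sigma> unfolding h_def by blast
qed

end

lemma weighted_walks_paths:
  "weighted_walks (fam_b F) (fam_beta F) (fam_gamma F) (\<lambda>n. num_objects (paths F n) returns)"
proof unfold_locales
  show "of_nat (num_objects (paths F n) returns k) = walk_coeff (fam_b F) (fam_beta F) (fam_gamma F) n 0 k" for n k
    by (rule num_objects_paths)
qed (cases F; simp)+

text \<open>The normalising sum passes from the attained values to the indices up to
  \<open>n\<close>; the counts vanish both off the image and above \<open>n\<close>.\<close>

lemma pmf_returns_pmf:
  assumes "q > 0"
  shows "pmf (returns_pmf F q n) k = real (num_objects (paths F n) returns k) * q ^ k /
    (\<Sum>j\<le>n. real (num_objects (paths F n) returns j) * q ^ j)"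
proof -
  let ?N = "num_objects (paths F n) returns"
  have gt: "?N j = 0" if "n < j" for j
    using num_objects_paths[of F n j] walk_coeff_eq_0[OF that] by simp
  have notin: "?N j = 0" if "j \<notin> returns ` paths F n" for j
  proof -
    have "{t \<in> paths F n. returns t = j} = {}" using that by auto
    then show ?thesis by (simp only: num_objects_def card.empty)
  qed
  have "(\<Sum>j\<in>returns ` paths F n. real (?N j) * q ^ j) = (\<Sum>j\<in>returns ` paths F n \<union> {..n}. real (?N j) * q ^ j)"
    using notin finite_paths by (intro sum.mono_neutral_left) auto
  also have "\<dots> = (\<Sum>j\<le>n. real (?N j) * q ^ j)"
    using gt finite_paths by (intro sum.mono_neutral_right) (auto simp: not_le)
  finally show ?thesis
    unfolding returns_pmf_def using pmf_gibbs_pmf[OF finite_paths paths_nonempty assms] by simp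
qed

theorem theorem9:
  fixes F :: path_family and q :: real
  assumes "q > 0"
  shows "(q < q_c F \<longrightarrow>
            weak_conv_m
              (\<lambda>n. distr (measure_pmf (returns_pmf F q n)) borel (\<lambda>k. real k - 1))
              (distr (measure_pmf (neg_binomial_pmf 2 (1 - q * tau_H F))) borel real)) \<and>
         (q = q_c F \<longrightarrow>
            weak_conv_m
              (\<lambda>n. distr (measure_pmf (returns_pmf F q n)) borel
                     (\<lambda>k. (- c_H F) / tau_H F * (real k / sqrt (real n))))
              (rayleigh_distribution (sqrt 2))) \<and>
         (q > q_c F \<longrightarrow>
            (\<exists>\<mu> \<sigma>. \<sigma> > 0 \<and>
               weak_conv_m
                 (\<lambda>n. distr (measure_pmf (returns_pmf F q n)) borel
                        (\<lambda>k. (real k - \<mu> * real n) / (\<sigma> * sqrt (real n))))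
                 std_normal_distribution))"
proof -
  interpret weighted_walks "fam_b F" "fam_beta F" "fam_gamma F" "\<lambda>n. num_objects (paths F n) returns"
    by (rule weighted_walks_paths)
  have \<tau>_eq: "\<tau> = tau_H F" and qc: "q_c F = 1 / tau_H F" and \<tau>_pos: "tau_H F > 0"
    unfolding \<tau>_def by (cases F; simp)+
  have scale_eq: "(- c_H F) / tau_H F = scale"
    unfolding scale_def \<kappa>_def
    by (cases F) (simp_all add: field_simps)
  note p = pmf_returns_pmf[OF assms]
  show ?thesis
  proof (intro conjI impI)
    assume "q < q_c F"
    then have "q * \<tau> < 1" using \<tau>_pos by (simp add: \<tau>_eq qc field_simps)
    from weak_conv_subcritical[OF p assms this]
    show "weak_conv_m (\<lambda>n. distr (measure_pmf (returns_pmf F q n)) borel (\<lambda>k. real k - 1))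
        (distr (measure_pmf (neg_binomial_pmf 2 (1 - q * tau_H F))) borel real)"
      unfolding \<tau>_eq .
  next
    assume "q = q_c F"
    then have "q * \<tau> = 1" using \<tau>_pos by (simp add: \<tau>_eq qc)
    from weak_conv_critical[OF p this]
    show "weak_conv_m (\<lambda>n. distr (measure_pmf (returns_pmf F q n)) borel
        (\<lambda>k. (- c_H F) / tau_H F * (real k / sqrt (real n)))) (rayleigh_distribution (sqrt 2))"
      unfolding scale_eq .
  next
    assume "q > q_c F"
    then have "q > 1 / \<tau>" by (simp add: \<tau>_eq qc)
    from weak_conv_supercritical[OF p this]
    show "\<exists>\<mu> \<sigma>. \<sigma> > 0 \<and> weak_conv_m (\<lambda>n. distr (measure_pmf (returns_pmf F q n)) borel
        (\<lambda>k. (real k - \<mu> * real n) / (\<sigma> * sqrt (real n)))) std_normal_distribution" .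
  qed
qed

end
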